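(* Let $F_7:=(6,\{02,04,15\})$. Then $\lambda_{F_7}=160/729$. Furthermore, the $F_7$-problem is perfectly $B$-stable with $B:=(9,\{02,01,12,34,35,45,67,68,78\})$, and the unique (up to automorphisms of $B$) maximiser of $p(F_7,B(\boldsymbol x))$ over $\boldsymbol x\in\mathbb S_9$ is $\boldsymbol x=(1/9,1/9,1/9,1/9,1/9,1/9,1/9,1/9,1/9)$.
   Context: All graphs are finite and simple. $(m,E)$ denotes the graph or pattern with vertex set $\{0,\dots,m-1\}$ and edge set $E$; $ij$ abbreviates $\{i,j\}$ ($ii$ is a loop). For graphs $F,G$ with $\kappa\le n$ vertices, $p(F,G)$ is the number of $\kappa$-subsets of $V(G)$ inducing a subgraph isomorphic to $F$, divided by $\binom n\kappa$; $p(F,n)$ is the maximum of $p(F,G)$ over $n$-vertex graphs $G$; $\lambda_F=\lim_{n\to\infty}p(F,n)$ (the limit exists). A pattern is a graph in which loops are allowed; its automorphisms are the bijections of the vertex set preserving edges, non-edges, loops and non-loops. For a pattern $B$ on $\{0,\dots,m-1\}$ and disjoint (possibly empty) sets $V_0,\dots,V_{m-1}$, the blowup $B(V_0,\dots,V_{m-1})$ is the simple graph on $\bigcup V_i$ in which distinct $x\in V_i$, $y\in V_j$ are adjacent iff $\{i,j\}\in E(B)$ (so $V_i$ is a clique if $i$ has a loop and independent otherwise); $B()$ is the family of all blowups. $\mathbb S_m=\{\boldsymbol x\in\mathbb R^m:x_i\ge0,\sum x_i=1\}$, and $p(F,B(\boldsymbol x))$ is the limit as $n\to\infty$ of $p(F,B(V_0,\dots,V_{m-1}))$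 with $|V_i|=(x_i+o(1))n$. $\delta_{\mathrm{edit}}(G,B())$ is the minimum number of vertex pairs whose adjacency must be changed to turn $G$ into a graph isomorphic to a blowup of $B$ (of the same order). The $F$-problem is perfectly $B$-stable if there is $C>0$ such that every graph $G$ with $n\ge C$ vertices satisfies $\delta_{\mathrm{edit}}(G,B())\le C\,(p(F,n)-p(F,G))\,n^2$. *)

theory Defs
  imports Complex_Main "HOL-Library.Disjoint_Sets"
begin

text \<open>
  Graphs and patterns are pairs \<open>(V, E)\<close> with \<open>E\<close> a set of unordered pairs \<open>{x, y}\<close>.
  A loop at \<open>x\<close> is \<open>{x, x}\<close>, that is, the singleton \<open>{x}\<close>.
\<close>

type_synonym 'a pattern = "'a set \<times> 'a set set"

abbreviation verts :: "'a pattern \<Rightarrow> 'a set" where "verts G \<equiv> fst G"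
abbreviation edges :: "'a pattern \<Rightarrow> 'a set set" where "edges G \<equiv> snd G"

definition is_graph :: "'a pattern \<Rightarrow> bool" where
  "is_graph G \<longleftrightarrow> finite (verts G) \<and>
     (\<forall>e\<in>edges G. \<exists>x\<in>verts G. \<exists>y\<in>verts G. x \<noteq> y \<and> e = {x, y})"

definition induced :: "'a pattern \<Rightarrow> 'a set \<Rightarrow> 'a pattern" where
  "induced G S = (S, {e \<in> edges G. e \<subseteq> S})"

text \<open>The case \<open>x = y\<close> below says that loops and non-loops are preserved.\<close>

definition is_iso :: "('a \<Rightarrow> 'b) \<Rightarrow> 'a pattern \<Rightarrow> 'b pattern \<Rightarrow> bool" where
  "is_iso f G H \<longleftrightarrow> bij_betw f (verts G) (verts H) \<and>
     (\<forall>x\<in>verts G. \<forall>y\<in>verts G. {x, y} \<in> edges G \<longleftrightarrow> {f x, f y} \<in> edges H)"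

definition isomorphic :: "'a pattern \<Rightarrow> 'b pattern \<Rightarrow> bool" where
  "isomorphic G H \<longleftrightarrow> (\<exists>f. is_iso f G H)"

definition automorphism :: "('a \<Rightarrow> 'a) \<Rightarrow> 'a pattern \<Rightarrow> bool" where
  "automorphism f G \<longleftrightarrow> is_iso f G G"

definition density :: "'b pattern \<Rightarrow> 'a pattern \<Rightarrow> real" where
  "density F G =
     real (card {S. S \<subseteq> verts G \<and> card S = card (verts F) \<and> isomorphic (induced G S) F})
       / real (card (verts G) choose card (verts F))"

text \<open>
  Every finite graph has an isomorphic copy with vertices in \<^typ>\<open>nat\<close>, so quantifying over
  graphs on natural numbers loses nothing.  The maximum ranges over finitely many values.
\<close>

definition max_density :: "'b pattern \<Rightarrow> nat \<Rightarrow> real" where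
  "max_density F n = Max {density F G | G :: nat pattern. is_graph G \<and> card (verts G) = n}"

definition inducibility :: "'b pattern \<Rightarrow> real" where
  "inducibility F = lim (\<lambda>n. max_density F n)"

definition blowup :: "'i pattern \<Rightarrow> ('i \<Rightarrow> 'a set) \<Rightarrow> 'a pattern" where
  "blowup B P =
     (\<Union>i\<in>verts B. P i,
      {{x, y} | x y. x \<noteq> y \<and>
         (\<exists>i\<in>verts B. \<exists>j\<in>verts B. x \<in> P i \<and> y \<in> P j \<and> {i, j} \<in> edges B)})"

definition blowup_parts :: "'i pattern \<Rightarrow> ('i \<Rightarrow> 'a set) \<Rightarrow> bool" where
  "blowup_parts B P \<longleftrightarrow> (\<forall>i\<in>verts B. finite (P i)) \<and> disjoint_family_on P (verts B)"

definition edit_dist :: "'a pattern \<Rightarrow> 'i pattern \<Rightarrow> nat" where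
  "edit_dist G B = (LEAST k. \<exists>H (P :: 'i \<Rightarrow> 'a set).
     is_graph H \<and> verts H = verts G \<and>
     blowup_parts B P \<and> isomorphic H (blowup B P) \<and>
     k = card ((edges G - edges H) \<union> (edges H - edges G)))"

definition perfectly_stable :: "'b pattern \<Rightarrow> 'i pattern \<Rightarrow> bool" where
  "perfectly_stable F B \<longleftrightarrow> (\<exists>C::real. C > 0 \<and>
     (\<forall>G :: nat pattern. is_graph G \<longrightarrow> real (card (verts G)) \<ge> C \<longrightarrow>
        real (edit_dist G B) \<le>
          C * (max_density F (card (verts G)) - density F G) * (real (card (verts G)))\<^sup>2))"

text \<open>
  Points of \<open>\<real>\<^sup>m\<close> are functions \<^typ>\<open>nat \<Rightarrow> real\<close> of which only the values on \<open>{..<m}\<close> matter.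
\<close>

definition std_simplex :: "nat \<Rightarrow> (nat \<Rightarrow> real) set" where
  "std_simplex m = {x. (\<forall>i<m. 0 \<le> x i) \<and> (\<Sum>i<m. x i) = 1}"

text \<open>
  The common limit over all sequences of part tuples with \<open>|V\<^sub>i| = (x\<^sub>i + o(1)) n\<close>.
\<close>

definition limit_density :: "'b pattern \<Rightarrow> 'i pattern \<Rightarrow> ('i \<Rightarrow> real) \<Rightarrow> real" where
  "limit_density F B x = (THE L. \<forall>P :: nat \<Rightarrow> 'i \<Rightarrow> nat set.
     (\<forall>n. blowup_parts B (P n)) \<longrightarrow>
     (\<forall>i\<in>verts B. (\<lambda>n. real (card (P n i)) / real n) \<longlonglongrightarrow> x i) \<longrightarrow>
     (\<lambda>n. density F (blowup B (P n))) \<longlonglongrightarrow> L)"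

definition maximiser :: "'b pattern \<Rightarrow> nat \<Rightarrow> nat pattern \<Rightarrow> (nat \<Rightarrow> real) \<Rightarrow> bool" where
  "maximiser F m B x \<longleftrightarrow> is_arg_max (limit_density F B) (\<lambda>y. y \<in> std_simplex m) x"

definition unique_maximiser_up_to_aut ::
    "'b pattern \<Rightarrow> nat \<Rightarrow> nat pattern \<Rightarrow> (nat \<Rightarrow> real) \<Rightarrow> bool" where
  "unique_maximiser_up_to_aut F m B x \<longleftrightarrow> maximiser F m B x \<and>
     (\<forall>y. maximiser F m B y \<longrightarrow> (\<exists>\<sigma>. automorphism \<sigma> B \<and> (\<forall>i<m. y i = x (\<sigma> i))))"

definition F7 :: "nat pattern" where
  "F7 = ({..<6}, {{0,2}, {0,4}, {1,5}})"

definition B9 :: "nat pattern" where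
  "B9 = ({..<9}, {{0,2}, {0,1}, {1,2}, {3,4}, {3,5}, {4,5}, {6,7}, {6,8}, {7,8}})"

end

theory Submission
  imports Defs "HOL-Library.List_Lexorder" "HOL-Combinatorics.Multiset_Permutations"
begin

text \<open>
  The proof is an exact flag-algebra computation on seven vertices, which is first used to bound the
  density and then run backwards to recover the structure.

  All counts are taken over lists of vertices in which repetitions are allowed, each list weighted by
  the product of the weights of its entries.  Then averaging arguments become polynomial identities
  in the weights, without error terms, and they apply equally to a graph (all weights 1) and to the
  limit of a blowup (nine vertices, weighted by the part sizes).

  The pattern is a path on three vertices, an edge and an isolated vertex.  Deleting an end of the
  path leaves two disjoint edges and an isolated vertex, and no other deletion of a vertex does so.
  Hence copies of the pattern correspond to pairs of a five-vertex list \<open>t\<close> that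
  induces \<open>2K\<^sub>2 + K\<^sub>1\<close> and a vertex \<open>x\<close> adjacent to exactly one entry of \<open>t\<close>, which lies on an edge
  (\<open>leaf_total_eq_F7_lists\<close>).  Write \<open>L\<close> for the number of such pairs and \<open>W\<close> for the total weight.
  For ten graphs \<open>t\<close> on five vertices the certificate provides a positive semidefinite quadratic form
  in the numbers of vertices that are attached to \<open>t\<close> in the various ways.  Averaging over all lists
  of length seven gives (\<open>slack_identity\<close>)

    \<open>57600 W\<^sup>7 = 787320 W L + (sum of the forms over all t) + (sum of the slacks) / 21\<close>,

  where the slack is an integer attached to each graph on seven vertices.  A finite check shows that
  it is never negative (\<open>slack7_nonneg\<close>), so \<open>L \<le> (160 / 2187) W\<^sup>6\<close>, which is the upper bound
  \<open>3 * 160 / 2187 = 160 / 729\<close> for the density.  Three disjoint triangles with equal weights attain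
  it; therefore every form and every slack vanishes on that pattern (\<open>b9_tight\<close>), a fact that would
  be tedious to verify directly and that all later arguments exploit.

  Uniqueness and stability use three disjoint edges as a coordinate system.  In a blowup of three
  triangles, the part of a vertex can be read off from its adjacency to an induced \<open>3K\<^sub>2\<close>.  If the forms
  of the six lists that arise by deleting one vertex of the \<open>3K\<^sub>2\<close> are small, then the nine parts have
  almost equal size (\<open>parts_balanced\<close>).  A vertex with an impossible attachment, and a pair of
  vertices whose adjacency contradicts their parts, lie in lists with positive slack
  (\<open>slack7_bad_attachment\<close>, \<open>slack7_wrong_pair\<close>).

  For stability, let \<open>G\<close> have almost the maximal density.  The identity makes the total slack and the
  total of the forms small; in particular there are many induced \<open>3K\<^sub>2\<close>, and by averaging one of them
  defines nine almost equal parts such that the number \<open>D\<close> of wrongly joined pairs is at most a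
  constant times the total slack divided by \<open>n\<^sup>5\<close> (\<open>near_blowup\<close>).  Let \<open>H\<close> be the blowup on these
  parts and subtract the identity for \<open>H\<close> from that for \<open>G\<close>.  The slack of \<open>H\<close> is zero, and the forms of
  \<open>H\<close> are tiny because they vanish on the balanced blowup, so that changing \<open>D\<close> pairs decreases them by
  at most a small multiple of \<open>D n\<^sup>5\<close> (\<open>sum_gram_form_comparison\<close>).  Hence \<open>H\<close> has at least
  \<open>c D n\<^sup>4\<close> more leaf pairs than \<open>G\<close>.  Lists with repeated entries change this by \<open>O(D n\<^sup>3)\<close> only, so
  the edit distance, which is at most \<open>D\<close>, is bounded linearly by the deficit of \<open>G\<close>.
\<close>

section \<open>Lists over a vertex set and their weights\<close>

definition tup :: "'a set \<Rightarrow> nat \<Rightarrow> 'a list set" where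
  "tup V k = {xs. set xs \<subseteq> V \<and> length xs = k}"

definition weight :: "('a \<Rightarrow> real) \<Rightarrow> 'a list \<Rightarrow> real" where
  "weight w xs = (\<Prod>x\<leftarrow>xs. w x)"

definition del_at :: "nat \<Rightarrow> 'a list \<Rightarrow> 'a list" where
  "del_at i xs = take i xs @ drop (Suc i) xs"

lemma del_at_simps [simp]: "del_at 0 (x # xs) = xs" "del_at (Suc i) (x # xs) = x # del_at i xs"
  by (simp_all add: del_at_def)

lemma weight_simps [simp]: "weight w [] = 1" "weight w (x # xs) = w x * weight w xs"
  by (simp_all add: weight_def)

lemma weight_one [simp]: "weight (\<lambda>_. 1) xs = 1"
  by (induction xs) auto

lemma finite_tup [simp]: "finite V \<Longrightarrow> finite (tup V k)"
  unfolding tup_def by (rule finite_lists_length_eq)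

lemma card_tup: "finite V \<Longrightarrow> card (tup V k) = card V ^ k"
  unfolding tup_def by (rule card_lists_length_eq)

lemma tup_0 [simp]: "tup V 0 = {[]}"
  by (auto simp: tup_def)

lemma tup_Suc: "tup V (Suc k) = (\<lambda>(x, xs). x # xs) ` (V \<times> tup V k)"
  by (auto simp: tup_def length_Suc_conv image_iff)

lemma sum_tup_Suc:
  assumes "finite V"
  shows "(\<Sum>xs\<in>tup V (Suc k). f xs) = (\<Sum>x\<in>V. \<Sum>xs\<in>tup V k. f (x # xs))"
proof -
  have "inj_on (\<lambda>(x, xs). x # xs) (V \<times> tup V k)"
    by (auto simp: inj_on_def)
  then show ?thesis
    by (simp add: tup_Suc sum.reindex sum.cartesian_product case_prod_unfold)
qed

lemma weight_nonneg: "(\<And>x. x \<in> V \<Longrightarrow> 0 \<le> w x) \<Longrightarrow> xs \<in> tup V k \<Longrightarrow> 0 \<le> weight w xs"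
  unfolding tup_def by (induction xs arbitrary: k) auto

lemma sum_weight_tup: "finite V \<Longrightarrow> (\<Sum>xs\<in>tup V k. weight w xs) = (\<Sum>x\<in>V. w x) ^ k"
proof (induction k)
  case (Suc k)
  then show ?case
    by (simp add: sum_tup_Suc sum_distrib_left [symmetric] sum_distrib_right [symmetric])
qed simp

text \<open>
  Singling out one entry turns a sum over long lists into a sum over shorter lists and one
  further vertex.
\<close>

lemma sum_tup_del_at:
  assumes "finite V" "i \<le> k"
  shows "(\<Sum>xs\<in>tup V (Suc k). weight w xs * f (del_at i xs) (xs ! i)) =
         (\<Sum>t\<in>tup V k. \<Sum>x\<in>V. weight w t * w x * f t x)"
  using assms(2)
proof (induction i arbitrary: k f)
  case 0
  show ?case
    by (subst sum_tup_Suc [OF assms(1)], subst sum.swap) (simp add: mult_ac)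
next
  case (Suc i)
  then obtain k' where k: "k = Suc k'" "i \<le> k'"
    by (metis Suc_le_D Suc_le_mono)
  have "(\<Sum>xs\<in>tup V (Suc k). weight w xs * f (del_at (Suc i) xs) (xs ! Suc i)) =
    (\<Sum>y\<in>V. w y * (\<Sum>xs\<in>tup V (Suc k'). weight w xs * f (y # del_at i xs) (xs ! i)))"
    unfolding k(1) by (subst sum_tup_Suc [OF assms(1)]) (simp add: sum_distrib_left mult_ac)
  also have "\<dots> = (\<Sum>y\<in>V. w y * (\<Sum>t\<in>tup V k'. \<Sum>x\<in>V. weight w t * w x * f (y # t) x))"
    by (simp add: Suc.IH [OF k(2), of "\<lambda>t. f (y # t)" for y])
  also have "\<dots> = (\<Sum>t\<in>tup V k. \<Sum>x\<in>V. weight w t * w x * f t x)"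
    unfolding k(1) by (subst sum_tup_Suc [OF assms(1)]) (simp add: sum_distrib_left mult_ac)
  finally show ?case .
qed

lemma sum_tup_del_at2:
  assumes V: "finite V" and ij: "j \<le> k" "i \<le> Suc k"
  shows "(\<Sum>xs\<in>tup V (Suc (Suc k)). weight w xs * f (del_at j (del_at i xs)) (del_at i xs ! j) (xs ! i)) =
         (\<Sum>t\<in>tup V k. \<Sum>y\<in>V. \<Sum>x\<in>V. weight w t * w y * w x * f t y x)"
proof -
  have "(\<Sum>xs\<in>tup V (Suc (Suc k)). weight w xs * f (del_at j (del_at i xs)) (del_at i xs ! j) (xs ! i)) =
    (\<Sum>t\<in>tup V (Suc k). \<Sum>x\<in>V. weight w t * w x * f (del_at j t) (t ! j) x)"
    using sum_tup_del_at [OF V ij(2), of w "\<lambda>t x. f (del_at j t) (t ! j) x"] by simp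
  also have "\<dots> = (\<Sum>t\<in>tup V (Suc k). weight w t * (\<Sum>x\<in>V. w x * f (del_at j t) (t ! j) x))"
    by (simp add: sum_distrib_left mult_ac)
  also have "\<dots> = (\<Sum>t\<in>tup V k. \<Sum>y\<in>V. weight w t * w y * (\<Sum>x\<in>V. w x * f t y x))"
    using sum_tup_del_at [OF V ij(1), of w "\<lambda>t y. \<Sum>x\<in>V. w x * f t y x"] by simp
  finally show ?thesis
    by (simp add: sum_distrib_left mult_ac)
qed

text \<open>
  A quantity that depends only on the parts of the vertices sees the graph as a pattern whose
  vertices are weighted by the sizes of the parts.
\<close>

lemma sum_tup_map:
  fixes f :: "'b list \<Rightarrow> real"
  assumes V: "finite V" and B: "finite B" and p: "p ` V \<subseteq> B"
  shows "(\<Sum>xs\<in>tup V k. f (map p xs)) =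
         (\<Sum>ys\<in>tup B k. weight (\<lambda>i. real (card {x \<in> V. p x = i})) ys * f ys)"
proof (induction k arbitrary: f)
  case (Suc k)
  have "(\<Sum>xs\<in>tup V (Suc k). f (map p xs)) = (\<Sum>x\<in>V. \<Sum>xs\<in>tup V k. f (p x # map p xs))"
    by (simp add: sum_tup_Suc V)
  also have "\<dots> = (\<Sum>x\<in>V. \<Sum>ys\<in>tup B k. weight (\<lambda>i. real (card {x \<in> V. p x = i})) ys * f (p x # ys))"
    by (simp add: Suc.IH [of "\<lambda>ys. f (p x # ys)" for x])
  also have "\<dots> = (\<Sum>i\<in>B. \<Sum>x\<in>{x \<in> V. p x = i}. \<Sum>ys\<in>tup B k.
      weight (\<lambda>i. real (card {x \<in> V. p x = i})) ys * f (p x # ys))"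
    by (rule sum.group [symmetric, OF V B p])
  also have "\<dots> = (\<Sum>ys\<in>tup B (Suc k). weight (\<lambda>i. real (card {x \<in> V. p x = i})) ys * f ys)"
    by (simp add: sum_tup_Suc B sum_distrib_left mult_ac)
  finally show ?case .
qed simp

text \<open>Swaps of neighbouring entries generate all rearrangements of a list.\<close>

lemma mset_invariant_if_swap_invariant:
  assumes swap: "\<And>us x y vs. f (us @ x # y # vs) = f (us @ y # x # vs)"
    and "mset xs = mset ys"
  shows "f xs = f ys"
  using assms
proof (induction xs arbitrary: ys f)
  case (Cons x xs)
  have move: "f (us @ x # vs) = f (x # us @ vs)" for us vs
  proof (induction us arbitrary: vs rule: rev_induct)
    case (snoc u us)
    have "f ((us @ [u]) @ x # vs) = f (us @ x # u # vs)"
      using Cons.prems(1) [of us u x vs] by simp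
    then show ?case
      using snoc [of "u # vs"] by simp
  qed simp
  from Cons.prems(2) have "x \<in> set ys"
    by (metis list.set_intros(1) set_mset_mset)
  then obtain us vs where ys: "ys = us @ x # vs"
    by (meson split_list)
  then have m: "mset xs = mset (us @ vs)"
    using Cons.prems(2) by simp
  have "f (x # xs) = f (x # (us @ vs))"
  proof (rule Cons.IH [where f = "\<lambda>zs. f (x # zs)", OF _ m])
    show "f (x # us' @ y # z # vs') = f (x # us' @ z # y # vs')" for us' y z vs'
      using Cons.prems(1) [of "x # us'" y z vs'] by simp
  qed
  then show ?case
    using move [of us vs] ys by simp
qed simp

lemma del_at_nth_less: "j < i \<Longrightarrow> i < length xs \<Longrightarrow> del_at i xs ! j = xs ! j"
  by (simp add: del_at_def nth_append)

lemma mset_del_at: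
  assumes "i < length xs"
  shows "mset (xs ! i # del_at i xs) = mset xs"
proof -
  have "mset xs = mset (take i xs @ xs ! i # drop (Suc i) xs)"
    using id_take_nth_drop [OF assms] by (rule arg_cong)
  then show ?thesis
    by (simp add: del_at_def)
qed

lemma set_del_at_coincidence:
  assumes "j < i" "i < length ys" "ys ! j = ys ! i"
  shows "set (del_at i ys) = set ys"
proof -
  have "set ys = insert (ys ! i) (set (del_at i ys))"
    using mset_eq_setD [OF mset_del_at [OF assms(2)]] by simp
  moreover have "ys ! i \<in> set (del_at i ys)"
    using assms del_at_nth_less [OF assms(1,2)] nth_mem [of j "del_at i ys"] by (simp add: del_at_def)
  ultimately show ?thesis
    by (metis insert_absorb)
qed

lemma del_at_map: "del_at i (map p xs) = map p (del_at i xs)"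
  by (simp add: del_at_def take_map drop_map)

lemma set_del_at_subset: "set (del_at i xs) \<subseteq> set xs"
  by (auto simp: del_at_def dest: in_set_takeD in_set_dropD)

lemma sum_tup_snoc:
  fixes f :: "'v list \<Rightarrow> real"
  assumes "finite V"
  shows "(\<Sum>xs\<in>tup V (Suc k). f xs) = (\<Sum>t\<in>tup V k. \<Sum>x\<in>V. f (t @ [x]))"
proof -
  have "(\<Sum>xs\<in>tup V (Suc k). f xs) = (\<Sum>xs\<in>tup V (Suc k). weight (\<lambda>_. 1) xs * f (del_at k xs @ [xs ! k]))"
    by (intro sum.cong) (auto simp: tup_def del_at_def take_Suc_conv_app_nth [symmetric])
  also have "\<dots> = (\<Sum>t\<in>tup V k. \<Sum>x\<in>V. f (t @ [x]))"
    using sum_tup_del_at [OF assms, of k k "\<lambda>_. 1" "\<lambda>t x. f (t @ [x])"] by simp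
  finally show ?thesis .
qed

lemma sum_tup_of_del_at:
  fixes f :: "'v list \<Rightarrow> real"
  assumes "finite V" "i \<le> k"
  shows "(\<Sum>xs\<in>tup V (Suc k). f (del_at i xs)) = real (card V) * (\<Sum>t\<in>tup V k. f t)"
  using sum_tup_del_at [OF assms, of "\<lambda>_. 1" "\<lambda>t _. f t"] by (simp add: sum_distrib_left)

lemma sum_tup_nth:
  fixes F :: "'v \<Rightarrow> real"
  assumes "finite V" "i \<le> k"
  shows "(\<Sum>t\<in>tup V (Suc k). F (t ! i)) = real (card V) ^ k * (\<Sum>x\<in>V. F x)"
  using sum_tup_del_at [OF assms, of "\<lambda>_. 1" "\<lambda>_ x. F x"] by (simp add: card_tup assms(1) sum_distrib_left)

lemma sum_tup_nth2:
  fixes F :: "'v \<Rightarrow> 'v \<Rightarrow> real"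
  assumes "finite V" "j < i" "i \<le> Suc k"
  shows "(\<Sum>t\<in>tup V (Suc (Suc k)). F (t ! j) (t ! i)) = real (card V) ^ k * (\<Sum>x\<in>V. \<Sum>y\<in>V. F x y)"
proof -
  have "(\<Sum>t\<in>tup V (Suc (Suc k)). F (t ! j) (t ! i)) =
    (\<Sum>t\<in>tup V (Suc (Suc k)). weight (\<lambda>_. 1) t * F (del_at i t ! j) (t ! i))"
    using assms by (intro sum.cong) (auto simp: tup_def del_at_nth_less)
  also have "\<dots> = (\<Sum>t\<in>tup V k. \<Sum>x\<in>V. \<Sum>y\<in>V. F x y)"
    using sum_tup_del_at2 [of V j k i "\<lambda>_. 1" "\<lambda>_ x y. F x y"] assms by simp
  finally show ?thesis
    by (simp add: card_tup assms(1) sum_distrib_left)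
qed

lemma weight_cong: "(\<And>x. x \<in> set xs \<Longrightarrow> w x = v x) \<Longrightarrow> weight w xs = weight v xs"
  by (induction xs) auto

lemma weight_scale: "weight (\<lambda>x. c * w x) xs = c ^ length xs * weight w xs"
  by (induction xs) auto

lemma tendsto_weight:
  assumes "\<And>x. x \<in> set xs \<Longrightarrow> ((\<lambda>n. w n x) \<longlongrightarrow> v x) F"
  shows "((\<lambda>n. weight (w n) xs) \<longlongrightarrow> weight v xs) F"
  using assms by (induction xs) (auto intro!: tendsto_mult)

lemma weight_pos: "(\<And>x. x \<in> set xs \<Longrightarrow> 0 < w x) \<Longrightarrow> 0 < weight w xs" for w :: "'a \<Rightarrow> real"
  by (induction xs) auto

lemma weight_pos_imp:
  fixes w :: "'a \<Rightarrow> real"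
  assumes "weight w xs \<noteq> 0" "x \<in> set xs"
  shows "w x \<noteq> 0"
  using assms by (induction xs) auto

section \<open>The certificate\<close>

locale simple_adjacency =
  fixes a :: "'v \<Rightarrow> 'v \<Rightarrow> bool"
  assumes adj_sym: "a x y \<longleftrightarrow> a y x"
    and adj_irrefl: "\<not> a x x"

text \<open>
  Neighbours, walks and triangles are counted by summing over the entries of \<open>t\<close>;
  such sums do not depend on the order of \<open>t\<close>, so that vertices and graphs can be
  classified without choosing canonical labellings.
\<close>

definition adj_count :: "('a \<Rightarrow> 'a \<Rightarrow> bool) \<Rightarrow> 'a list \<Rightarrow> 'a \<Rightarrow> nat" where
  "adj_count a t x = (\<Sum>y\<leftarrow>t. of_bool (a x y))"

definition walks2 :: "('a \<Rightarrow> 'a \<Rightarrow> bool) \<Rightarrow> 'a list \<Rightarrow> 'a \<Rightarrow> nat" where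
  "walks2 a t x = (\<Sum>y\<leftarrow>t. of_bool (a x y) * adj_count a t y)"

definition walks3 :: "('a \<Rightarrow> 'a \<Rightarrow> bool) \<Rightarrow> 'a list \<Rightarrow> 'a \<Rightarrow> nat" where
  "walks3 a t x = (\<Sum>y\<leftarrow>t. of_bool (a x y) * walks2 a t y)"

definition triangles :: "('a \<Rightarrow> 'a \<Rightarrow> bool) \<Rightarrow> 'a list \<Rightarrow> 'a \<Rightarrow> nat" where
  "triangles a t x = (\<Sum>y\<leftarrow>t. of_bool (a x y) * (\<Sum>z\<leftarrow>t. of_bool (a x z) * of_bool (a y z)))"

definition signature :: "('a \<Rightarrow> 'a \<Rightarrow> bool) \<Rightarrow> 'a list \<Rightarrow> 'a \<Rightarrow> nat list" where
  "signature a t x = [adj_count a t x, walks2 a t x, walks3 a t x, triangles a t x]"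

text \<open>
  The sum of the squares of the degrees and the sum of the products of the degrees at the two
  ends of an edge (each edge counted twice).  On five vertices these two numbers determine the
  graph up to isomorphism.
\<close>

definition type_key :: "('a \<Rightarrow> 'a \<Rightarrow> bool) \<Rightarrow> 'a list \<Rightarrow> nat \<times> nat" where
  "type_key a t = (\<Sum>x\<leftarrow>t. adj_count a t x * adj_count a t x, \<Sum>x\<leftarrow>t. adj_count a t x * walks2 a t x)"

text \<open>
  The ten types of the certificate, named by their keys, are the following: (0,0) is the empty
  graph, (2,2) is an edge and three isolated vertices, (4,4) is \<open>2K\<^sub>2 +
  K\<^sub>1\<close>, (6,8) and (8,10) are a path on three vertices with two isolated vertices
  and with an edge, (12,18) is \<open>K\<^sub>1\<^sub>,\<^sub>3 + K\<^sub>1\<close>, (14,26) is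
  \<open>K\<^sub>3 + K\<^sub>2\<close>, (20,32) is \<open>K\<^sub>1\<^sub>,\<^sub>4\<close>,
  (26,66) is \<open>K\<^sub>4\<close> without an edge together with an isolated vertex, and
  (30,72) is \<open>K\<^sub>2\<^sub>,\<^sub>3\<close>.

  The rows of a Gram matrix, of which the lower triangle is listed, correspond to the signatures
  in the list before it.  The matrices come from a numerical semidefinite programme, restricted
  to forms that vanish on the balanced blowup of three triangles, and have been rounded within
  the lattice of exact solutions.
\<close>

definition sigs_0_0 :: "nat list list" where
  "sigs_0_0 = [[0, 0, 0, 0], [1, 0, 0, 0], [2, 0, 0, 0], [3, 0, 0, 0], [4, 0, 0, 0], [5, 0, 0, 0]]"

definition gram_0_0 :: "int list list" where
  "gram_0_0 = [[57600], [5760, 576], [-46080, -4608, 36864], [-97920, -9792, 78336, 166464], [-149760, -14976, 119808, 254592, 389376],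
      [-201600, -20160, 161280, 342720, 524160, 705600]]"

definition sigs_4_4 :: "nat list list" where
  "sigs_4_4 = [[0, 0, 0, 0], [1, 0, 0, 0], [1, 1, 1, 0], [2, 1, 1, 0], [2, 2, 2, 2], [3, 2, 2, 2]]"

definition gram_4_4 :: "int list list" where
  "gram_4_4 = [[828080], [-1053360, 2195352], [241378, -560120, 157435], [-362582, 210791, -22304, 241155], [156564, -548432, 124561,
      15108, 221028], [-682528, 300487, -51397, 451775, 143571, 978423]]"

definition sigs_30_72 :: "nat list list" where
  "sigs_30_72 = [[0, 0, 0, 0], [3, 6, 18, 0], [2, 6, 12, 0], [5, 12, 30, 12]]"

definition gram_30_72 :: "int list list" where
  "gram_30_72 = [[40624], [-88560, 605952], [-3792, -276192, 196992], [-151392, 201600, 101952, 604800]]"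

definition sigs_2_2 :: "nat list list" where
  "sigs_2_2 = [[0, 0, 0, 0], [1, 0, 0, 0], [2, 0, 0, 0], [3, 0, 0, 0], [1, 1, 1, 0], [2, 1, 1, 0], [2, 2, 2, 2], [3, 2, 2, 2]]"

definition gram_2_2 :: "int list list" where
  "gram_2_2 = [[109440], [-124652, 419812], [-192754, 273816, 370568], [-426846, 818280, 837138, 2082264], [157638, -436344, -336906,
      -930888, 468864], [71714, -312856, -171824, -556394, 317268, 241155], [100656, -265264, -229448, -595368, 293496, 191396, 201120],
      [62132, -335704, -152796, -550632, 331022, 262012, 190692, 294062]]"

definition sigs_6_8 :: "nat list list" where
  "sigs_6_8 = [[0, 0, 0, 0], [1, 0, 0, 0], [2, 0, 0, 0], [2, 2, 4, 0], [1, 2, 2, 0], [2, 3, 4, 2], [3, 3, 4, 2], [3, 4, 6, 4]]"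

definition gram_6_8 :: "int list list" where
  "gram_6_8 = [[20120], [28280, 86446], [36440, 144612, 252784], [-61632, -275200, -488768, 1781248], [-8144, 37736, 83616, -708288,
      399360], [-21356, -31424, -41492, -319520, 258512, 206835], [-52108, -149954, -247800, 406224, -19120, 87421, 273487], [-83584,
      -164880, -246176, 151104, 174272, 229416, 316928, 501312]]"

definition sigs_8_10 :: "nat list list" where
  "sigs_8_10 = [[0, 0, 0, 0], [1, 1, 1, 0], [2, 2, 2, 2], [2, 2, 3, 0], [2, 2, 4, 0], [1, 2, 2, 0]]"

definition gram_8_10 :: "int list list" where
  "gram_8_10 = [[505800], [-404388, 327240], [-204198, 172440, 262440], [-221607, 177576, 89490, 104995], [-277239, 168768, -14409, 115704,
      890676], [-227187, 217476, 19683, 104475, -382086, 609012]]"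

definition sigs_14_26 :: "nat list list" where
  "sigs_14_26 = [[0, 0, 0, 0], [1, 1, 1, 0], [2, 2, 2, 2], [2, 4, 8, 2], [3, 6, 12, 6]]"

definition gram_14_26 :: "int list list" where
  "gram_14_26 = [[602364], [-429063, 345627], [-129942, 265023, 784476], [-273008, 110304, -308232, 302216], [-31046, -46080, -291744,
      159014, 120577]]"

definition sigs_12_18 :: "nat list list" where
  "sigs_12_18 = [[0, 0, 0, 0], [1, 0, 0, 0], [3, 3, 9, 0], [1, 3, 3, 0], [2, 4, 6, 2], [3, 5, 9, 4], [4, 6, 12, 6]]"

definition gram_12_18 :: "int list list" where
  "gram_12_18 = [[102768], [-123798, 593892], [-22876, -323200, 290160], [-65624, -92096, 118992, 221424], [-87269, 61832, 53700, 71636,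
      90323], [-174564, -157946, 329116, 253168, 184478, 602887], [-74976, -277296, 328752, 106272, 100076, 431864, 419472]]"

definition sigs_26_66 :: "nat list list" where
  "sigs_26_66 = [[0, 0, 0, 0], [1, 0, 0, 0], [2, 4, 12, 0], [3, 7, 19, 4], [2, 6, 14, 2], [3, 8, 20, 6], [4, 10, 26, 10]]"

definition gram_26_66 :: "int list list" where
  "gram_26_66 = [[99712], [-174528, 404808], [53203, -331674, 602887], [-49680, 92, 182208, 100800], [49568, -111688, 86120, -3064, 31232],
      [-3449, -101562, 257186, 95874, 25172, 124105], [-51972, 18666, 146442, 89190, -7824, 81107, 86660]]"

definition sigs_20_32 :: "nat list list" where
  "sigs_20_32 = [[0, 0, 0, 0], [4, 4, 16, 0], [1, 4, 4, 0], [5, 8, 20, 8]]"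

definition gram_20_32 :: "int list list" where
  "gram_20_32 = [[29632], [-58272, 296064], [-10848, -146592, 161280], [-108672, 200160, 50400, 401472]]"

definition certificate :: "((nat \<times> nat) \<times> nat list list \<times> int list list) list" where
  "certificate = [((0, 0), sigs_0_0, gram_0_0),
    ((4, 4), sigs_4_4, gram_4_4),
    ((30, 72), sigs_30_72, gram_30_72),
    ((2, 2), sigs_2_2, gram_2_2),
    ((6, 8), sigs_6_8, gram_6_8),
    ((8, 10), sigs_8_10, gram_8_10),
    ((14, 26), sigs_14_26, gram_14_26),
    ((12, 18), sigs_12_18, gram_12_18),
    ((26, 66), sigs_26_66, gram_26_66),
    ((20, 32), sigs_20_32, gram_20_32)]"

text \<open>
  A signature that is not listed gets the first position after the list, where every Gram entry
  is zero.
\<close>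

definition position :: "nat list list \<Rightarrow> nat list \<Rightarrow> nat" where
  "position ss s = length (takeWhile (\<lambda>r. r \<noteq> s) ss)"

definition entry :: "int list list \<Rightarrow> nat \<Rightarrow> nat \<Rightarrow> int" where
  "entry G i j = (if i < length G \<and> j < length G then G ! max i j ! min i j else 0)"

text \<open>
  In \<open>2K\<^sub>2 + K\<^sub>1\<close> this is the signature of a vertex with exactly one
  neighbour, which lies on an edge.
\<close>

definition leaf_sig :: "nat list" where "leaf_sig = [1, 1, 1, 0]"

text \<open>The weight 393660 is half of 787320: a leaf may sit in either of the two slots.\<close>

definition coef :: "nat \<times> nat \<Rightarrow> nat list \<Rightarrow> nat list \<Rightarrow> int" where
  "coef k s s' = (if k = (4, 4) then 393660 * (of_bool (s = leaf_sig) + of_bool (s' = leaf_sig)) else 0)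
     + (case map_of certificate k of None \<Rightarrow> 0
        | Some (ss, G) \<Rightarrow> entry G (position ss s) (position ss s'))"

definition local_coef :: "('a \<Rightarrow> 'a \<Rightarrow> bool) \<Rightarrow> 'a list \<Rightarrow> 'a \<Rightarrow> 'a \<Rightarrow> int" where
  "local_coef a t x y = coef (type_key a t) (signature a t x) (signature a t y)"

text \<open>
  Key, signature and coefficient as functions of the entries above the diagonal of the adjacency
  matrix, column by column.  In this form they can be evaluated by rewriting.
\<close>

definition type_key_bits :: "bool \<Rightarrow> bool \<Rightarrow> bool \<Rightarrow> bool \<Rightarrow> bool \<Rightarrow> bool
    \<Rightarrow> bool \<Rightarrow> bool \<Rightarrow> bool \<Rightarrow> bool \<Rightarrow> nat \<times> nat" where
  "type_key_bits b01 b02 b12 b03 b13 b23 b04 b14 b24 b34 =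
   (let d0 = (of_bool b01 + of_bool b02 + of_bool b03 + of_bool b04); d1 = (of_bool b01 + of_bool b12 + of_bool b13 + of_bool b14); d2 =
       (of_bool b02 + of_bool b12 + of_bool b23 + of_bool b24); d3 = (of_bool b03 + of_bool b13 + of_bool b23 + of_bool b34); d4 = (of_bool
       b04 + of_bool b14 + of_bool b24 + of_bool b34) in (d0*d0+d1*d1+d2*d2+d3*d3+d4*d4,
     d0 * (of_bool b01 * d1 + of_bool b02 * d2 + of_bool b03 * d3 + of_bool b04 * d4) + d1 * (of_bool b01 * d0 + of_bool b12 * d2 + of_bool
         b13 * d3 + of_bool b14 * d4) + d2 * (of_bool b02 * d0 + of_bool b12 * d1 + of_bool b23 * d3 + of_bool b24 * d4) + d3 * (of_bool
         b03 * d0 + of_bool b13 * d1 + of_bool b23 * d2 + of_bool b34 * d4) + d4 * (of_bool b04 * d0 + of_bool b14 * d1 + of_bool b24 * d2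
         + of_bool b34 * d3)))"

definition signature_bits :: "bool \<Rightarrow> bool \<Rightarrow> bool \<Rightarrow> bool \<Rightarrow> bool \<Rightarrow> bool
    \<Rightarrow> bool \<Rightarrow> bool \<Rightarrow> bool \<Rightarrow> bool \<Rightarrow> bool \<Rightarrow> bool \<Rightarrow> bool
    \<Rightarrow> bool \<Rightarrow> bool \<Rightarrow> nat list" where
  "signature_bits b01 b02 b12 b03 b13 b23 b04 b14 b24 b34 s0 s1 s2 s3 s4 =
   (let d0 = (of_bool b01 + of_bool b02 + of_bool b03 + of_bool b04); d1 = (of_bool b01 + of_bool b12 + of_bool b13 + of_bool b14); d2 =
       (of_bool b02 + of_bool b12 + of_bool b23 + of_bool b24); d3 = (of_bool b03 + of_bool b13 + of_bool b23 + of_bool b34); d4 = (of_bool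
       b04 + of_bool b14 + of_bool b24 + of_bool b34);
     e0 = (of_bool b01 * d1 + of_bool b02 * d2 + of_bool b03 * d3 + of_bool b04 * d4);
     e1 = (of_bool b01 * d0 + of_bool b12 * d2 + of_bool b13 * d3 + of_bool b14 * d4);
     e2 = (of_bool b02 * d0 + of_bool b12 * d1 + of_bool b23 * d3 + of_bool b24 * d4);
     e3 = (of_bool b03 * d0 + of_bool b13 * d1 + of_bool b23 * d2 + of_bool b34 * d4);
     e4 = (of_bool b04 * d0 + of_bool b14 * d1 + of_bool b24 * d2 + of_bool b34 * d3) in
   [of_bool s0 + of_bool s1 + of_bool s2 + of_bool s3 + of_bool s4, of_bool s0 * d0 + of_bool s1 * d1 + of_bool s2 * d2 + of_bool s3 * d3 +
       of_bool s4 * d4, of_bool s0 * e0 + of_bool s1 * e1 + of_bool s2 * e2 + of_bool s3 * e3 + of_bool s4 * e4,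
    of_bool s0 * (of_bool s1 * of_bool b01 + of_bool s2 * of_bool b02 + of_bool s3 * of_bool b03 + of_bool s4 * of_bool b04) + of_bool s1 *
        (of_bool s0 * of_bool b01 + of_bool s2 * of_bool b12 + of_bool s3 * of_bool b13 + of_bool s4 * of_bool b14) + of_bool s2 * (of_bool
        s0 * of_bool b02 + of_bool s1 * of_bool b12 + of_bool s3 * of_bool b23 + of_bool s4 * of_bool b24) + of_bool s3 * (of_bool s0 *
        of_bool b03 + of_bool s1 * of_bool b13 + of_bool s2 * of_bool b23 + of_bool s4 * of_bool b34) + of_bool s4 * (of_bool s0 * of_bool
        b04 + of_bool s1 * of_bool b14 + of_bool s2 * of_bool b24 + of_bool s3 * of_bool b34)])"

definition coef_bits where
  "coef_bits b01 b02 b12 b03 b13 b23 b04 b14 b24 b34 s0 s1 s2 s3 s4 t0 t1 t2 t3 t4 =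
   coef (type_key_bits b01 b02 b12 b03 b13 b23 b04 b14 b24 b34)
    (signature_bits b01 b02 b12 b03 b13 b23 b04 b14 b24 b34 s0 s1 s2 s3 s4)
    (signature_bits b01 b02 b12 b03 b13 b23 b04 b14 b24 b34 t0 t1 t2 t3 t4)"

context simple_adjacency
begin

lemma type_key_eq_bits: "type_key a [x0, x1, x2, x3, x4] = type_key_bits (a x0 x1) (a x0 x2) (a x1 x2) (a x0 x3) (a x1 x3) (a x2 x3) (a x0
    x4) (a x1 x4) (a x2 x4) (a x3 x4)"
proof -
  have sym: "a x1 x0 = a x0 x1" "a x2 x0 = a x0 x2" "a x2 x1 = a x1 x2" "a x3 x0 = a x0 x3" "a x3 x1 = a x1 x3" "a x3 x2 = a x2 x3" "a x4
      x0 = a x0 x4" "a x4 x1 = a x1 x4" "a x4 x2 = a x2 x4" "a x4 x3 = a x3 x4"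
    using adj_sym by blast+
  show ?thesis
    by (simp add: type_key_def type_key_bits_def adj_count_def walks2_def Let_def adj_irrefl sym ac_simps)
qed

lemma signature_eq_bits: "signature a [x0, x1, x2, x3, x4] w = signature_bits (a x0 x1) (a x0 x2) (a x1 x2) (a x0 x3) (a x1 x3) (a x2 x3)
    (a x0 x4) (a x1 x4) (a x2 x4) (a x3 x4) (a x0 w) (a x1 w) (a x2 w) (a x3 w) (a x4 w)"
proof -
  have sym: "a x1 x0 = a x0 x1" "a x2 x0 = a x0 x2" "a x2 x1 = a x1 x2" "a x3 x0 = a x0 x3" "a x3 x1 = a x1 x3" "a x3 x2 = a x2 x3" "a x4
      x0 = a x0 x4" "a x4 x1 = a x1 x4" "a x4 x2 = a x2 x4" "a x4 x3 = a x3 x4" "a w x0 = a x0 w" "a w x1 = a x1 w" "a w x2 = a x2 w" "a w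
      x3 = a x3 w" "a w x4 = a x4 w"
    using adj_sym by blast+
  show ?thesis
    by (simp add: signature_def signature_bits_def adj_count_def walks2_def walks3_def triangles_def Let_def adj_irrefl sym ac_simps)
qed

lemma local_coef_eq_bits: "local_coef a [x0, x1, x2, x3, x4] y z =
    coef_bits (a x0 x1) (a x0 x2) (a x1 x2) (a x0 x3) (a x1 x3) (a x2 x3) (a x0 x4) (a x1 x4) (a x2 x4) (a x3 x4)
      (a x0 y) (a x1 y) (a x2 y) (a x3 y) (a x4 y) (a x0 z) (a x1 z) (a x2 z) (a x3 z) (a x4 z)"
  by (simp add: local_coef_def coef_bits_def type_key_eq_bits signature_eq_bits)

end

text \<open>
  Exchanging two consecutive vertices.  Used as permutative rewrite rules these equations sort
  every labelled graph on five vertices into one of 46 locally minimal labellings, so that only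
  those have to be tabulated.
\<close>

lemma coef_bits_swap:
  "coef_bits b01 b02 b12 b03 b13 b23 b04 b14 b24 b34 s0 s1 s2 s3 s4 t0 t1 t2 t3 t4 =
    coef_bits b01 b12 b02 b13 b03 b23 b14 b04 b24 b34 s1 s0 s2 s3 s4 t1 t0 t2 t3 t4"
  "coef_bits b01 b02 b12 b03 b13 b23 b04 b14 b24 b34 s0 s1 s2 s3 s4 t0 t1 t2 t3 t4 =
    coef_bits b02 b01 b12 b03 b23 b13 b04 b24 b14 b34 s0 s2 s1 s3 s4 t0 t2 t1 t3 t4"
  "coef_bits b01 b02 b12 b03 b13 b23 b04 b14 b24 b34 s0 s1 s2 s3 s4 t0 t1 t2 t3 t4 =
    coef_bits b01 b03 b13 b02 b12 b23 b04 b14 b34 b24 s0 s1 s3 s2 s4 t0 t1 t3 t2 t4"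
  "coef_bits b01 b02 b12 b03 b13 b23 b04 b14 b24 b34 s0 s1 s2 s3 s4 t0 t1 t2 t3 t4 =
    coef_bits b01 b02 b12 b04 b14 b24 b03 b13 b23 b34 s0 s1 s2 s4 s3 t0 t1 t2 t4 t3"
  by (simp_all add: coef_bits_def type_key_bits_def signature_bits_def Let_def ac_simps)

section \<open>Evaluating the certificate on labelled patterns\<close>

definition sigs_of :: "nat \<times> nat \<Rightarrow> nat list list" where
  "sigs_of k = fst (the (map_of certificate k))"

definition value_of :: "nat \<times> nat \<Rightarrow> nat \<Rightarrow> nat \<Rightarrow> int" where
  "value_of k i j = (if k = (4, 4) then 393660 * (of_bool (i = 2) + of_bool (j = 2)) else 0)
     + entry (snd (the (map_of certificate k))) i j"

lemma coef_eq_value_of: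
  assumes "map_of certificate k \<noteq> None"
  shows "coef k s s' = value_of k (position (sigs_of k) s) (position (sigs_of k) s')"
proof -
  have *: "position (sigs_of (4, 4)) s = 2 \<longleftrightarrow> s = leaf_sig" for s
    by (auto simp: position_def sigs_of_def certificate_def sigs_4_4_def leaf_sig_def)
  obtain ss G where e: "map_of certificate k = Some (ss, G)"
    using assms by auto
  then have so: "sigs_of k = ss"
    by (simp add: sigs_of_def)
  have "k = (4, 4) \<Longrightarrow> position ss s = 2 \<longleftrightarrow> s = leaf_sig" for s
    using * so by metis
  then show ?thesis
    by (simp add: coef_def value_of_def e so)
qed

definition row_class where
  "row_class b01 b02 b12 b03 b13 b23 b04 b14 b24 b34 s0 s1 s2 s3 s4 =
     position (sigs_of (type_key_bits b01 b02 b12 b03 b13 b23 b04 b14 b24 b34)) (signature_bits b01 b02 b12 b03 b13 b23 b04 b14 b24 b34 s0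
         s1 s2 s3 s4)"

lemma coef_bits_eq_value_of:
  assumes "map_of certificate (type_key_bits b01 b02 b12 b03 b13 b23 b04 b14 b24 b34) \<noteq> None"
  shows "coef_bits b01 b02 b12 b03 b13 b23 b04 b14 b24 b34 s0 s1 s2 s3 s4 t0 t1 t2 t3 t4 =
    value_of (type_key_bits b01 b02 b12 b03 b13 b23 b04 b14 b24 b34) (row_class b01 b02 b12 b03 b13 b23 b04 b14 b24 b34 s0 s1 s2 s3 s4)
        (row_class b01 b02 b12 b03 b13 b23 b04 b14 b24 b34 t0 t1 t2 t3 t4)"
  unfolding coef_bits_def row_class_def row_class_def using assms by (rule coef_eq_value_of)

definition bit_rows :: "(bool \<times> bool \<times> bool \<times> bool \<times> bool) list" where
  "bit_rows = [(s0, s1, s2, s3, s4). s0 \<leftarrow> [False, True], s1 \<leftarrow> [False, True], s2 \<leftarrow> [False, True],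
     s3 \<leftarrow> [False, True], s4 \<leftarrow> [False, True]]"

text \<open>The locally minimal labellings of the graphs that are not types of the certificate.\<close>

lemma coef_bits_irrelevant:
  "coef_bits False False True True False True True True False False s0 s1 s2 s3 s4 t0 t1 t2 t3 t4 = 0"
  "coef_bits False False True True False False True False True False s0 s1 s2 s3 s4 t0 t1 t2 t3 t4 = 0"
  "coef_bits False False True True False True True False True False s0 s1 s2 s3 s4 t0 t1 t2 t3 t4 = 0"
  "coef_bits False False False False True True True False True False s0 s1 s2 s3 s4 t0 t1 t2 t3 t4 = 0"
  "coef_bits False False False False True True False True True False s0 s1 s2 s3 s4 t0 t1 t2 t3 t4 = 0"
  "coef_bits False False True True False False True True True False s0 s1 s2 s3 s4 t0 t1 t2 t3 t4 = 0"
  "coef_bits False False True True False True True True True False s0 s1 s2 s3 s4 t0 t1 t2 t3 t4 = 0"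
  "coef_bits False False False False True True True True True False s0 s1 s2 s3 s4 t0 t1 t2 t3 t4 = 0"
  "coef_bits False False True True True True True True True False s0 s1 s2 s3 s4 t0 t1 t2 t3 t4 = 0"
  "coef_bits False False False False True True True False False True s0 s1 s2 s3 s4 t0 t1 t2 t3 t4 = 0"
  "coef_bits False False True False True True True False False True s0 s1 s2 s3 s4 t0 t1 t2 t3 t4 = 0"
  "coef_bits False False False False False True False True False True s0 s1 s2 s3 s4 t0 t1 t2 t3 t4 = 0"
  "coef_bits False True True True True False True True False True s0 s1 s2 s3 s4 t0 t1 t2 t3 t4 = 0"
  "coef_bits False False False False False True True True False True s0 s1 s2 s3 s4 t0 t1 t2 t3 t4 = 0"
  "coef_bits False False True True False True True True False True s0 s1 s2 s3 s4 t0 t1 t2 t3 t4 = 0"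
  "coef_bits False False False False False True False False True True s0 s1 s2 s3 s4 t0 t1 t2 t3 t4 = 0"
  "coef_bits False False True True False False True False True True s0 s1 s2 s3 s4 t0 t1 t2 t3 t4 = 0"
  "coef_bits False False True True False True True False True True s0 s1 s2 s3 s4 t0 t1 t2 t3 t4 = 0"
  "coef_bits False False False False True True True False True True s0 s1 s2 s3 s4 t0 t1 t2 t3 t4 = 0"
  "coef_bits False False True False True True True False True True s0 s1 s2 s3 s4 t0 t1 t2 t3 t4 = 0"
  "coef_bits False False False False False True False True True True s0 s1 s2 s3 s4 t0 t1 t2 t3 t4 = 0"
  "coef_bits False False True False True True False True True True s0 s1 s2 s3 s4 t0 t1 t2 t3 t4 = 0"
  "coef_bits False False True True False False True True True True s0 s1 s2 s3 s4 t0 t1 t2 t3 t4 = 0"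
  "coef_bits False True True True True False True True True True s0 s1 s2 s3 s4 t0 t1 t2 t3 t4 = 0"
  "coef_bits False False False False False True True True True True s0 s1 s2 s3 s4 t0 t1 t2 t3 t4 = 0"
  "coef_bits False False True True False True True True True True s0 s1 s2 s3 s4 t0 t1 t2 t3 t4 = 0"
  "coef_bits False False False False True True True True True True s0 s1 s2 s3 s4 t0 t1 t2 t3 t4 = 0"
  "coef_bits False False True False True True True True True True s0 s1 s2 s3 s4 t0 t1 t2 t3 t4 = 0"
  "coef_bits False False False True True True True True True True s0 s1 s2 s3 s4 t0 t1 t2 t3 t4 = 0"
  "coef_bits False False True True True True True True True True s0 s1 s2 s3 s4 t0 t1 t2 t3 t4 = 0"
  "coef_bits False True True True True True True True True True s0 s1 s2 s3 s4 t0 t1 t2 t3 t4 = 0"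
  "coef_bits True True True True True True True True True True s0 s1 s2 s3 s4 t0 t1 t2 t3 t4 = 0"
  by (simp_all add: coef_bits_def coef_def certificate_def type_key_bits_def Let_def)

text \<open>
  The locally minimal labellings of the types of the certificate; three types have more than one
  of them.
\<close>

lemma type_key_at:
  "type_key_bits False False False False False False False False False False = (0, 0)"
  "type_key_bits False False True True False False True False False False = (8, 10)"
  "type_key_bits False False False False True True True False False False = (8, 10)"
  "type_key_bits False False True False True True True False False False = (14, 26)"
  "type_key_bits False False False False False True False True False False = (4, 4)"
  "type_key_bits False True True True True False True True False False = (30, 72)"
  "type_key_bits False False False False False True True True False False = (8, 10)"
  "type_key_bits False False False True True True True True True False = (30, 72)"
  "type_key_bits False False False False False False False False False True = (2, 2)"
  "type_key_bits False False True True False False True False False True = (14, 26)"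
  "type_key_bits False False False False False False False False True True = (6, 8)"
  "type_key_bits False False False False False False False True True True = (12, 18)"
  "type_key_bits False False False False True True False True True True = (26, 66)"
  "type_key_bits False False False False False False True True True True = (20, 32)"
  by (simp_all add: type_key_bits_def Let_def)

lemmas coef_bits_at =
  coef_bits_eq_value_of [of False False False False False False False False False False]
  coef_bits_eq_value_of [of False False True True False False True False False False]
  coef_bits_eq_value_of [of False False False False True True True False False False]
  coef_bits_eq_value_of [of False False True False True True True False False False]
  coef_bits_eq_value_of [of False False False False False True False True False False]
  coef_bits_eq_value_of [of False True True True True False True True False False]
  coef_bits_eq_value_of [of False False False False False True True True False False]
  coef_bits_eq_value_of [of False False False True True True True True True False]
  coef_bits_eq_value_of [of False False False False False False False False False True]
  coef_bits_eq_value_of [of False False True True False False True False False True]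
  coef_bits_eq_value_of [of False False False False False False False False True True]
  coef_bits_eq_value_of [of False False False False False False False True True True]
  coef_bits_eq_value_of [of False False False False True True False True True True]
  coef_bits_eq_value_of [of False False False False False False True True True True]

lemmas coef_bits_relevant = coef_bits_at [unfolded type_key_at, simplified certificate_def, simplified]

text \<open>The row of the Gram matrix that belongs to each of the 32 attachments, in binary order.\<close>

lemma row_class_at:
  "map (\<lambda>(s0, s1, s2, s3, s4). row_class False False False False False False False False False False s0 s1 s2 s3 s4) bit_rows =
    [0, 1, 1, 2, 1, 2, 2, 3, 1, 2, 2, 3, 2, 3, 3, 4, 1, 2, 2, 3, 2, 3, 3, 4, 2, 3, 3, 4, 3, 4, 4, 5]"
  "map (\<lambda>(s0, s1, s2, s3, s4). row_class False False True True False False True False False False s0 s1 s2 s3 s4) bit_rows =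
    [0, 6, 6, 4, 1, 3, 3, 6, 1, 3, 3, 6, 2, 6, 6, 6, 5, 6, 6, 6, 6, 6, 6, 6, 6, 6, 6, 6, 6, 6, 6, 6]"
  "map (\<lambda>(s0, s1, s2, s3, s4). row_class False False False False True True True False False False s0 s1 s2 s3 s4) bit_rows =
    [0, 1, 5, 6, 6, 3, 6, 6, 6, 3, 6, 6, 4, 6, 6, 6, 1, 2, 6, 6, 3, 6, 6, 6, 3, 6, 6, 6, 6, 6, 6, 6]"
  "map (\<lambda>(s0, s1, s2, s3, s4). row_class False False True False True True True False False False s0 s1 s2 s3 s4) bit_rows =
    [0, 1, 5, 5, 5, 5, 3, 5, 5, 5, 3, 5, 3, 5, 4, 5, 1, 2, 5, 5, 5, 5, 5, 5, 5, 5, 5, 5, 5, 5, 5, 5]"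
  "map (\<lambda>(s0, s1, s2, s3, s4). row_class False False False False False True False True False False s0 s1 s2 s3 s4) bit_rows =
    [0, 2, 2, 6, 2, 6, 4, 6, 2, 4, 6, 6, 6, 6, 6, 6, 1, 3, 3, 6, 3, 6, 5, 6, 3, 5, 6, 6, 6, 6, 6, 6]"
  "map (\<lambda>(s0, s1, s2, s3, s4). row_class False True True True True False True True False False s0 s1 s2 s3 s4) bit_rows =
    [0, 4, 4, 4, 4, 4, 4, 1, 4, 4, 4, 4, 4, 4, 4, 4, 4, 4, 4, 4, 4, 4, 4, 4, 2, 4, 4, 4, 4, 4, 4, 3]"
  "map (\<lambda>(s0, s1, s2, s3, s4). row_class False False False False False True True True False False s0 s1 s2 s3 s4) bit_rows =
    [0, 5, 1, 6, 1, 6, 2, 6, 6, 6, 3, 6, 3, 6, 6, 6, 6, 6, 3, 6, 3, 6, 6, 6, 4, 6, 6, 6, 6, 6, 6, 6]"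
  "map (\<lambda>(s0, s1, s2, s3, s4). row_class False False False True True True True True True False s0 s1 s2 s3 s4) bit_rows =
    [0, 4, 4, 2, 4, 4, 4, 4, 4, 4, 4, 4, 4, 4, 4, 4, 4, 4, 4, 4, 4, 4, 4, 4, 4, 4, 4, 4, 1, 4, 4, 3]"
  "map (\<lambda>(s0, s1, s2, s3, s4). row_class False False False False False False False False False True s0 s1 s2 s3 s4) bit_rows =
    [0, 4, 4, 6, 1, 5, 5, 7, 1, 5, 5, 7, 2, 8, 8, 8, 1, 5, 5, 7, 2, 8, 8, 8, 2, 8, 8, 8, 3, 8, 8, 8]"
  "map (\<lambda>(s0, s1, s2, s3, s4). row_class False False True True False False True False False True s0 s1 s2 s3 s4) bit_rows =
    [0, 5, 5, 3, 1, 5, 5, 5, 1, 5, 5, 5, 2, 5, 5, 5, 5, 3, 3, 4, 5, 5, 5, 5, 5, 5, 5, 5, 5, 5, 5, 5]"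
  "map (\<lambda>(s0, s1, s2, s3, s4). row_class False False False False False False False False True True s0 s1 s2 s3 s4) bit_rows =
    [0, 4, 8, 5, 8, 5, 3, 7, 1, 8, 8, 6, 8, 6, 8, 8, 1, 8, 8, 6, 8, 6, 8, 8, 2, 8, 8, 8, 8, 8, 8, 8]"
  "map (\<lambda>(s0, s1, s2, s3, s4). row_class False False False False False False False True True True s0 s1 s2 s3 s4) bit_rows =
    [0, 3, 7, 4, 7, 4, 7, 5, 7, 4, 7, 5, 7, 5, 2, 6, 1, 7, 7, 7, 7, 7, 7, 7, 7, 7, 7, 7, 7, 7, 7, 7]"
  "map (\<lambda>(s0, s1, s2, s3, s4). row_class False False False False True True False True True True s0 s1 s2 s3 s4) bit_rows =
    [0, 7, 7, 4, 7, 7, 7, 5, 7, 7, 7, 5, 2, 3, 3, 6, 1, 7, 7, 7, 7, 7, 7, 7, 7, 7, 7, 7, 7, 7, 7, 7]"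
  "map (\<lambda>(s0, s1, s2, s3, s4). row_class False False False False False False True True True True s0 s1 s2 s3 s4) bit_rows =
    [0, 2, 4, 4, 4, 4, 4, 4, 4, 4, 4, 4, 4, 4, 4, 4, 4, 4, 4, 4, 4, 4, 4, 4, 4, 4, 4, 4, 4, 4, 1, 3]"
  by (simp_all add: bit_rows_def row_class_def type_key_at sigs_of_def certificate_def position_def signature_bits_def Let_def
    sigs_0_0_def sigs_4_4_def sigs_30_72_def sigs_2_2_def sigs_6_8_def sigs_8_10_def sigs_14_26_def sigs_12_18_def sigs_26_66_def sigs_20_32_def)

lemmas row_class_table = row_class_at [unfolded bit_rows_def, simplified]

lemma value_of_0_0: "\<forall>i\<in>set [0, 1, 2, 3, 4, 5, 6]. \<forall>j\<in>set [0, 1, 2, 3, 4, 5, 6].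
    value_of (0, 0) i j = entry gram_0_0 i j"
  by (simp add: value_of_def certificate_def)

lemma value_of_4_4: "\<forall>i\<in>set [0, 1, 2, 3, 4, 5, 6]. \<forall>j\<in>set [0, 1, 2, 3, 4, 5, 6].
    value_of (4, 4) i j = entry gram_4_4 i j + 393660 * (of_bool (i = 2) + of_bool (j = 2))"
  by (simp add: value_of_def certificate_def)

lemma value_of_30_72: "\<forall>i\<in>set [0, 1, 2, 3, 4]. \<forall>j\<in>set [0, 1, 2, 3, 4].
    value_of (30, 72) i j = entry gram_30_72 i j"
  by (simp add: value_of_def certificate_def)

lemma value_of_2_2: "\<forall>i\<in>set [0, 1, 2, 3, 4, 5, 6, 7, 8]. \<forall>j\<in>set [0, 1, 2, 3, 4, 5, 6, 7, 8].
    value_of (2, 2) i j = entry gram_2_2 i j"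
  by (simp add: value_of_def certificate_def)

lemma value_of_6_8: "\<forall>i\<in>set [0, 1, 2, 3, 4, 5, 6, 7, 8]. \<forall>j\<in>set [0, 1, 2, 3, 4, 5, 6, 7, 8].
    value_of (6, 8) i j = entry gram_6_8 i j"
  by (simp add: value_of_def certificate_def)

lemma value_of_8_10: "\<forall>i\<in>set [0, 1, 2, 3, 4, 5, 6]. \<forall>j\<in>set [0, 1, 2, 3, 4, 5, 6].
    value_of (8, 10) i j = entry gram_8_10 i j"
  by (simp add: value_of_def certificate_def)

lemma value_of_14_26: "\<forall>i\<in>set [0, 1, 2, 3, 4, 5]. \<forall>j\<in>set [0, 1, 2, 3, 4, 5].
    value_of (14, 26) i j = entry gram_14_26 i j"
  by (simp add: value_of_def certificate_def)

lemma value_of_12_18: "\<forall>i\<in>set [0, 1, 2, 3, 4, 5, 6, 7]. \<forall>j\<in>set [0, 1, 2, 3, 4, 5, 6, 7].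
    value_of (12, 18) i j = entry gram_12_18 i j"
  by (simp add: value_of_def certificate_def)

lemma value_of_26_66: "\<forall>i\<in>set [0, 1, 2, 3, 4, 5, 6, 7]. \<forall>j\<in>set [0, 1, 2, 3, 4, 5, 6, 7].
    value_of (26, 66) i j = entry gram_26_66 i j"
  by (simp add: value_of_def certificate_def)

lemma value_of_20_32: "\<forall>i\<in>set [0, 1, 2, 3, 4]. \<forall>j\<in>set [0, 1, 2, 3, 4].
    value_of (20, 32) i j = entry gram_20_32 i j"
  by (simp add: value_of_def certificate_def)

lemmas value_of_table =
  value_of_0_0 [simplified entry_def gram_0_0_def, simplified]
  value_of_4_4 [simplified entry_def gram_4_4_def, simplified]
  value_of_30_72 [simplified entry_def gram_30_72_def, simplified]
  value_of_2_2 [simplified entry_def gram_2_2_def, simplified]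
  value_of_6_8 [simplified entry_def gram_6_8_def, simplified]
  value_of_8_10 [simplified entry_def gram_8_10_def, simplified]
  value_of_14_26 [simplified entry_def gram_14_26_def, simplified]
  value_of_12_18 [simplified entry_def gram_12_18_def, simplified]
  value_of_26_66 [simplified entry_def gram_26_66_def, simplified]
  value_of_20_32 [simplified entry_def gram_20_32_def, simplified]

lemmas coef_bits_eval = coef_bits_swap coef_bits_irrelevant coef_bits_relevant row_class_table value_of_table

section \<open>The slack of every seven-vertex graph is nonnegative\<close>

text \<open>
  This quantifier is expanded from the outside, one bit at a time, because the weak congruence
  rule below keeps the simplifier out of its body.  Thus a violated ordering condition prunes a
  branch before the matrix entries that come later are considered.
\<close>

definition both :: "(bool \<Rightarrow> bool) \<Rightarrow> bool" where
  "both P \<longleftrightarrow> P False \<and> P True"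

lemma both_cong: "both P = both P" ..

definition slack7_bits where
  "slack7_bits b01 b02 b12 b03 b13 b23 b04 b14 b24 b34 b05 b15 b25 b35 b45 b06 b16 b26 b36 b46 b56 =
    1209600 - (coef_bits b23 b24 b34 b25 b35 b45 b26 b36 b46 b56 b02 b03 b04 b05 b06 b12 b13 b14 b15 b16 +
     coef_bits b13 b14 b34 b15 b35 b45 b16 b36 b46 b56 b01 b03 b04 b05 b06 b12 b23 b24 b25 b26 +
     coef_bits b03 b04 b34 b05 b35 b45 b06 b36 b46 b56 b01 b13 b14 b15 b16 b02 b23 b24 b25 b26 +
     coef_bits b12 b14 b24 b15 b25 b45 b16 b26 b46 b56 b01 b02 b04 b05 b06 b13 b23 b34 b35 b36 +
     coef_bits b02 b04 b24 b05 b25 b45 b06 b26 b46 b56 b01 b12 b14 b15 b16 b03 b23 b34 b35 b36 +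
     coef_bits b01 b04 b14 b05 b15 b45 b06 b16 b46 b56 b02 b12 b24 b25 b26 b03 b13 b34 b35 b36 +
     coef_bits b12 b13 b23 b15 b25 b35 b16 b26 b36 b56 b01 b02 b03 b05 b06 b14 b24 b34 b45 b46 +
     coef_bits b02 b03 b23 b05 b25 b35 b06 b26 b36 b56 b01 b12 b13 b15 b16 b04 b24 b34 b45 b46 +
     coef_bits b01 b03 b13 b05 b15 b35 b06 b16 b36 b56 b02 b12 b23 b25 b26 b04 b14 b34 b45 b46 +
     coef_bits b01 b02 b12 b05 b15 b25 b06 b16 b26 b56 b03 b13 b23 b35 b36 b04 b14 b24 b45 b46 +
     coef_bits b12 b13 b23 b14 b24 b34 b16 b26 b36 b46 b01 b02 b03 b04 b06 b15 b25 b35 b45 b56 +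
     coef_bits b02 b03 b23 b04 b24 b34 b06 b26 b36 b46 b01 b12 b13 b14 b16 b05 b25 b35 b45 b56 +
     coef_bits b01 b03 b13 b04 b14 b34 b06 b16 b36 b46 b02 b12 b23 b24 b26 b05 b15 b35 b45 b56 +
     coef_bits b01 b02 b12 b04 b14 b24 b06 b16 b26 b46 b03 b13 b23 b34 b36 b05 b15 b25 b45 b56 +
     coef_bits b01 b02 b12 b03 b13 b23 b06 b16 b26 b36 b04 b14 b24 b34 b46 b05 b15 b25 b35 b56 +
     coef_bits b12 b13 b23 b14 b24 b34 b15 b25 b35 b45 b01 b02 b03 b04 b05 b16 b26 b36 b46 b56 +
     coef_bits b02 b03 b23 b04 b24 b34 b05 b25 b35 b45 b01 b12 b13 b14 b15 b06 b26 b36 b46 b56 +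
     coef_bits b01 b03 b13 b04 b14 b34 b05 b15 b35 b45 b02 b12 b23 b24 b25 b06 b16 b36 b46 b56 +
     coef_bits b01 b02 b12 b04 b14 b24 b05 b15 b25 b45 b03 b13 b23 b34 b35 b06 b16 b26 b46 b56 +
     coef_bits b01 b02 b12 b03 b13 b23 b05 b15 b25 b35 b04 b14 b24 b34 b45 b06 b16 b26 b36 b56 +
     coef_bits b01 b02 b12 b03 b13 b23 b04 b14 b24 b34 b05 b15 b25 b35 b45 b06 b16 b26 b36 b46)"

text \<open>
  A graph on four vertices is extended by one vertex at a time.  Orderings of the vertices that
  violate the row conditions of \<open>sorted_rows_7\<close> on a prefix are discarded at once.
  This leaves eleven graphs on four vertices and about four thousand on seven.
\<close>

definition extensions_nonneg where
  "extensions_nonneg b01 b02 b12 b03 b13 b23 = both (\<lambda>b04. both (\<lambda>b14. both (\<lambda>b24. both (\<lambda>b34. if [b02,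
      b03, b04] \<le> [b12, b13, b14] \<and> [b01, b13, b14] \<le> [b02, b23, b24] \<and> [b02, b12, b24] \<le> [b03, b13, b34] \<and>
      [b03, b13, b23] \<le> [b04, b14, b24] then both (\<lambda>b05. both (\<lambda>b15. both (\<lambda>b25. both (\<lambda>b35. both
      (\<lambda>b45. if [b02, b03, b04, b05] \<le> [b12, b13, b14, b15] \<and> [b01, b13, b14, b15] \<le> [b02, b23, b24, b25] \<and> [b02,
      b12, b24, b25] \<le> [b03, b13, b34, b35] \<and> [b03, b13, b23, b35] \<le> [b04, b14, b24, b45] \<and> [b04, b14, b24, b34] \<le>
      [b05, b15, b25, b35] then both (\<lambda>b06. both (\<lambda>b16. both (\<lambda>b26. both (\<lambda>b36. both (\<lambda>b46. both
      (\<lambda>b56. if [b02, b03, b04, b05, b06] \<le> [b12, b13, b14, b15, b16] \<and> [b01, b13, b14, b15, b16] \<le> [b02, b23, b24,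
      b25, b26] \<and> [b02, b12, b24, b25, b26] \<le> [b03, b13, b34, b35, b36] \<and> [b03, b13, b23, b35, b36] \<le> [b04, b14, b24,
      b45, b46] \<and> [b04, b14, b24, b34, b46] \<le> [b05, b15, b25, b35, b56] \<and> [b05, b15, b25, b35, b45] \<le> [b06, b16, b26,
      b36, b46] then 0 \<le> slack7_bits b01 b02 b12 b03 b13 b23 b04 b14 b24 b34 b05 b15 b25 b35 b45 b06 b16 b26 b36 b46 b56 else
      True)))))) else True))))) else True))))"

lemma extensions_nonneg_0: "extensions_nonneg False False False False False False"
  by (simp add: extensions_nonneg_def both_def slack7_bits_def coef_bits_eval cong: both_cong)

lemma extensions_nonneg_1: "extensions_nonneg False False False False False True"
  by (simp add: extensions_nonneg_def both_def slack7_bits_def coef_bits_eval cong: both_cong)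

lemma extensions_nonneg_2: "extensions_nonneg False False False False True True"
  by (simp add: extensions_nonneg_def both_def slack7_bits_def coef_bits_eval cong: both_cong)

lemma extensions_nonneg_3: "extensions_nonneg False False False True True True"
  by (simp add: extensions_nonneg_def both_def slack7_bits_def coef_bits_eval cong: both_cong)

lemma extensions_nonneg_4: "extensions_nonneg False False True False True True"
  by (simp add: extensions_nonneg_def both_def slack7_bits_def coef_bits_eval cong: both_cong)

lemma extensions_nonneg_5: "extensions_nonneg False False True True False False"
  by (simp add: extensions_nonneg_def both_def slack7_bits_def coef_bits_eval cong: both_cong)

lemma extensions_nonneg_6: "extensions_nonneg False False True True False True"
  by (simp add: extensions_nonneg_def both_def slack7_bits_def coef_bits_eval cong: both_cong)

lemma extensions_nonneg_7: "extensions_nonneg False False True True True True"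
  by (simp add: extensions_nonneg_def both_def slack7_bits_def coef_bits_eval cong: both_cong)

lemma extensions_nonneg_8: "extensions_nonneg False True True True True False"
  by (simp add: extensions_nonneg_def both_def slack7_bits_def coef_bits_eval cong: both_cong)

lemma extensions_nonneg_9: "extensions_nonneg False True True True True True"
  by (simp add: extensions_nonneg_def both_def slack7_bits_def coef_bits_eval cong: both_cong)

lemma extensions_nonneg_10: "extensions_nonneg True True True True True True"
  by (simp add: extensions_nonneg_def both_def slack7_bits_def coef_bits_eval cong: both_cong)

lemma adj_count_mset: "mset t = mset t' \<Longrightarrow> adj_count a t x = adj_count a t' x"
  unfolding adj_count_def by (metis mset_map sum_mset_sum_list)

lemma sum_list_cong_mset:
  fixes f g :: "'a \<Rightarrow> 'b :: comm_monoid_add"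
  assumes "mset xs = mset ys" "\<And>x. f x = g x"
  shows "sum_list (map f xs) = sum_list (map g ys)"
proof -
  have "f = g" using assms(2) by blast
  then show ?thesis using assms(1) by (metis mset_map sum_mset_sum_list)
qed

lemma walks2_mset: "mset t = mset t' \<Longrightarrow> walks2 a t x = walks2 a t' x"
  unfolding walks2_def by (intro sum_list_cong_mset) (simp_all add: adj_count_mset [of t t'])

lemma walks3_mset: "mset t = mset t' \<Longrightarrow> walks3 a t x = walks3 a t' x"
  unfolding walks3_def by (intro sum_list_cong_mset) (simp_all add: walks2_mset [of t t'])

lemma triangles_mset:
  assumes "mset t = mset t'"
  shows "triangles a t x = triangles a t' x"
proof -
  have "(\<Sum>z\<leftarrow>t. of_bool (a x z) * of_bool (a y z)) = (\<Sum>z\<leftarrow>t'. of_bool (a x z) * of_bool (a y z) :: nat)" for y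
    by (rule sum_list_cong_mset [OF assms refl])
  then show ?thesis
    unfolding triangles_def by (intro sum_list_cong_mset [OF assms]) simp
qed

lemma signature_mset: "mset t = mset t' \<Longrightarrow> signature a t x = signature a t' x"
  by (simp add: signature_def adj_count_mset [of t t'] walks2_mset [of t t'] walks3_mset [of t t'] triangles_mset [of t t'])

lemma type_key_mset:
  assumes "mset t = mset t'"
  shows "type_key a t = type_key a t'"
  unfolding type_key_def using assms
  by (auto intro!: sum_list_cong_mset simp: adj_count_mset [OF assms] walks2_mset [OF assms])

lemma local_coef_mset: "mset t = mset t' \<Longrightarrow> local_coef a t x y = local_coef a t' x y"
  by (simp add: local_coef_def type_key_mset [of t t'] signature_mset [of t t'])

lemma entry_commute: "entry G i j = entry G j i"
  by (simp add: entry_def max.commute min.commute conj_commute)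

lemma coef_commute: "coef k s s' = coef k s' s"
  by (simp add: coef_def entry_commute add.commute split: option.split)

lemma local_coef_commute: "local_coef a t x y = local_coef a t y x"
  by (simp add: local_coef_def coef_commute)

text \<open>
  The constant is 21 times 57600, one contribution for each of the 21 pairs of entries that can
  be singled out.
\<close>

definition slack7 :: "('v \<Rightarrow> 'v \<Rightarrow> bool) \<Rightarrow> 'v list \<Rightarrow> int" where
  "slack7 a xs = 1209600 - (\<Sum>i<7. \<Sum>j<i. local_coef a (del_at j (del_at i xs)) (xs ! j) (xs ! i))"

lemma slack7_swap:
  assumes "length (us @ x # y # vs) = 7"
  shows "slack7 a (us @ x # y # vs) = slack7 a (us @ y # x # vs)"
proof -
  have sw: "local_coef a [x1, x0, x2, x3, x4] y z = local_coef a [x0, x1, x2, x3, x4] y z"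
    "local_coef a [x0, x2, x1, x3, x4] y z = local_coef a [x0, x1, x2, x3, x4] y z"
    "local_coef a [x0, x1, x3, x2, x4] y z = local_coef a [x0, x1, x2, x3, x4] y z"
    "local_coef a [x0, x1, x2, x4, x3] y z = local_coef a [x0, x1, x2, x3, x4] y z"
    for x0 x1 x2 x3 x4 y z
    by (simp_all add: local_coef_mset add_mset_commute)
  have exp: "slack7 a [x0, x1, x2, x3, x4, x5, x6] = 1209600 -
     (local_coef a [x2, x3, x4, x5, x6] x0 x1 + (local_coef a [x1, x3, x4, x5, x6] x0 x2 + local_coef a [x0, x3, x4, x5, x6] x1 x2) +
      (local_coef a [x1, x2, x4, x5, x6] x0 x3 + local_coef a [x0, x2, x4, x5, x6] x1 x3 + local_coef a [x0, x1, x4, x5, x6] x2 x3) +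
      (local_coef a [x1, x2, x3, x5, x6] x0 x4 + local_coef a [x0, x2, x3, x5, x6] x1 x4 + local_coef a [x0, x1, x3, x5, x6] x2 x4 +
          local_coef a [x0, x1, x2, x5, x6] x3 x4) +
      (local_coef a [x1, x2, x3, x4, x6] x0 x5 + local_coef a [x0, x2, x3, x4, x6] x1 x5 + local_coef a [x0, x1, x3, x4, x6] x2 x5 +
          local_coef a [x0, x1, x2, x4, x6] x3 x5 + local_coef a [x0, x1, x2, x3, x6] x4 x5) +
      (local_coef a [x1, x2, x3, x4, x5] x0 x6 + local_coef a [x0, x2, x3, x4, x5] x1 x6 + local_coef a [x0, x1, x3, x4, x5] x2 x6 +
          local_coef a [x0, x1, x2, x4, x5] x3 x6 + local_coef a [x0, x1, x2, x3, x5] x4 x6 + local_coef a [x0, x1, x2, x3, x4] x5 x6))"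
    for x0 x1 x2 x3 x4 x5 x6
    by (simp add: slack7_def numeral_eq_Suc lessThan_Suc)
  have "length us = 0 \<or> length us = 1 \<or> length us = 2 \<or> length us = 3 \<or> length us = 4 \<or> length us = 5"
  proof -
    have "length us < 6"
      using assms by simp
    then show ?thesis
      by presburger
  qed
  then show ?thesis
    using assms
    by (elim disjE) (auto simp: length_Suc_conv numeral_eq_Suc exp sw local_coef_commute [of a _ y x])
qed

text \<open>
  The coefficient of a pair depends only on the graph induced by the other five vertices and on
  how the pair is attached to it, so that swapping two neighbouring entries permutes the 21
  summands.
\<close>

lemma slack7_mset:
  assumes "mset xs = mset ys" "length xs = 7"
  shows "slack7 a xs = slack7 a ys"
proof -
  define f where "f zs = (if length zs = 7 then slack7 a zs else 0)" for zs
  have "f xs = f ys"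
    by (rule mset_invariant_if_swap_invariant [OF _ assms(1)]) (simp add: f_def slack7_swap)
  then show ?thesis
    using assms mset_eq_length [OF assms(1)] by (simp add: f_def)
qed

definition upper_bits :: "('v \<Rightarrow> 'v \<Rightarrow> bool) \<Rightarrow> 'v list \<Rightarrow> bool list" where
  "upper_bits a ys = concat (map (\<lambda>j. map (\<lambda>i. a (ys ! i) (ys ! j)) [0..<j]) [0..<length ys])"

text \<open>An ordering of the vertices with the lexicographically least adjacency word.\<close>

lemma minimal_rearrangement:
  obtains ys where "mset ys = mset xs" "\<And>zs. mset zs = mset ys \<Longrightarrow> upper_bits a ys \<le> upper_bits a zs"
proof -
  define M where "M = {ys. mset ys = mset xs}"
  have "M \<subseteq> {ys. set ys \<subseteq> set xs \<and> length ys = length xs}"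
    unfolding M_def by (auto dest: mset_eq_setD mset_eq_length)
  then have fin: "finite M"
    by (rule finite_subset) (rule finite_lists_length_eq, simp)
  have "xs \<in> M" by (simp add: M_def)
  with fin have "Min (upper_bits a ` M) \<in> upper_bits a ` M"
    by (intro Min_in) auto
  then obtain ys where "ys \<in> M" "upper_bits a ys = Min (upper_bits a ` M)"
    by auto
  then show ?thesis
    using fin that [of ys] by (auto simp: M_def)
qed

lemma list_le_append_same_length:
  fixes us :: "'b :: linorder list"
  shows "us @ vs \<le> us' @ vs' \<Longrightarrow> length us = length us' \<Longrightarrow> us \<le> us'"
proof (induction us arbitrary: us')
  case (Cons u us)
  then show ?case
    by (cases us') (auto simp: less_le)
qed simp

text \<open>
  In an ordering with minimal adjacency word, exchanging two consecutive vertices cannot make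
  the word smaller.  The exchange swaps two rows of the adjacency matrix; hence these rows are
  sorted, apart from their entries in the two columns concerned.
\<close>

lemma (in simple_adjacency) sorted_rows_5:
  assumes "length xs = 5"
  obtains y0 y1 y2 y3 y4 where "mset [y0, y1, y2, y3, y4] = mset xs"
    "[a y0 y2, a y0 y3, a y0 y4] \<le> [a y1 y2, a y1 y3, a y1 y4]"
    "[a y0 y1, a y1 y3, a y1 y4] \<le> [a y0 y2, a y2 y3, a y2 y4]"
    "[a y0 y2, a y1 y2, a y2 y4] \<le> [a y0 y3, a y1 y3, a y3 y4]"
    "[a y0 y3, a y1 y3, a y2 y3] \<le> [a y0 y4, a y1 y4, a y2 y4]"
proof -
  obtain ys where ys: "mset ys = mset xs" "\<And>zs. mset zs = mset ys \<Longrightarrow> upper_bits a ys \<le> upper_bits a zs"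
    by (rule minimal_rearrangement [of xs a]) blast
  have "length ys = 5"
    using ys(1) assms by (metis size_mset)
  then obtain y0 y1 y2 y3 y4 where eq: "ys = [y0, y1, y2, y3, y4]"
    by (auto simp: length_Suc_conv numeral_eq_Suc)
  have min: "upper_bits a [y0, y1, y2, y3, y4] \<le> upper_bits a zs" if "mset zs = mset [y0, y1, y2, y3, y4]" for zs
    using ys(2) that eq by simp
  have sym: "a y1 y0 = a y0 y1" "a y2 y0 = a y0 y2" "a y2 y1 = a y1 y2" "a y3 y0 = a y0 y3" "a y3 y1 = a y1 y3" "a y3 y2 = a y2 y3" "a y4
      y0 = a y0 y4" "a y4 y1 = a y1 y4" "a y4 y2 = a y2 y4" "a y4 y3 = a y3 y4"
    using adj_sym by blast+

  have "[a y0 y2, a y0 y3, a y0 y4] \<le> [a y1 y2, a y1 y3, a y1 y4]"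
    using min [of "[y1, y0, y2, y3, y4]"]
    by (simp add: upper_bits_def numeral_eq_Suc upt_rec sym add_mset_commute) (auto simp: less_le)
  have "[a y0 y1, a y1 y3, a y1 y4] \<le> [a y0 y2, a y2 y3, a y2 y4]"
    using min [of "[y0, y2, y1, y3, y4]"]
    by (simp add: upper_bits_def numeral_eq_Suc upt_rec sym add_mset_commute) (auto simp: less_le)
  have "[a y0 y2, a y1 y2, a y2 y4] \<le> [a y0 y3, a y1 y3, a y3 y4]"
    using min [of "[y0, y1, y3, y2, y4]"]
    by (simp add: upper_bits_def numeral_eq_Suc upt_rec sym add_mset_commute) (auto simp: less_le)
  have bits: "upper_bits a [z0, z1, z2, z3, z4] = [a z0 z1, a z0 z2, a z1 z2, a z0 z3, a z1 z3, a z2 z3, a z0 z4, a z1 z4, a z2 z4, a z3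
      z4]" for z0 z1 z2 z3 z4
    by (simp add: upper_bits_def numeral_eq_Suc upt_rec)
  have "[a y0 y1, a y0 y2, a y1 y2, a y0 y3, a y1 y3, a y2 y3] @ [a y0 y4, a y1 y4, a y2 y4, a y3 y4] \<le> [a y0 y1, a y0 y2, a y1 y2, a
      y0 y4, a y1 y4, a y2 y4] @ [a y0 y3, a y1 y3, a y2 y3, a y3 y4]"
    using min [of "[y0, y1, y2, y4, y3]", unfolded bits] by (simp only: append.simps sym mset.simps add_mset_commute)
  then have "[a y0 y1, a y0 y2, a y1 y2, a y0 y3, a y1 y3, a y2 y3] \<le> [a y0 y1, a y0 y2, a y1 y2, a y0 y4, a y1 y4, a y2 y4]"
    by (rule list_le_append_same_length) simp
  then have "[a y0 y3, a y1 y3, a y2 y3] \<le> [a y0 y4, a y1 y4, a y2 y4]"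
    by (simp add: sym)
  have "mset [y0, y1, y2, y3, y4] = mset xs"
    using ys(1) eq by simp
  then show ?thesis
    by (rule that) fact+
qed

lemma (in simple_adjacency) sorted_rows_7:
  assumes "length xs = 7"
  obtains y0 y1 y2 y3 y4 y5 y6 where "mset [y0, y1, y2, y3, y4, y5, y6] = mset xs"
    "[a y0 y2, a y0 y3, a y0 y4, a y0 y5, a y0 y6] \<le> [a y1 y2, a y1 y3, a y1 y4, a y1 y5, a y1 y6]"
    "[a y0 y1, a y1 y3, a y1 y4, a y1 y5, a y1 y6] \<le> [a y0 y2, a y2 y3, a y2 y4, a y2 y5, a y2 y6]"
    "[a y0 y2, a y1 y2, a y2 y4, a y2 y5, a y2 y6] \<le> [a y0 y3, a y1 y3, a y3 y4, a y3 y5, a y3 y6]"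
    "[a y0 y3, a y1 y3, a y2 y3, a y3 y5, a y3 y6] \<le> [a y0 y4, a y1 y4, a y2 y4, a y4 y5, a y4 y6]"
    "[a y0 y4, a y1 y4, a y2 y4, a y3 y4, a y4 y6] \<le> [a y0 y5, a y1 y5, a y2 y5, a y3 y5, a y5 y6]"
    "[a y0 y5, a y1 y5, a y2 y5, a y3 y5, a y4 y5] \<le> [a y0 y6, a y1 y6, a y2 y6, a y3 y6, a y4 y6]"
proof -
  obtain ys where ys: "mset ys = mset xs" "\<And>zs. mset zs = mset ys \<Longrightarrow> upper_bits a ys \<le> upper_bits a zs"
    by (rule minimal_rearrangement [of xs a]) blast
  have "length ys = 7"
    using ys(1) assms by (metis size_mset)
  then obtain y0 y1 y2 y3 y4 y5 y6 where eq: "ys = [y0, y1, y2, y3, y4, y5, y6]"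
    by (auto simp: length_Suc_conv numeral_eq_Suc)
  have min: "upper_bits a [y0, y1, y2, y3, y4, y5, y6] \<le> upper_bits a zs" if "mset zs = mset [y0, y1, y2, y3, y4, y5, y6]" for zs
    using ys(2) that eq by simp
  have sym: "a y1 y0 = a y0 y1" "a y2 y0 = a y0 y2" "a y2 y1 = a y1 y2" "a y3 y0 = a y0 y3" "a y3 y1 = a y1 y3" "a y3 y2 = a y2 y3" "a y4
      y0 = a y0 y4" "a y4 y1 = a y1 y4" "a y4 y2 = a y2 y4" "a y4 y3 = a y3 y4" "a y5 y0 = a y0 y5" "a y5 y1 = a y1 y5" "a y5 y2 = a y2 y5"
      "a y5 y3 = a y3 y5" "a y5 y4 = a y4 y5" "a y6 y0 = a y0 y6" "a y6 y1 = a y1 y6" "a y6 y2 = a y2 y6" "a y6 y3 = a y3 y6" "a y6 y4 = a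
      y4 y6" "a y6 y5 = a y5 y6"
    using adj_sym by blast+

  have "[a y0 y2, a y0 y3, a y0 y4, a y0 y5, a y0 y6] \<le> [a y1 y2, a y1 y3, a y1 y4, a y1 y5, a y1 y6]"
    using min [of "[y1, y0, y2, y3, y4, y5, y6]"]
    by (simp add: upper_bits_def numeral_eq_Suc upt_rec sym add_mset_commute) (auto simp: less_le)
  have "[a y0 y1, a y1 y3, a y1 y4, a y1 y5, a y1 y6] \<le> [a y0 y2, a y2 y3, a y2 y4, a y2 y5, a y2 y6]"
    using min [of "[y0, y2, y1, y3, y4, y5, y6]"]
    by (simp add: upper_bits_def numeral_eq_Suc upt_rec sym add_mset_commute) (auto simp: less_le)
  have "[a y0 y2, a y1 y2, a y2 y4, a y2 y5, a y2 y6] \<le> [a y0 y3, a y1 y3, a y3 y4, a y3 y5, a y3 y6]"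
    using min [of "[y0, y1, y3, y2, y4, y5, y6]"]
    by (simp add: upper_bits_def numeral_eq_Suc upt_rec sym add_mset_commute) (auto simp: less_le)
  have "[a y0 y3, a y1 y3, a y2 y3, a y3 y5, a y3 y6] \<le> [a y0 y4, a y1 y4, a y2 y4, a y4 y5, a y4 y6]"
    using min [of "[y0, y1, y2, y4, y3, y5, y6]"]
    by (simp add: upper_bits_def numeral_eq_Suc upt_rec sym add_mset_commute) (auto simp: less_le)
  have "[a y0 y4, a y1 y4, a y2 y4, a y3 y4, a y4 y6] \<le> [a y0 y5, a y1 y5, a y2 y5, a y3 y5, a y5 y6]"
    using min [of "[y0, y1, y2, y3, y5, y4, y6]"]
    by (simp add: upper_bits_def numeral_eq_Suc upt_rec sym add_mset_commute) (auto simp: less_le)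
  have bits: "upper_bits a [z0, z1, z2, z3, z4, z5, z6] = [a z0 z1, a z0 z2, a z1 z2, a z0 z3, a z1 z3, a z2 z3, a z0 z4, a z1 z4, a z2 z4,
      a z3 z4, a z0 z5, a z1 z5, a z2 z5, a z3 z5, a z4 z5, a z0 z6, a z1 z6, a z2 z6, a z3 z6, a z4 z6, a z5 z6]" for z0 z1 z2 z3 z4 z5 z6
    by (simp add: upper_bits_def numeral_eq_Suc upt_rec)
  have "[a y0 y1, a y0 y2, a y1 y2, a y0 y3, a y1 y3, a y2 y3, a y0 y4, a y1 y4, a y2 y4, a y3 y4, a y0 y5, a y1 y5, a y2 y5, a y3 y5, a y4
      y5] @ [a y0 y6, a y1 y6, a y2 y6, a y3 y6, a y4 y6, a y5 y6] \<le> [a y0 y1, a y0 y2, a y1 y2, a y0 y3, a y1 y3, a y2 y3, a y0 y4, a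
      y1 y4, a y2 y4, a y3 y4, a y0 y6, a y1 y6, a y2 y6, a y3 y6, a y4 y6] @ [a y0 y5, a y1 y5, a y2 y5, a y3 y5, a y4 y5, a y5 y6]"
    using min [of "[y0, y1, y2, y3, y4, y6, y5]", unfolded bits] by (simp only: append.simps sym mset.simps add_mset_commute)
  then have "[a y0 y1, a y0 y2, a y1 y2, a y0 y3, a y1 y3, a y2 y3, a y0 y4, a y1 y4, a y2 y4, a y3 y4, a y0 y5, a y1 y5, a y2 y5, a y3 y5,
      a y4 y5] \<le> [a y0 y1, a y0 y2, a y1 y2, a y0 y3, a y1 y3, a y2 y3, a y0 y4, a y1 y4, a y2 y4, a y3 y4, a y0 y6, a y1 y6, a y2 y6,
      a y3 y6, a y4 y6]"
    by (rule list_le_append_same_length) simp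
  then have "[a y0 y5, a y1 y5, a y2 y5, a y3 y5, a y4 y5] \<le> [a y0 y6, a y1 y6, a y2 y6, a y3 y6, a y4 y6]"
    by (simp add: sym)
  have "mset [y0, y1, y2, y3, y4, y5, y6] = mset xs"
    using ys(1) eq by simp
  then show ?thesis
    by (rule that) fact+
qed

lemma extensions_nonneg_sorted:
  assumes "[b02, b03] \<le> [b12, b13] \<and> [b01, b13] \<le> [b02, b23] \<and> [b02, b12] \<le> [b03, b13]"
  shows "extensions_nonneg b01 b02 b12 b03 b13 b23"
  using assms extensions_nonneg_0 extensions_nonneg_1 extensions_nonneg_2 extensions_nonneg_3 extensions_nonneg_4 extensions_nonneg_5
      extensions_nonneg_6 extensions_nonneg_7 extensions_nonneg_8 extensions_nonneg_9 extensions_nonneg_10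
  by (cases b01; cases b02; cases b12; cases b03; cases b13; cases b23) simp_all

lemma slack7_bits_nonneg:
  assumes "[b02, b03] \<le> [b12, b13] \<and> [b01, b13] \<le> [b02, b23] \<and> [b02, b12] \<le> [b03, b13]"
    and "[b02, b03, b04] \<le> [b12, b13, b14] \<and> [b01, b13, b14] \<le> [b02, b23, b24] \<and> [b02, b12, b24] \<le> [b03, b13, b34]
        \<and> [b03, b13, b23] \<le> [b04, b14, b24]"
    and "[b02, b03, b04, b05] \<le> [b12, b13, b14, b15] \<and> [b01, b13, b14, b15] \<le> [b02, b23, b24, b25] \<and> [b02, b12, b24, b25]
        \<le> [b03, b13, b34, b35] \<and> [b03, b13, b23, b35] \<le> [b04, b14, b24, b45] \<and> [b04, b14, b24, b34] \<le> [b05, b15, b25, b35]"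
    and "[b02, b03, b04, b05, b06] \<le> [b12, b13, b14, b15, b16] \<and> [b01, b13, b14, b15, b16] \<le> [b02, b23, b24, b25, b26] \<and>
        [b02, b12, b24, b25, b26] \<le> [b03, b13, b34, b35, b36] \<and> [b03, b13, b23, b35, b36] \<le> [b04, b14, b24, b45, b46] \<and>
        [b04, b14, b24, b34, b46] \<le> [b05, b15, b25, b35, b56] \<and> [b05, b15, b25, b35, b45] \<le> [b06, b16, b26, b36, b46]"
  shows "0 \<le> slack7_bits b01 b02 b12 b03 b13 b23 b04 b14 b24 b34 b05 b15 b25 b35 b45 b06 b16 b26 b36 b46 b56"
proof -
  have "both P = (\<forall>b. P b)" "(if c then d else True) = (c \<longrightarrow> d)" for P c d
    by (auto simp: both_def) (metis (full_types))
  note * = extensions_nonneg_sorted [OF assms(1), unfolded extensions_nonneg_def this]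
  show ?thesis
    by (rule *[THEN spec, THEN spec, THEN spec, THEN spec, THEN mp, OF assms(2), THEN spec, THEN spec, THEN spec, THEN spec, THEN spec,
        THEN mp, OF assms(3),
      THEN spec, THEN spec, THEN spec, THEN spec, THEN spec, THEN spec, THEN mp, OF assms(4)])
qed

context simple_adjacency
begin

lemma slack7_eq_bits: "slack7 a [y0, y1, y2, y3, y4, y5, y6] = slack7_bits (a y0 y1) (a y0 y2) (a y1 y2) (a y0 y3) (a y1 y3) (a y2 y3) (a
    y0 y4) (a y1 y4) (a y2 y4) (a y3 y4) (a y0 y5) (a y1 y5) (a y2 y5) (a y3 y5) (a y4 y5) (a y0 y6) (a y1 y6) (a y2 y6) (a y3 y6) (a y4
    y6) (a y5 y6)"
proof -
  have sym: "a y1 y0 = a y0 y1" "a y2 y0 = a y0 y2" "a y2 y1 = a y1 y2" "a y3 y0 = a y0 y3" "a y3 y1 = a y1 y3" "a y3 y2 = a y2 y3" "a y4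
      y0 = a y0 y4" "a y4 y1 = a y1 y4" "a y4 y2 = a y2 y4" "a y4 y3 = a y3 y4" "a y5 y0 = a y0 y5" "a y5 y1 = a y1 y5" "a y5 y2 = a y2 y5"
      "a y5 y3 = a y3 y5" "a y5 y4 = a y4 y5" "a y6 y0 = a y0 y6" "a y6 y1 = a y1 y6" "a y6 y2 = a y2 y6" "a y6 y3 = a y3 y6" "a y6 y4 = a
      y4 y6" "a y6 y5 = a y5 y6"
    using adj_sym by blast+
  show ?thesis
    by (simp add: slack7_def slack7_bits_def numeral_eq_Suc lessThan_Suc local_coef_eq_bits sym)
qed

text \<open>
  Rearranging the vertices reduces the claim to the sorted labelled graphs of the finite check.
\<close>

lemma slack7_nonneg:
  assumes "length xs = 7"
  shows "0 \<le> slack7 a xs"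
proof -
  obtain y0 y1 y2 y3 y4 y5 y6 where m: "mset [y0, y1, y2, y3, y4, y5, y6] = mset xs"
    and rows:       "[a y0 y2, a y0 y3, a y0 y4, a y0 y5, a y0 y6] \<le> [a y1 y2, a y1 y3, a y1 y4, a y1 y5, a y1 y6]"
      "[a y0 y1, a y1 y3, a y1 y4, a y1 y5, a y1 y6] \<le> [a y0 y2, a y2 y3, a y2 y4, a y2 y5, a y2 y6]"
      "[a y0 y2, a y1 y2, a y2 y4, a y2 y5, a y2 y6] \<le> [a y0 y3, a y1 y3, a y3 y4, a y3 y5, a y3 y6]"
      "[a y0 y3, a y1 y3, a y2 y3, a y3 y5, a y3 y6] \<le> [a y0 y4, a y1 y4, a y2 y4, a y4 y5, a y4 y6]"
      "[a y0 y4, a y1 y4, a y2 y4, a y3 y4, a y4 y6] \<le> [a y0 y5, a y1 y5, a y2 y5, a y3 y5, a y5 y6]"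
      "[a y0 y5, a y1 y5, a y2 y5, a y3 y5, a y4 y5] \<le> [a y0 y6, a y1 y6, a y2 y6, a y3 y6, a y4 y6]"
    using assms by (rule sorted_rows_7)
  have "[a y0 y2, a y0 y3] \<le> [a y1 y2, a y1 y3]"
    by (rule list_le_append_same_length [of _ "[a y0 y4, a y0 y5, a y0 y6]" _ "[a y1 y4, a y1 y5, a y1 y6]"])
      (simp_all only: append.simps rows list.size)
  have "[a y0 y1, a y1 y3] \<le> [a y0 y2, a y2 y3]"
    by (rule list_le_append_same_length [of _ "[a y1 y4, a y1 y5, a y1 y6]" _ "[a y2 y4, a y2 y5, a y2 y6]"])
      (simp_all only: append.simps rows list.size)
  have "[a y0 y2, a y1 y2] \<le> [a y0 y3, a y1 y3]"
    by (rule list_le_append_same_length [of _ "[a y2 y4, a y2 y5, a y2 y6]" _ "[a y3 y4, a y3 y5, a y3 y6]"])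
      (simp_all only: append.simps rows list.size)
  have "[a y0 y2, a y0 y3, a y0 y4] \<le> [a y1 y2, a y1 y3, a y1 y4]"
    by (rule list_le_append_same_length [of _ "[a y0 y5, a y0 y6]" _ "[a y1 y5, a y1 y6]"])
      (simp_all only: append.simps rows list.size)
  have "[a y0 y1, a y1 y3, a y1 y4] \<le> [a y0 y2, a y2 y3, a y2 y4]"
    by (rule list_le_append_same_length [of _ "[a y1 y5, a y1 y6]" _ "[a y2 y5, a y2 y6]"])
      (simp_all only: append.simps rows list.size)
  have "[a y0 y2, a y1 y2, a y2 y4] \<le> [a y0 y3, a y1 y3, a y3 y4]"
    by (rule list_le_append_same_length [of _ "[a y2 y5, a y2 y6]" _ "[a y3 y5, a y3 y6]"])
      (simp_all only: append.simps rows list.size)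
  have "[a y0 y3, a y1 y3, a y2 y3] \<le> [a y0 y4, a y1 y4, a y2 y4]"
    by (rule list_le_append_same_length [of _ "[a y3 y5, a y3 y6]" _ "[a y4 y5, a y4 y6]"])
      (simp_all only: append.simps rows list.size)
  have "[a y0 y2, a y0 y3, a y0 y4, a y0 y5] \<le> [a y1 y2, a y1 y3, a y1 y4, a y1 y5]"
    by (rule list_le_append_same_length [of _ "[a y0 y6]" _ "[a y1 y6]"])
      (simp_all only: append.simps rows list.size)
  have "[a y0 y1, a y1 y3, a y1 y4, a y1 y5] \<le> [a y0 y2, a y2 y3, a y2 y4, a y2 y5]"
    by (rule list_le_append_same_length [of _ "[a y1 y6]" _ "[a y2 y6]"])
      (simp_all only: append.simps rows list.size)
  have "[a y0 y2, a y1 y2, a y2 y4, a y2 y5] \<le> [a y0 y3, a y1 y3, a y3 y4, a y3 y5]"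
    by (rule list_le_append_same_length [of _ "[a y2 y6]" _ "[a y3 y6]"])
      (simp_all only: append.simps rows list.size)
  have "[a y0 y3, a y1 y3, a y2 y3, a y3 y5] \<le> [a y0 y4, a y1 y4, a y2 y4, a y4 y5]"
    by (rule list_le_append_same_length [of _ "[a y3 y6]" _ "[a y4 y6]"])
      (simp_all only: append.simps rows list.size)
  have "[a y0 y4, a y1 y4, a y2 y4, a y3 y4] \<le> [a y0 y5, a y1 y5, a y2 y5, a y3 y5]"
    by (rule list_le_append_same_length [of _ "[a y4 y6]" _ "[a y5 y6]"])
      (simp_all only: append.simps rows list.size)

  have "0 \<le> slack7_bits (a y0 y1) (a y0 y2) (a y1 y2) (a y0 y3) (a y1 y3) (a y2 y3) (a y0 y4) (a y1 y4) (a y2 y4) (a y3 y4) (a y0 y5)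
      (a y1 y5) (a y2 y5) (a y3 y5) (a y4 y5) (a y0 y6) (a y1 y6) (a y2 y6) (a y3 y6) (a y4 y6) (a y5 y6)"
    by (rule slack7_bits_nonneg; intro conjI; fact)
  moreover have "slack7 a [y0, y1, y2, y3, y4, y5, y6] = slack7 a xs"
    by (rule slack7_mset [OF m]) simp
  ultimately show ?thesis
    by (simp only: slack7_eq_bits)
qed

end

section \<open>The Gram matrices are positive semidefinite\<close>

text \<open>
  Each form is displayed as a positive combination of squares of linear forms; these are the
  pivots of a fraction-free Cholesky decomposition.
\<close>

lemma gram_psd_0_0:
  fixes y :: "nat \<Rightarrow> real"
  shows "0 \<le> (\<Sum>i<6. \<Sum>j<6. y i * y j * real_of_int (entry gram_0_0 i j))"
proof -
  have "1 * ((\<Sum>i<6. \<Sum>j<6. y i * y j * real_of_int (entry gram_0_0 i j))) =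
    576 * (10 * y 0 + 1 * y 1 + (-8) * y 2 + (-17) * y 3 + (-26) * y 4 + (-35) * y 5)^2"
    unfolding gram_0_0_def
    by (simp add: entry_def eval_nat_numeral lessThan_Suc) algebra
  also have "\<dots> \<ge> 0"
    by (intro add_nonneg_nonneg mult_nonneg_nonneg zero_le_power2) simp_all
  finally show ?thesis
    by simp
qed

text \<open>
  For \<open>2K\<^sub>2 + K\<^sub>1\<close> two squares can be split off.  They record two
  relations between the parts of a balanced blowup, and force these relations to hold
  approximately in every graph near the maximum.
\<close>

lemma gram_psd_4_4:
  fixes y :: "nat \<Rightarrow> real"
  shows "100 * ((y 2 - 2 * y 1)^2 + (y 4 - y 1)^2) \<le> (\<Sum>i<6. \<Sum>j<6. y i * y j * real_of_int (entry gram_4_4 i j))"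
proof -
  have "153294336482500067426609732376245628386378980 * ((\<Sum>i<6. \<Sum>j<6. y i * y j * real_of_int (entry gram_4_4 i j)) - 100 * ((y 2
      - 2 * y 1)^2 + (y 4 - y 1)^2)) =
    740480806117766725082647726674937824299 * (414040 * y 0 + (-526680) * y 1 + 120689 * y 2 + (-181291) * y 3 + 78282 * y 4 + (-341264) * y 5)^2 +
    202497272059352114742344249766565 * (804483812 * y 1 + (-237955254) * y 2 + (-235656323) * y 3 + (-328573304) * y 4 + (-534227749) * y 5)^2 +
    777958473798370360669 * (48987173332657 * y 2 + 37453402975547 * y 3 + (-97974346665314) * y 4 + (-81940332851762) * y 5)^2 +
    17204983343 * (4133679456952021045 * y 3 + 4734319383274166301 * y 5)^2 +
    347893428796329048735918492982678011705909349892 * (1 * y 5)^2"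
    unfolding gram_4_4_def
    by (simp add: entry_def eval_nat_numeral lessThan_Suc) algebra
  also have "\<dots> \<ge> 0"
    by (intro add_nonneg_nonneg mult_nonneg_nonneg zero_le_power2) simp_all
  finally show ?thesis
    by simp
qed

lemma gram_psd_30_72:
  fixes y :: "nat \<Rightarrow> real"
  shows "0 \<le> (\<Sum>i<4. \<Sum>j<4. y i * y j * real_of_int (entry gram_30_72 i j))"
proof -
  have "18484140893 * ((\<Sum>i<4. \<Sum>j<4. y i * y j * real_of_int (entry gram_30_72 i j))) =
    116481392 * (2539 * y 0 + (-5535) * y 1 + (-237) * y 2 + (-9462) * y 3)^2 +
    144 * (7280087 * y 1 + (-5015557) * y 2 + (-2264530) * y 3)^2 +
    12248308570752 * (1 * y 2 + (-1) * y 3)^2"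
    unfolding gram_30_72_def
    by (simp add: entry_def eval_nat_numeral lessThan_Suc) algebra
  also have "\<dots> \<ge> 0"
    by (intro add_nonneg_nonneg mult_nonneg_nonneg zero_le_power2) simp_all
  finally show ?thesis
    by simp
qed

lemma gram_psd_2_2:
  fixes y :: "nat \<Rightarrow> real"
  shows "0 \<le> (\<Sum>i<8. \<Sum>j<8. y i * y j * real_of_int (entry gram_2_2 i j))"
proof -
  have "12676670113634705588126414450364053038778454041937782533920 * ((\<Sum>i<8. \<Sum>j<8. y i * y j * real_of_int (entry gram_2_2 i j))) =
    463328586024660291963684738682896675393949343638076847 * (54720 * y 0 + (-62326) * y 1 + (-96377) * y 2 + (-213423) * y 3 + 78819 * y 4
        + 35857 * y 5 + 50328 * y 6 + 31066 * y 7)^2 +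
    243808195008618083721024340508276327570495577 * (3800763022 * y 1 + 742406429 * y 2 + 4543169451 * y 3 + (-3512949423) * y 4 +
        (-3162458389) * y 5 + (-2060440056) * y 6 + (-3624320962) * y 7)^2 +
    171438586048808433210277861895158560 * (38909514883287 * y 2 + 38909514883287 * y 3 + (-17297522055315) * y 4 + (-685062451063) * y 5 +
        (-43223985655944) * y 6 + 15936047177034 * y 7)^2 +
    742129352709783049166569672720 * (2634031800598068 * y 4 + 922932287377029 * y 5 + (-5268063601196136) * y 6 + 2472164766079255 * y 7)^2 +
    337179727448971395942355920 * (256918409476045801 * y 5 + 127311890010377033 * y 7)^2 +
    24439491405569709593380581720518226607680292601337118977882080 * (1 * y 7)^2"
    unfolding gram_2_2_def
    by (simp add: entry_def eval_nat_numeral lessThan_Suc) algebra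
  also have "\<dots> \<ge> 0"
    by (intro add_nonneg_nonneg mult_nonneg_nonneg zero_le_power2) simp_all
  finally show ?thesis
    by simp
qed

lemma gram_psd_6_8:
  fixes y :: "nat \<Rightarrow> real"
  shows "0 \<le> (\<Sum>i<8. \<Sum>j<8. y i * y j * real_of_int (entry gram_6_8 i j))"
proof -
  have "4952426670443304080756750247339941161955685654960 * ((\<Sum>i<8. \<Sum>j<8. y i * y j * real_of_int (entry gram_6_8 i j))) =
    3938311467549347181516302383570529751058199328 * (5030 * y 0 + 7070 * y 1 + 9110 * y 2 + (-15408) * y 3 + (-2036) * y 4 + (-5339) * y 5
        + (-13027) * y 6 + (-20896) * y 7)^2 +
    1676706440755231025963692505106367817760 * (11744189 * y 1 + 23488378 * y 2 + (-47425888) * y 3 + 12369508 * y 4 + (-353790) * y 5 +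
        (-19293253) * y 6 + (-11920376) * y 7)^2 +
    442480513365617575228756807173 * (3049655979776 * y 3 + (-1962095170948) * y 4 + (-1433594127632) * y 5 + (-231870528701) * y 6 +
        (-1087560808828) * y 7)^2 +
    7386173688375029509856795 * (14071087404732 * y 4 + 1526130103312 * y 5 + (-2990613773357) * y 6 + (-14071087404732) * y 7)^2 +
    39408502250182558055920 * (250068215441677 * y 5 + 54464779827253 * y 6)^2 +
    37989863581202079242932556452974857772080802581412960 * (1 * y 6)^2"
    unfolding gram_6_8_def
    by (simp add: entry_def eval_nat_numeral lessThan_Suc) algebra
  also have "\<dots> \<ge> 0"
    by (intro add_nonneg_nonneg mult_nonneg_nonneg zero_le_power2) simp_all
  finally show ?thesis
    by simp
qed

lemma gram_psd_8_10:
  fixes y :: "nat \<Rightarrow> real"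
  shows "0 \<le> (\<Sum>i<6. \<Sum>j<6. y i * y j * real_of_int (entry gram_8_10 i j))"
proof -
  have "400787715588083429912240320527947400 * ((\<Sum>i<6. \<Sum>j<6. y i * y j * real_of_int (entry gram_8_10 i j))) =
    7131454014022836831178653390177 * (168600 * y 0 + (-134796) * y 1 + (-68066) * y 2 + (-73869) * y 3 + (-92413) * y 4 + (-75729) * y 5)^2 +
    4648287630595033428373707 * (18410532 * y 1 + 43008622 * y 2 + 1877123 * y 3 + (-247678429) * y 4 + 167848743 * y 5)^2 +
    1073938002825230548 * (243248459550 * y 2 + (-1399103441) * y 3 + (-4280119182) * y 4 + (-238968340368) * y 5)^2 +
    862226582 * (1910921713212154 * y 3 + (-94164744861867) * y 4 + 94164744861867 * y 5)^2 +
    10893538583088085311623524895945876574750 * (1 * y 4 + (-1) * y 5)^2"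
    unfolding gram_8_10_def
    by (simp add: entry_def eval_nat_numeral lessThan_Suc) algebra
  also have "\<dots> \<ge> 0"
    by (intro add_nonneg_nonneg mult_nonneg_nonneg zero_le_power2) simp_all
  finally show ?thesis
    by simp
qed

lemma gram_psd_14_26:
  fixes y :: "nat \<Rightarrow> real"
  shows "0 \<le> (\<Sum>i<5. \<Sum>j<5. y i * y j * real_of_int (entry gram_14_26 i j))"
proof -
  have "110952264805949561108108484 * ((\<Sum>i<5. \<Sum>j<5. y i * y j * real_of_int (entry gram_14_26 i j))) =
    184194714169421746831 * (602364 * y 0 + (-429063) * y 1 + (-129942) * y 2 + (-273008) * y 3 + (-31046) * y 4)^2 +
    68791533581 * (8032734753 * y 1 + 34629003342 * y 2 + (-16898157616) * y 3 + (-13692541006) * y 4)^2 +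
    43026 * (5778488820804 * y 2 + (-1926162940268) * y 3 + (-1989355231169) * y 4)^2 +
    133050135369092805266900414370 * (1 * y 4)^2"
    unfolding gram_14_26_def
    by (simp add: entry_def eval_nat_numeral lessThan_Suc) algebra
  also have "\<dots> \<ge> 0"
    by (intro add_nonneg_nonneg mult_nonneg_nonneg zero_le_power2) simp_all
  finally show ?thesis
    by simp
qed

lemma gram_psd_12_18:
  fixes y :: "nat \<Rightarrow> real"
  shows "0 \<le> (\<Sum>i<7. \<Sum>j<7. y i * y j * real_of_int (entry gram_12_18 i j))"
proof -
  have "20464086634655985979730033382586595148857353499682384 * ((\<Sum>i<7. \<Sum>j<7. y i * y j * real_of_int (entry gram_12_18 i j))) =
    199128976283045169505391107957599594707081518563 * (102768 * y 0 + (-123798) * y 1 + (-22876) * y 2 + (-65624) * y 3 + (-87269) * y 4 +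
        (-174564) * y 5 + (-74976) * y 6)^2 +
    156838556338415818569850247643351604509 * (7617858042 * y 1 + (-6007770108) * y 2 + (-2931440280) * y 3 + (-741562781) * y 4 +
        (-6307078100) * y 5 + (-6296505696) * y 6)^2 +
    148833203854753308549288344053198176 * (34077023176 * y 2 + (-123432160519) * y 3 + 522434996 * y 4 + (-586158513) * y 5 + 89355137343 * y 6)^2 +
    1581553812283576500189801800608 * (6075285969393 * y 3 + (-601561138550) * y 4 + (-1125692182037) * y 5 + (-6075285969393) * y 6)^2 +
    13305338349355844876 * (4290893206031539732 * y 4 + 123725172474986731 * y 5)^2 +
    28379539233414582130593775574765631653349861531824820228 * (1 * y 5)^2"
    unfolding gram_12_18_def
    by (simp add: entry_def eval_nat_numeral lessThan_Suc) algebra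
  also have "\<dots> \<ge> 0"
    by (intro add_nonneg_nonneg mult_nonneg_nonneg zero_le_power2) simp_all
  finally show ?thesis
    by simp
qed

lemma gram_psd_26_66:
  fixes y :: "nat \<Rightarrow> real"
  shows "0 \<le> (\<Sum>i<7. \<Sum>j<7. y i * y j * real_of_int (entry gram_26_66 i j))"
proof -
  have "1449283493987982492622284797524286425891099876894680960 * ((\<Sum>i<7. \<Sum>j<7. y i * y j * real_of_int (entry gram_26_66 i j))) =
    14534694861079734561760718845517955972110677520205 * (99712 * y 0 + (-174528) * y 1 + 53203 * y 2 + (-49680) * y 3 + 49568 * y 4 +
        (-3449) * y 5 + (-51972) * y 6)^2 +
    6011000904803756783536550101262969842984140 * (154753008 * y 1 + (-371663511) * y 2 + (-135334024) * y 3 + (-38837968) * y 4 +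
        (-167639019) * y 5 + (-112646016) * y 6)^2 +
    5384279915059713354647533887922615 * (652255702533 * y 2 + 40553313776 * y 3 + (-81106627552) * y 4 + 252068626993 * y 5 + 218204212788 * y 6)^2 +
    43872390382132674529690157120 * (50645884910726 * y 3 + (-101291769821452) * y 4 + 13475242895494 * y 5 + 22088674318131 * y 6)^2 +
    139788651361267806322944 * (272945541065849495 * y 5 + 29394003577104336 * y 6)^2 +
    9662518606207409072205243276448719634251253126825942350336 * (1 * y 6)^2"
    unfolding gram_26_66_def
    by (simp add: entry_def eval_nat_numeral lessThan_Suc) algebra
  also have "\<dots> \<ge> 0"
    by (intro add_nonneg_nonneg mult_nonneg_nonneg zero_le_power2) simp_all
  finally show ?thesis
    by simp
qed

lemma gram_psd_20_32:
  fixes y :: "nat \<Rightarrow> real"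
  shows "0 \<le> (\<Sum>i<4. \<Sum>j<4. y i * y j * real_of_int (entry gram_20_32 i j))"
proof -
  have "30016753 * ((\<Sum>i<4. \<Sum>j<4. y i * y j * real_of_int (entry gram_20_32 i j))) =
    1037296 * (926 * y 0 + (-1821) * y 1 + (-339) * y 2 + (-3396) * y 3)^2 +
    144 * (194493 * y 1 + (-179975) * y 2 + (-14518) * y 3)^2 +
    57590740224 * (1 * y 2 + (-1) * y 3)^2"
    unfolding gram_20_32_def
    by (simp add: entry_def eval_nat_numeral lessThan_Suc) algebra
  also have "\<dots> \<ge> 0"
    by (intro add_nonneg_nonneg mult_nonneg_nonneg zero_le_power2) simp_all
  finally show ?thesis
    by simp
qed

section \<open>The counting identity\<close>

definition leaf :: "('v \<Rightarrow> 'v \<Rightarrow> bool) \<Rightarrow> 'v list \<Rightarrow> 'v \<Rightarrow> bool" where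
  "leaf a t x \<longleftrightarrow> type_key a t = (4, 4) \<and> signature a t x = leaf_sig"

definition gram_coef :: "('v \<Rightarrow> 'v \<Rightarrow> bool) \<Rightarrow> 'v list \<Rightarrow> 'v \<Rightarrow> 'v \<Rightarrow> int" where
  "gram_coef a t x y = (case map_of certificate (type_key a t) of None \<Rightarrow> 0
     | Some (ss, G) \<Rightarrow> entry G (position ss (signature a t x)) (position ss (signature a t y)))"

definition leaf_total :: "'v set \<Rightarrow> ('v \<Rightarrow> real) \<Rightarrow> ('v \<Rightarrow> 'v \<Rightarrow> bool) \<Rightarrow>
    real" where
  "leaf_total V w a = (\<Sum>t\<in>tup V 5. \<Sum>x\<in>V. weight w t * w x * of_bool (leaf a t x))"

definition gram_form :: "'v set \<Rightarrow> ('v \<Rightarrow> real) \<Rightarrow> ('v \<Rightarrow> 'v \<Rightarrow> bool) \<Rightarrow>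
    'v list \<Rightarrow> real" where
  "gram_form V w a t = (\<Sum>x\<in>V. \<Sum>y\<in>V. w x * w y * real_of_int (gram_coef a t x y))"

lemma local_coef_eq: "local_coef a t x y = 393660 * (of_bool (leaf a t x) + of_bool (leaf a t y)) + gram_coef a t x y"
  by (simp add: local_coef_def coef_def leaf_def gram_coef_def)

lemma sum_classes:
  fixes w :: "'v \<Rightarrow> real" and E :: "nat \<Rightarrow> nat \<Rightarrow> real"
  assumes "finite V" and E: "\<And>i j. \<not> (i < n \<and> j < n) \<Longrightarrow> E i j = 0"
  shows "(\<Sum>x\<in>V. \<Sum>y\<in>V. w x * w y * E (p x) (p y)) =
    (\<Sum>i<n. \<Sum>j<n. (\<Sum>x\<in>{x\<in>V. p x = i}. w x) * (\<Sum>x\<in>{x\<in>V. p x = j}. w x) * E i j)"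
proof -
  define U where "U = {x\<in>V. p x < n}"
  have U: "finite U" "U \<subseteq> V" "p ` U \<subseteq> {..<n}" using assms(1) by (auto simp: U_def)
  have cls: "{x \<in> U. p x = i} = {x \<in> V. p x = i}" if "i < n" for i
    using that by (auto simp: U_def)
  have "(\<Sum>x\<in>V. \<Sum>y\<in>V. w x * w y * E (p x) (p y)) = (\<Sum>x\<in>U. \<Sum>y\<in>U. w x * w y * E (p x) (p y))"
    using U assms(1) by (intro sum.mono_neutral_cong_right sum.mono_neutral_right sum.neutral ballI) (auto simp: U_def E)
  also have "\<dots> = (\<Sum>x\<in>U. \<Sum>j<n. \<Sum>y\<in>{y\<in>U. p y = j}. w x * w y * E (p x) (p y))"
    by (intro sum.cong refl sum.group [OF U(1) finite_lessThan U(3), symmetric])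
  also have "\<dots> = (\<Sum>i<n. \<Sum>x\<in>{x\<in>U. p x = i}. \<Sum>j<n. \<Sum>y\<in>{y\<in>U. p y = j}. w x * w y * E (p x) (p y))"
    by (rule sum.group [OF U(1) finite_lessThan U(3), symmetric])
  also have "\<dots> = (\<Sum>i<n. \<Sum>j<n. (\<Sum>x\<in>{x\<in>V. p x = i}. w x) * (\<Sum>x\<in>{x\<in>V. p x = j}. w x) * E i j)"
  proof (intro sum.cong refl)
    fix i assume "i \<in> {..<n}"
    have "(\<Sum>x\<in>{x\<in>U. p x = i}. \<Sum>j<n. \<Sum>y\<in>{y\<in>U. p y = j}. w x * w y * E (p x) (p y)) =
      (\<Sum>j<n. \<Sum>x\<in>{x\<in>U. p x = i}. \<Sum>y\<in>{y\<in>U. p y = j}. w x * w y * E i j)"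
      by (subst sum.swap) simp
    also have "\<dots> = (\<Sum>j<n. (\<Sum>x\<in>{x\<in>U. p x = i}. w x) * (\<Sum>x\<in>{x\<in>U. p x = j}. w x) * E i j)"
      unfolding sum_product unfolding sum_distrib_right ..
    also have "\<dots> = (\<Sum>j<n. (\<Sum>x\<in>{x\<in>V. p x = i}. w x) * (\<Sum>x\<in>{x\<in>V. p x = j}. w x) * E i j)"
      using \<open>i \<in> {..<n}\<close> cls by simp
    finally show "(\<Sum>x\<in>{x\<in>U. p x = i}. \<Sum>j<n. \<Sum>y\<in>{y\<in>U. p y = j}. w x * w y * E (p x) (p y)) =
      (\<Sum>j<n. (\<Sum>x\<in>{x\<in>V. p x = i}. w x) * (\<Sum>x\<in>{x\<in>V. p x = j}. w x) * E i j)" .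
  qed
  finally show ?thesis .
qed

lemma entry_outside: "\<not> (i < length G \<and> j < length G) \<Longrightarrow> entry G i j = 0"
  unfolding entry_def by argo

lemma gram_form_eq:
  assumes "finite V" "map_of certificate (type_key a t) = Some (ss, G)" "length G = n"
  shows "gram_form V w a t = (\<Sum>i<n. \<Sum>j<n. (\<Sum>x\<in>{x\<in>V. position ss (signature a t x) = i}. w x) *
     (\<Sum>x\<in>{x\<in>V. position ss (signature a t x) = j}. w x) * real_of_int (entry G i j))"
  unfolding gram_form_def gram_coef_def assms(2) option.case prod.case
  by (rule sum_classes [OF assms(1)]) (simp add: entry_outside assms(3))

lemma length_gram:
  "length gram_0_0 = 6"
  "length gram_4_4 = 6"
  "length gram_30_72 = 4"
  "length gram_2_2 = 8"
  "length gram_6_8 = 8"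
  "length gram_8_10 = 6"
  "length gram_14_26 = 5"
  "length gram_12_18 = 7"
  "length gram_26_66 = 7"
  "length gram_20_32 = 4"
  by (simp_all add: gram_0_0_def gram_4_4_def gram_30_72_def gram_2_2_def gram_6_8_def gram_8_10_def gram_14_26_def gram_12_18_def
      gram_26_66_def gram_20_32_def)

lemma certificate_psd:
  fixes y :: "nat \<Rightarrow> real"
  assumes "map_of certificate k = Some (ss, G)"
  shows "0 \<le> (\<Sum>i<length G. \<Sum>j<length G. y i * y j * real_of_int (entry G i j))"
proof -
  have "(k, ss, G) \<in> set certificate"
    using assms by (rule map_of_SomeD)
  then consider "G = gram_0_0" | "G = gram_4_4" | "G = gram_30_72" | "G = gram_2_2" | "G = gram_6_8" |
    "G = gram_8_10" | "G = gram_14_26" | "G = gram_12_18" | "G = gram_26_66" | "G = gram_20_32"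
    by (auto simp: certificate_def)
  then show ?thesis
  proof cases
    case 1
    then show ?thesis using gram_psd_0_0 [of y] by (simp add: length_gram)
  next
    case 2
    have "0 \<le> 100 * ((y 2 - 2 * y 1)\<^sup>2 + (y 4 - y 1)\<^sup>2)" by simp
    from order_trans [OF this gram_psd_4_4 [of y]] show ?thesis
      unfolding 2 length_gram .
  next
    case 3
    then show ?thesis using gram_psd_30_72 [of y] by (simp add: length_gram)
  next
    case 4
    then show ?thesis using gram_psd_2_2 [of y] by (simp add: length_gram)
  next
    case 5
    then show ?thesis using gram_psd_6_8 [of y] by (simp add: length_gram)
  next
    case 6
    then show ?thesis using gram_psd_8_10 [of y] by (simp add: length_gram)
  next
    case 7
    then show ?thesis using gram_psd_14_26 [of y] by (simp add: length_gram)
  next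
    case 8
    then show ?thesis using gram_psd_12_18 [of y] by (simp add: length_gram)
  next
    case 9
    then show ?thesis using gram_psd_26_66 [of y] by (simp add: length_gram)
  next
    case 10
    then show ?thesis using gram_psd_20_32 [of y] by (simp add: length_gram)
  qed
qed

lemma gram_form_nonneg:
  assumes "finite V"
  shows "0 \<le> gram_form V w a t"
proof (cases "map_of certificate (type_key a t)")
  case None
  then show ?thesis by (simp add: gram_form_def gram_coef_def)
next
  case (Some p)
  then obtain ss G where *: "map_of certificate (type_key a t) = Some (ss, G)" by (cases p) auto
  show ?thesis
    unfolding gram_form_eq [OF assms * refl] by (rule certificate_psd [OF *])
qed

text \<open>
  The three sums are the weights of the vertices attached to one end of one edge, to the
  isolated vertex only, and to both ends of one edge.  In the balanced blowup of three
  triangles, these are four, two and two parts.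
\<close>

lemma gram_form_matching_vertex:
  fixes w :: "'v \<Rightarrow> real"
  assumes "finite V" "type_key a t = (4, 4)"
  shows "100 * (((\<Sum>x\<in>{x\<in>V. signature a t x = leaf_sig}. w x) - 2 * (\<Sum>x\<in>{x\<in>V. signature a t x = [1, 0, 0, 0]}. w
      x))\<^sup>2 +
     ((\<Sum>x\<in>{x\<in>V. signature a t x = [2, 2, 2, 2]}. w x) - (\<Sum>x\<in>{x\<in>V. signature a t x = [1, 0, 0, 0]}. w x))\<^sup>2)
     \<le> gram_form V w a t"
proof -
  have *: "map_of certificate (type_key a t) = Some (sigs_4_4, gram_4_4)"
    by (simp add: assms(2) certificate_def)
  have pos: "position sigs_4_4 s = 2 \<longleftrightarrow> s = leaf_sig" "position sigs_4_4 s = 1 \<longleftrightarrow> s = [1, 0, 0, 0]"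
    "position sigs_4_4 s = 4 \<longleftrightarrow> s = [2, 2, 2, 2]" for s
    by (auto simp: position_def sigs_4_4_def leaf_sig_def)
  show ?thesis
    unfolding gram_form_eq [OF assms(1) * length_gram(2)]
    using gram_psd_4_4 [of "\<lambda>i. \<Sum>x\<in>{x\<in>V. position sigs_4_4 (signature a t x) = i}. w x"]
    by (simp only: pos)
qed

text \<open>
  Sum the definition of the slack over all lists of length seven.  For each of the 21 choices of
  two entries, the coefficients of the pair add up to the same sum over five-vertex lists and
  two further vertices.
\<close>

theorem slack_identity:
  assumes "finite V"
  shows "57600 * (\<Sum>x\<in>V. w x) ^ 7 = 787320 * (\<Sum>x\<in>V. w x) * leaf_total V w a
     + (\<Sum>t\<in>tup V 5. weight w t * gram_form V w a t)
     + (\<Sum>xs\<in>tup V 7. weight w xs * real_of_int (slack7 a xs)) / 21"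
proof -
  define W where "W = (\<Sum>x\<in>V. w x)"
  define S where "S = (\<Sum>t\<in>tup V 5. \<Sum>y\<in>V. \<Sum>x\<in>V. weight w t * w y * w x * real_of_int (local_coef a t y x))"
  have one: "(\<Sum>xs\<in>tup V 7. weight w xs * real_of_int (local_coef a (del_at j (del_at i xs)) (xs ! j) (xs ! i))) = S"
    if "j < i" "i < 7" for i j
  proof -
    have "(\<Sum>xs\<in>tup V 7. weight w xs * real_of_int (local_coef a (del_at j (del_at i xs)) (xs ! j) (xs ! i))) =
      (\<Sum>xs\<in>tup V (Suc (Suc 5)). weight w xs * real_of_int (local_coef a (del_at j (del_at i xs)) (del_at i xs ! j) (xs ! i)))"
      using that by (intro sum.cong) (auto simp: tup_def del_at_nth_less)
    also have "\<dots> = S"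
      unfolding S_def using that
      by (intro sum_tup_del_at2 [OF assms, where f = "\<lambda>t y x. real_of_int (local_coef a t y x)"]) auto
    finally show ?thesis .
  qed
  have "(\<Sum>xs\<in>tup V 7. weight w xs * real_of_int (slack7 a xs)) =
    (\<Sum>xs\<in>tup V 7. weight w xs * 1209600) -
    (\<Sum>xs\<in>tup V 7. \<Sum>i<7. \<Sum>j<i. weight w xs * real_of_int (local_coef a (del_at j (del_at i xs)) (xs ! j) (xs ! i)))"
    by (simp add: slack7_def sum_subtractf right_diff_distrib sum_distrib_left)
  also have "(\<Sum>xs\<in>tup V 7. \<Sum>i<7. \<Sum>j<i. weight w xs * real_of_int (local_coef a (del_at j (del_at i xs)) (xs ! j) (xs ! i))) =
    (\<Sum>i<7. \<Sum>j<i. \<Sum>xs\<in>tup V 7. weight w xs * real_of_int (local_coef a (del_at j (del_at i xs)) (xs ! j) (xs ! i)))"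
    by (subst sum.swap, intro sum.cong refl, subst sum.swap) rule
  also have "\<dots> = (\<Sum>i<(7::nat). \<Sum>j<i. S)"
    by (intro sum.cong refl one) auto
  also have "\<dots> = 21 * S"
    by (simp add: eval_nat_numeral lessThan_Suc)
  also have "(\<Sum>xs\<in>tup V 7. weight w xs * 1209600) = 1209600 * W ^ 7"
    using sum_weight_tup [OF assms, of w 7] by (simp add: sum_distrib_right [symmetric] W_def)
  finally have A: "(\<Sum>xs\<in>tup V 7. weight w xs * real_of_int (slack7 a xs)) = 1209600 * W ^ 7 - 21 * S" .
  have L: "(\<Sum>t\<in>tup V 5. \<Sum>y\<in>V. \<Sum>x\<in>V. weight w t * w y * w x * of_bool (leaf a t y)) = W * leaf_total V w a"
    unfolding leaf_total_def W_def
    by (simp add: sum_distrib_left sum_distrib_right mult_ac)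
  have L': "(\<Sum>t\<in>tup V 5. \<Sum>y\<in>V. \<Sum>x\<in>V. weight w t * w y * w x * of_bool (leaf a t x)) = W * leaf_total V w a"
    unfolding L [symmetric] by (rule sum.cong [OF refl], subst sum.swap) (simp add: mult_ac)
  have "S = 393660 * ((\<Sum>t\<in>tup V 5. \<Sum>y\<in>V. \<Sum>x\<in>V. weight w t * w y * w x * of_bool (leaf a t y)) +
       (\<Sum>t\<in>tup V 5. \<Sum>y\<in>V. \<Sum>x\<in>V. weight w t * w y * w x * of_bool (leaf a t x))) +
     (\<Sum>t\<in>tup V 5. weight w t * gram_form V w a t)"
    unfolding S_def local_coef_eq gram_form_def
    by (simp add: sum.distrib [symmetric] sum_distrib_left algebra_simps)
  then have "S = 787320 * (W * leaf_total V w a) + (\<Sum>t\<in>tup V 5. weight w t * gram_form V w a t)"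
    unfolding L L' by simp
  with A show ?thesis
    unfolding W_def [symmetric] by (simp add: field_simps)
qed

section \<open>Copies of the pattern and leaf pairs\<close>

text \<open>
  Among the sorted labellings, \<open>2K\<^sub>2 + K\<^sub>1\<close> occurs once, with the
  isolated vertex in front.
\<close>

lemma sorted_matching_bits:
  assumes "[b02, b03, b04] \<le> [b12, b13, b14]" "[b01, b13, b14] \<le> [b02, b23, b24]" "[b02, b12, b24] \<le> [b03, b13, b34]" "[b03,
      b13, b23] \<le> [b04, b14, b24]"
    and "type_key_bits b01 b02 b12 b03 b13 b23 b04 b14 b24 b34 = (4, 4)"
  shows "\<not> b01 \<and> \<not> b02 \<and> \<not> b12 \<and> \<not> b03 \<and> \<not> b13 \<and> b23 \<and> \<not> b04 \<and> b14 \<and>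
      \<not> b24 \<and> \<not> b34"
proof -
  have nested: "both (\<lambda>b01. both (\<lambda>b02. both (\<lambda>b12. both (\<lambda>b03. both (\<lambda>b13. both (\<lambda>b23. if
      [b02, b03] \<le> [b12, b13] \<and> [b01, b13] \<le> [b02, b23] \<and> [b02, b12] \<le> [b03, b13] then both (\<lambda>b04. both
      (\<lambda>b14. both (\<lambda>b24. both (\<lambda>b34. if [b02, b03, b04] \<le> [b12, b13, b14] \<and> [b01, b13, b14] \<le> [b02,
      b23, b24] \<and> [b02, b12, b24] \<le> [b03, b13, b34] \<and> [b03, b13, b23] \<le> [b04, b14, b24] then if type_key_bits b01 b02 b12
      b03 b13 b23 b04 b14 b24 b34 = (4, 4) then \<not> b01 \<and> \<not> b02 \<and> \<not> b12 \<and> \<not> b03 \<and> \<not> b13 \<and>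
      b23 \<and> \<not> b04 \<and> b14 \<and> \<not> b24 \<and> \<not> b34 else True else True)))) else True))))))"
    by (simp add: both_def type_key_bits_def Let_def cong: both_cong)
  have conv: "both P = (\<forall>b. P b)" "(if c then d else True) = (c \<longrightarrow> d)" for P c d
    by (auto simp: both_def) (metis (full_types))
  have "[b02, b03] \<le> [b12, b13]"
    by (rule list_le_append_same_length [of _ "[b04]" _ "[b14]"])
      (simp_all only: append.simps assms list.size)
  have "[b01, b13] \<le> [b02, b23]"
    by (rule list_le_append_same_length [of _ "[b14]" _ "[b24]"])
      (simp_all only: append.simps assms list.size)
  have "[b02, b12] \<le> [b03, b13]"
    by (rule list_le_append_same_length [of _ "[b24]" _ "[b34]"])
      (simp_all only: append.simps assms list.size)

  have four: "[b02, b03] \<le> [b12, b13] \<and> [b01, b13] \<le> [b02, b23] \<and> [b02, b12] \<le> [b03, b13]"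
    by (intro conjI; fact)
  have five: "[b02, b03, b04] \<le> [b12, b13, b14] \<and> [b01, b13, b14] \<le> [b02, b23, b24] \<and> [b02, b12, b24] \<le> [b03, b13,
      b34] \<and> [b03, b13, b23] \<le> [b04, b14, b24]"
    by (intro conjI; fact)
  note * = nested [unfolded conv]
  show ?thesis
    by (rule * [THEN spec, THEN spec, THEN spec, THEN spec, THEN spec, THEN spec, THEN mp, OF four, THEN spec, THEN spec, THEN spec, THEN
        spec, THEN mp, OF five, THEN mp, OF assms(5)])
qed

definition F7_pattern :: "('v \<Rightarrow> 'v \<Rightarrow> bool) \<Rightarrow> 'v list \<Rightarrow> bool" where
  "F7_pattern a ys \<longleftrightarrow> length ys = 6 \<and> (\<forall>i<6. \<forall>j<6. a (ys ! i) (ys ! j) \<longleftrightarrow> {i, j}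
      \<in> edges F7)"

text \<open>
  A list that can be rearranged into a copy of the pattern (\<open>F7_list_iff\<close>),
  described by the deletion of one leaf.  Entries may coincide: in the pattern, twins such as 2
  and 4 may be mapped to the same vertex.
\<close>

definition F7_list :: "('v \<Rightarrow> 'v \<Rightarrow> bool) \<Rightarrow> 'v list \<Rightarrow> bool" where
  "F7_list a ys \<longleftrightarrow> (\<exists>i<6. leaf a (del_at i ys) (ys ! i))"

lemma leaf_mset: "mset t = mset t' \<Longrightarrow> leaf a t x = leaf a t' x"
  by (simp add: leaf_def type_key_mset [of t t'] signature_mset [of t t'])

lemma edges_F7: "{i, j} \<in> edges F7 \<longleftrightarrow> (i, j) \<in> {(0, 2), (2, 0), (0, 4), (4, 0), (1, 5), (5, 1)}"
  by (auto simp: F7_def doubleton_eq_iff)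

context simple_adjacency
begin

lemma F7_patternI:
  assumes "a v0 v2" "a v0 v4" "a v1 v5" "\<not> a v0 v1" "\<not> a v0 v3" "\<not> a v0 v5" "\<not> a v1 v2" "\<not> a v1 v3" "\<not> a v1 v4"
    "\<not> a v2 v3" "\<not> a v2 v4" "\<not> a v2 v5" "\<not> a v3 v4" "\<not> a v3 v5" "\<not> a v4 v5"
  shows "F7_pattern a [v0, v1, v2, v3, v4, v5]"
proof -
  have sym: "a v2 v0" "a v4 v0" "a v5 v1" "\<not> a v1 v0" "\<not> a v3 v0" "\<not> a v5 v0" "\<not> a v2 v1" "\<not> a v3 v1" "\<not> a v4 v1"
    "\<not> a v3 v2" "\<not> a v4 v2" "\<not> a v5 v2" "\<not> a v4 v3" "\<not> a v5 v3" "\<not> a v5 v4"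
    using assms adj_sym by blast+
  have six: "(\<forall>i<6. P i) \<longleftrightarrow> P 0 \<and> P 1 \<and> P 2 \<and> P 3 \<and> P 4 \<and> P (5::nat)" for P
    by (simp add: numeral_eq_Suc All_less_Suc conj_ac)
  show ?thesis
    unfolding F7_pattern_def six edges_F7 using assms sym adj_irrefl by simp
qed

lemma F7_patternD:
  assumes "F7_pattern a ys"
  obtains v0 v1 v2 v3 v4 v5 where "ys = [v0, v1, v2, v3, v4, v5]" "a v0 v2" "a v0 v4" "a v1 v5" "\<not> a v0 v1" "\<not> a v0 v3" "\<not> a
      v0 v5" "\<not> a v1 v2" "\<not> a v1 v3" "\<not> a v1 v4"
    "\<not> a v2 v3" "\<not> a v2 v4" "\<not> a v2 v5" "\<not> a v3 v4" "\<not> a v3 v5" "\<not> a v4 v5"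
proof -
  from assms have "length ys = 6" by (simp add: F7_pattern_def)
  then obtain v0 v1 v2 v3 v4 v5 where ys: "ys = [v0, v1, v2, v3, v4, v5]"
    by (auto simp: length_Suc_conv numeral_eq_Suc)
  have *: "a (ys ! i) (ys ! j) \<longleftrightarrow> (i, j) \<in> {(0, 2), (2, 0), (0, 4), (4, 0), (1, 5), (5, 1)}" if "i < 6" "j < 6" for i j
    using assms that by (simp add: F7_pattern_def edges_F7)
  show ?thesis
    using that [OF ys] *[of 0 1] *[of 0 2] *[of 0 3] *[of 0 4] *[of 0 5] *[of 1 2] *[of 1 3] *[of 1 4] *[of 1 5]
      *[of 2 3] *[of 2 4] *[of 2 5] *[of 3 4] *[of 3 5] *[of 4 5]
    by (simp add: ys)
qed

text \<open>The two deletions are those of the ends 2 and 4 of the path.\<close>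

lemma leaf_count_F7_pattern:
  assumes "F7_pattern a ys"
  shows "(\<Sum>i<6. of_bool (leaf a (del_at i ys) (ys ! i))) = (2::nat)"
proof -
  obtain v0 v1 v2 v3 v4 v5 where ys: "ys = [v0, v1, v2, v3, v4, v5]" and e: "a v0 v2" "a v0 v4" "a v1 v5" "\<not> a v0 v1" "\<not> a v0 v3"
      "\<not> a v0 v5" "\<not> a v1 v2" "\<not> a v1 v3" "\<not> a v1 v4"
    "\<not> a v2 v3" "\<not> a v2 v4" "\<not> a v2 v5" "\<not> a v3 v4" "\<not> a v3 v5" "\<not> a v4 v5"
    using F7_patternD [OF assms] by metis
  have sym: "a v2 v0" "a v4 v0" "a v5 v1" "\<not> a v1 v0" "\<not> a v3 v0" "\<not> a v5 v0" "\<not> a v2 v1" "\<not> a v3 v1" "\<not> a v4 v1"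
    "\<not> a v3 v2" "\<not> a v4 v2" "\<not> a v5 v2" "\<not> a v4 v3" "\<not> a v5 v3" "\<not> a v5 v4"
    using e adj_sym by blast+
  have six: "(\<Sum>i<6. f i) = f 0 + f 1 + f 2 + f 3 + f 4 + f 5" for f :: "nat \<Rightarrow> nat"
    by (simp add: numeral_eq_Suc)
  show ?thesis
    unfolding six ys
    by (simp add: numeral_eq_Suc leaf_def type_key_eq_bits signature_eq_bits e sym)
      (simp add: type_key_bits_def signature_bits_def Let_def leaf_sig_def)
qed

lemma leaf_imp_F7_pattern:
  assumes "leaf a t x" "length t = 5"
  obtains zs where "mset zs = mset (x # t)" "F7_pattern a zs"
proof -
  obtain y0 y1 y2 y3 y4 where m: "mset [y0, y1, y2, y3, y4] = mset t"
    and rows: "[a y0 y2, a y0 y3, a y0 y4] \<le> [a y1 y2, a y1 y3, a y1 y4]" "[a y0 y1, a y1 y3, a y1 y4] \<le> [a y0 y2, a y2 y3, a y2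
        y4]" "[a y0 y2, a y1 y2, a y2 y4] \<le> [a y0 y3, a y1 y3, a y3 y4]" "[a y0 y3, a y1 y3, a y2 y3] \<le> [a y0 y4, a y1 y4, a y2 y4]"
    using assms(2) by (rule sorted_rows_5)
  have lf: "leaf a [y0, y1, y2, y3, y4] x"
    using assms(1) leaf_mset [OF m] by blast
  then have k: "type_key_bits (a y0 y1) (a y0 y2) (a y1 y2) (a y0 y3) (a y1 y3) (a y2 y3) (a y0 y4) (a y1 y4) (a y2 y4) (a y3 y4) = (4, 4)"
      and s: "signature_bits (a y0 y1) (a y0 y2) (a y1 y2) (a y0 y3) (a y1 y3) (a y2 y3) (a y0 y4) (a y1 y4) (a y2 y4) (a y3 y4) (a y0 x)
      (a y1 x) (a y2 x) (a y3 x) (a y4 x) = leaf_sig"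
    by (simp_all add: leaf_def type_key_eq_bits signature_eq_bits)
  note e = sorted_matching_bits [OF rows k]
  have ex: "\<not> a y0 x \<and> (a y1 x \<and> \<not> a y2 x \<and> \<not> a y3 x \<and> \<not> a y4 x \<or> \<not> a y1 x \<and> a y2 x
      \<and> \<not> a y3 x \<and> \<not> a y4 x \<or>
      \<not> a y1 x \<and> \<not> a y2 x \<and> a y3 x \<and> \<not> a y4 x \<or> \<not> a y1 x \<and> \<not> a y2 x \<and> \<not> a y3 x
          \<and> a y4 x)"
    using s e
    by (cases "a y0 x"; cases "a y1 x"; cases "a y2 x"; cases "a y3 x"; cases "a y4 x")
      (simp_all add: signature_bits_def Let_def leaf_sig_def)
  have sym: "a y1 y0 = a y0 y1" "a y2 y0 = a y0 y2" "a y2 y1 = a y1 y2" "a y3 y0 = a y0 y3" "a y3 y1 = a y1 y3" "a y3 y2 = a y2 y3" "a y4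
      y0 = a y0 y4" "a y4 y1 = a y1 y4" "a y4 y2 = a y2 y4" "a y4 y3 = a y3 y4" "a x y0 = a y0 x" "a x y1 = a y1 x" "a x y2 = a y2 x" "a x
      y3 = a y3 x" "a x y4 = a y4 x"
    using adj_sym by blast+
  consider "a y1 x" | "a y2 x" | "a y3 x" | "a y4 x"
    using ex by blast
  then show ?thesis
  proof cases

    case 1
    show ?thesis
      by (rule that [of "[y1, y2, y4, y0, x, y3]"])
        (use m in \<open>simp add: add_mset_commute\<close>, rule F7_patternI, use 1 e ex in \<open>simp_all add: sym\<close>)
  next
    case 2
    show ?thesis
      by (rule that [of "[y2, y1, y3, y0, x, y4]"])
        (use m in \<open>simp add: add_mset_commute\<close>, rule F7_patternI, use 2 e ex in \<open>simp_all add: sym\<close>)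
  next
    case 3
    show ?thesis
      by (rule that [of "[y3, y1, y2, y0, x, y4]"])
        (use m in \<open>simp add: add_mset_commute\<close>, rule F7_patternI, use 3 e ex in \<open>simp_all add: sym\<close>)
  next
    case 4
    show ?thesis
      by (rule that [of "[y4, y2, y1, y0, x, y3]"])
        (use m in \<open>simp add: add_mset_commute\<close>, rule F7_patternI, use 4 e ex in \<open>simp_all add: sym\<close>)
  qed
qed

lemma leaf_count_mset:
  assumes "mset xs = mset ys" "length xs = 6"
  shows "(\<Sum>i<6. of_bool (leaf a (del_at i xs) (xs ! i)) :: nat) = (\<Sum>i<6. of_bool (leaf a (del_at i ys) (ys ! i)))"
proof -
  define f where "f zs = (\<Sum>i<length zs. of_bool (leaf a (del_at i zs) (zs ! i)) :: nat)" for zs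
  have "f xs = f ys"
  proof (rule mset_invariant_if_swap_invariant [OF _ assms(1)])
    fix us :: "'v list" and x y vs
    let ?n = "length us" and ?s = "Fun.swap (length us) (Suc (length us)) id"
    let ?xs = "us @ x # y # vs" and ?ys = "us @ y # x # vs"
    let ?p = "\<lambda>i. if i = ?n then Suc ?n else if i = Suc ?n then ?n else i"
    have del_at_n: "del_at ?n ?xs = us @ y # vs" "del_at (Suc ?n) ?xs = us @ x # vs" "del_at ?n ?ys = us @ x # vs" "del_at (Suc ?n) ?ys = us @ y # vs"
      by (simp_all add: del_at_def)
    have other: "mset (del_at i ?xs) = mset (del_at i ?ys)" "?xs ! i = ?ys ! i" if "i \<noteq> ?n" "i \<noteq> Suc ?n" for i
      using that by (auto simp: del_at_def nth_append nth_Cons' take_Cons' drop_Cons' not_less)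
    show "f ?xs = f ?ys"
      unfolding f_def
    proof (rule sum.reindex_bij_witness [of _ ?p ?p])
      fix i assume "i \<in> {..<length ?xs}"
      then show "of_bool (leaf a (del_at (?p i) ?ys) (?ys ! ?p i)) = (of_bool (leaf a (del_at i ?xs) (?xs ! i)) :: nat)"
        using other [of i] leaf_mset [of "del_at i ?xs" "del_at i ?ys"] by (auto simp: del_at_n nth_append)
    qed (auto split: if_splits)
  qed
  then show ?thesis
    using assms mset_eq_length [OF assms(1)] by (simp add: f_def)
qed

lemma F7_list_iff:
  assumes "length ys = 6"
  shows "F7_list a ys \<longleftrightarrow> (\<exists>zs. mset zs = mset ys \<and> F7_pattern a zs)"
proof
  assume "F7_list a ys"
  then obtain i where i: "i < 6" "leaf a (del_at i ys) (ys ! i)"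
    by (auto simp: F7_list_def)
  have "mset (ys ! i # del_at i ys) = mset ys"
    using i(1) assms by (intro mset_del_at) simp
  moreover have "length (del_at i ys) = 5"
    using i(1) assms by (simp add: del_at_def)
  ultimately show "\<exists>zs. mset zs = mset ys \<and> F7_pattern a zs"
    using leaf_imp_F7_pattern [OF i(2)] by metis
next
  assume "\<exists>zs. mset zs = mset ys \<and> F7_pattern a zs"
  then obtain zs where zs: "mset ys = mset zs" "F7_pattern a zs"
    by metis
  have "(\<Sum>i<6. of_bool (leaf a (del_at i ys) (ys ! i))) = (2::nat)"
    using leaf_count_mset [OF zs(1) assms] leaf_count_F7_pattern [OF zs(2)] by simp
  then show "F7_list a ys"
    by (rule contrapos_pp) (simp add: F7_list_def)
qed

lemma leaf_count:
  assumes "length ys = 6"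
  shows "(\<Sum>i<6. of_bool (leaf a (del_at i ys) (ys ! i))) = (2 * of_bool (F7_list a ys) :: nat)"
proof (cases "F7_list a ys")
  case True
  then obtain zs where zs: "mset ys = mset zs" "F7_pattern a zs"
    using F7_list_iff [OF assms] by metis
  then show ?thesis
    using leaf_count_mset [OF zs(1) assms] leaf_count_F7_pattern [OF zs(2)] True by simp
next
  case False
  then show ?thesis
    by (auto simp: F7_list_def)
qed

text \<open>
  Each list of length six that induces the pattern yields two leaf pairs, one for each end of
  the path, and each leaf pair arises from six lists, one for each place at which the leaf can
  be inserted.
\<close>

theorem leaf_total_eq_F7_lists:
  assumes "finite V"
  shows "3 * leaf_total V w a = (\<Sum>ys\<in>tup V 6. weight w ys * of_bool (F7_list a ys))"
proof -
  have "(\<Sum>ys\<in>tup V 6. weight w ys * (\<Sum>i<6. of_bool (leaf a (del_at i ys) (ys ! i)))) =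
    (\<Sum>i<6. \<Sum>ys\<in>tup V (Suc 5). weight w ys * of_bool (leaf a (del_at i ys) (ys ! i)))"
    unfolding sum_distrib_left by (subst sum.swap) simp
  also have "\<dots> = (\<Sum>i<(6::nat). leaf_total V w a)"
    unfolding leaf_total_def by (intro sum.cong refl sum_tup_del_at [OF assms, where f = "\<lambda>t x. of_bool (leaf a t x)"]) simp
  finally have "(\<Sum>ys\<in>tup V 6. weight w ys * (\<Sum>i<6. of_bool (leaf a (del_at i ys) (ys ! i)))) = 6 * leaf_total V w a"
    by simp
  moreover have "(\<Sum>i<6. of_bool (leaf a (del_at i ys) (ys ! i))) = (2 * of_bool (F7_list a ys) :: real)" if "ys \<in> tup V 6" for ys
  proof -
    have "length ys = 6" using that by (simp add: tup_def)
    from arg_cong [OF leaf_count [OF this], of real] show ?thesis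
      unfolding of_nat_sum of_nat_mult of_nat_of_bool of_nat_numeral .
  qed
  ultimately show ?thesis
    by (simp add: sum_distrib_left [symmetric] mult.left_commute)
qed

end

section \<open>The pattern B9 makes the identity tight\<close>

definition b9 :: "nat \<Rightarrow> nat \<Rightarrow> bool" where
  "b9 p q \<longleftrightarrow> {p, q} \<in> edges B9"

interpretation b9: simple_adjacency b9
proof
  show "b9 x y \<longleftrightarrow> b9 y x" for x y
    by (simp add: b9_def insert_commute)
  show "\<not> b9 x x" for x
    by (auto simp: b9_def B9_def doubleton_eq_iff)
qed

lemma b9_iff: "b9 p q \<longleftrightarrow> p < 9 \<and> q < 9 \<and> p div 3 = q div 3 \<and> p \<noteq> q"
proof -
  have "b9 p q \<longleftrightarrow> (p, q) \<in>
      {(0,2),(2,0),(0,1),(1,0),(1,2),(2,1),(3,4),(4,3),(3,5),(5,3),(4,5),(5,4),(6,7),(7,6),(6,8),(8,6),(7,8),(8,7)}"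
    by (auto simp: b9_def B9_def doubleton_eq_iff)
  also have "\<dots> \<longleftrightarrow> p < 9 \<and> q < 9 \<and> p div 3 = q div 3 \<and> p \<noteq> q"
  proof (cases "p < 9 \<and> q < 9")
    case True
    have cases9: "i = 0 \<or> i = 1 \<or> i = 2 \<or> i = 3 \<or> i = 4 \<or> i = 5 \<or> i = 6 \<or> i = 7 \<or> i = 8" if "i < 9" for i :: nat
      using that by presburger
    have "p = 0 \<or> p = 1 \<or> p = 2 \<or> p = 3 \<or> p = 4 \<or> p = 5 \<or> p = 6 \<or> p = 7 \<or> p = 8"
      "q = 0 \<or> q = 1 \<or> q = 2 \<or> q = 3 \<or> q = 4 \<or> q = 5 \<or> q = 6 \<or> q = 7 \<or> q = 8"
      using cases9 True by blast+
    then show ?thesis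
      by - (elim disjE; simp)
  next
    case False
    then show ?thesis by auto
  qed
  finally show ?thesis .
qed

definition F7_edge :: "nat \<Rightarrow> nat \<Rightarrow> bool" where
  "F7_edge i j \<longleftrightarrow> (i, j) \<in> {(0, 2), (2, 0), (0, 4), (4, 0), (1, 5), (5, 1)}"

text \<open>
  The automorphisms of the pattern are generated by the exchanges of 2 with 4 and of 1 with 5.
\<close>

lemma F7_automorphism:
  assumes perm: "\<rho> permutes {..<6}" and hom: "\<And>i j. i < 6 \<Longrightarrow> j < 6 \<Longrightarrow> F7_edge (\<rho> i) (\<rho> j)
      \<longleftrightarrow> F7_edge i j"
  shows "(\<rho> 1, \<rho> 2) \<in> {(1, 2), (1, 4), (5, 2), (5, 4)} \<and>
    \<rho> = (\<lambda>i. if i = 1 then \<rho> 1 else if i = 5 then 6 - \<rho> 1 else if i = 2 then \<rho> 2 else if i = 4 then 6 - \<rho> 2 else i)"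
proof -
  have lt: "\<rho> i < 6" if "i < 6" for i
    using permutes_in_image [OF perm, of i] that by simp
  have inj: "\<rho> i = \<rho> j \<longleftrightarrow> i = j" for i j
    using permutes_inj [OF perm] by (auto simp: inj_def)
  have e: "F7_edge (\<rho> 0) (\<rho> 2)" "F7_edge (\<rho> 0) (\<rho> 4)" "F7_edge (\<rho> 1) (\<rho> 5)"
    using hom [of 0 2] hom [of 0 4] hom [of 1 5] by (simp_all add: F7_edge_def)
  have d: "\<rho> 2 \<noteq> \<rho> 4" "\<rho> 1 \<noteq> \<rho> 0" "\<rho> 5 \<noteq> \<rho> 0"
    by (simp_all add: inj)
  have 0: "\<rho> 0 = 0" "\<rho> 2 \<in> {2, 4}" "\<rho> 4 = 6 - \<rho> 2"
    using e(1,2) d(1) by (auto simp: F7_edge_def)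
  have 1: "\<rho> 1 \<in> {1, 5}" "\<rho> 5 = 6 - \<rho> 1"
    using e(3) d 0(1) by (auto simp: F7_edge_def)
  have "\<rho> 3 \<noteq> \<rho> 0" "\<rho> 3 \<noteq> \<rho> 1" "\<rho> 3 \<noteq> \<rho> 2" "\<rho> 3 \<noteq> \<rho> 4" "\<rho> 3
      \<noteq> \<rho> 5"
    by (simp_all add: inj)
  then have "\<rho> 3 \<noteq> 0" "\<rho> 3 \<noteq> 1" "\<rho> 3 \<noteq> 2" "\<rho> 3 \<noteq> 4" "\<rho> 3 \<noteq> 5"
    using 0 1 by auto
  then have 3: "\<rho> 3 = 3"
    using lt [of 3] by simp
  have out: "\<rho> i = i" if "\<not> i < 6" for i
    using permutes_not_in [OF perm, of i] that by simp
  have "\<rho> i = (if i = 1 then \<rho> 1 else if i = 5 then 6 - \<rho> 1 else if i = 2 then \<rho> 2 else if i = 4 then 6 - \<rho> 2 else i)" for i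
  proof (cases "i < 6")
    case True
    then have "i = 0 \<or> i = 1 \<or> i = 2 \<or> i = 3 \<or> i = 4 \<or> i = 5"
      by presburger
    then show ?thesis
      using 0 1 3 by auto
  next
    case False
    then show ?thesis
      using out [of i] by auto
  qed
  moreover have "(\<rho> 1, \<rho> 2) \<in> {(1, 2), (1, 4), (5, 2), (5, 4)}"
    using 0(2) 1(1) by auto
  ultimately show ?thesis
    by (intro conjI ext) blast+
qed

lemma card_F7_placements:
  assumes "length ys = 6"
  shows "card {\<sigma>. \<sigma> permutes {..<6} \<and> F7_pattern a (permute_list \<sigma> ys)} \<le> 4"
proof (cases "\<exists>\<sigma>. \<sigma> permutes {..<6} \<and> F7_pattern a (permute_list \<sigma> ys)")
  case True
  then obtain \<tau> where \<tau>: "\<tau> permutes {..<6}" "F7_pattern a (permute_list \<tau> ys)"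
    by blast
  \<comment> \<open>Automorphisms are parametrised by the images of 1 and 2.\<close>
  define aut :: "nat \<times> nat \<Rightarrow> nat \<Rightarrow> nat" where
    "aut = (\<lambda>(p, q) i. if i = 1 then p else if i = 5 then 6 - p else if i = 2 then q else if i = 4 then 6 - q else i)"
  have pat: "a (ys ! \<sigma> i) (ys ! \<sigma> j) \<longleftrightarrow> F7_edge i j"
    if "\<sigma> permutes {..<6}" "F7_pattern a (permute_list \<sigma> ys)" "i < 6" "j < 6" for \<sigma> i j
    using that assms unfolding F7_pattern_def edges_F7 F7_edge_def by (simp add: permute_list_nth)
  have "\<sigma> \<in> (\<lambda>p. \<tau> \<circ> aut p) ` {(1, 2), (1, 4), (5, 2), (5, 4)}"
    if \<sigma>: "\<sigma> permutes {..<6}" "F7_pattern a (permute_list \<sigma> ys)" for \<sigma>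
  proof -
    define \<rho> where "\<rho> = inv \<tau> \<circ> \<sigma>"
    have \<rho>: "\<rho> permutes {..<6}"
      unfolding \<rho>_def using \<sigma>(1) \<tau>(1) by (intro permutes_compose permutes_inv)
    have eq: "\<sigma> = \<tau> \<circ> \<rho>"
      unfolding \<rho>_def using permutes_inv_o(1) [OF \<tau>(1)] by (simp add: o_assoc)
    have "F7_edge (\<rho> i) (\<rho> j) \<longleftrightarrow> F7_edge i j" if "i < 6" "j < 6" for i j
      using pat [OF \<tau>, of "\<rho> i" "\<rho> j"] pat [OF \<sigma> that] permutes_in_image [OF \<rho>] that eq by auto
    from F7_automorphism [OF \<rho> this]
    have "(\<rho> 1, \<rho> 2) \<in> {(1, 2), (1, 4), (5, 2), (5, 4)}" and "\<rho> = aut (\<rho> 1, \<rho> 2)"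
      unfolding aut_def prod.case by blast+
    then show ?thesis
      unfolding eq by (intro image_eqI [where x = "(\<rho> 1, \<rho> 2)"]) (auto intro!: arg_cong [where f = "\<lambda>r. \<tau> \<circ> r"])
  qed
  then have "{\<sigma>. \<sigma> permutes {..<6} \<and> F7_pattern a (permute_list \<sigma> ys)} \<subseteq> (\<lambda>p. \<tau> \<circ>
      aut p) ` {(1, 2), (1, 4), (5, 2), (5, 4)}"
    by blast
  then have "card {\<sigma>. \<sigma> permutes {..<6} \<and> F7_pattern a (permute_list \<sigma> ys)} \<le> card ((\<lambda>p. \<tau>
      \<circ> aut p) ` {(1::nat, 2::nat), (1, 4), (5, 2), (5, 4)})"
    by (intro card_mono) auto
  also have "\<dots> \<le> card {(1::nat, 2::nat), (1, 4), (5, 2), (5, 4)}"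
    by (rule card_image_le) simp
  finally show ?thesis
    by simp
next
  case False
  then have "{\<sigma>. \<sigma> permutes {..<6} \<and> F7_pattern a (permute_list \<sigma> ys)} = {}"
    by blast
  then show ?thesis by (metis card.empty zero_le)
qed

text \<open>
  A list that induces the pattern can be permuted into its standard order in at most four ways,
  so there are at least \<open>720 / 4\<close> times as many such lists as standard ones.
\<close>

lemma (in simple_adjacency) card_F7_lists_ge:
  assumes "finite V"
  shows "180 * card {ys \<in> tup V 6. F7_pattern a ys} \<le> card {ys \<in> tup V 6. F7_list a ys}"
proof -
  let ?P = "{\<sigma>. \<sigma> permutes {..<6::nat}}"
  have P: "finite ?P" "card ?P = 720"
    using finite_permutations [of "{..<6::nat}"] card_permutations [of "{..<6::nat}" 6]
    by (simp_all add: fact_numeral)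
  have cls: "card {ys \<in> tup V 6. F7_pattern a (permute_list \<sigma> ys)} = card {ys \<in> tup V 6. F7_pattern a ys}" if "\<sigma>
      \<in> ?P" for \<sigma>
  proof (rule bij_betw_same_card [where f = "permute_list \<sigma>"])
    have perm: "\<sigma> permutes {..<6}" "inv \<sigma> permutes {..<6}"
      using that permutes_inv by blast+
    have inv1: "permute_list (inv \<sigma>) (permute_list \<sigma> ys) = ys" if "length ys = 6" for ys :: "'v list"
      using permute_list_compose [of "inv \<sigma>" ys \<sigma>] perm that permutes_inv_o(1) [OF perm(1)] by simp
    have inv2: "permute_list \<sigma> (permute_list (inv \<sigma>) ys) = ys" if "length ys = 6" for ys :: "'v list"
      using permute_list_compose [of \<sigma> ys "inv \<sigma>"] perm that permutes_inv_o(2) [OF perm(1)] by simp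
    show "bij_betw (permute_list \<sigma>) {ys \<in> tup V 6. F7_pattern a (permute_list \<sigma> ys)} {ys \<in> tup V 6. F7_pattern a ys}"
      using perm by (intro bij_betw_byWitness [where f' = "permute_list (inv \<sigma>)"]) (auto simp: tup_def inv1 inv2)
  qed
  have "720 * card {ys \<in> tup V 6. F7_pattern a ys} = (\<Sum>\<sigma>\<in>?P. card {ys \<in> tup V 6. F7_pattern a (permute_list \<sigma> ys)})"
    using P by (simp add: cls)
  also have "\<dots> = (\<Sum>\<sigma>\<in>?P. \<Sum>ys\<in>tup V 6. of_bool (F7_pattern a (permute_list \<sigma> ys)))"
    using assms by (intro sum.cong refl) (simp add: Int_def conj_commute)
  also have "\<dots> = (\<Sum>ys\<in>tup V 6. \<Sum>\<sigma>\<in>?P. of_bool (F7_pattern a (permute_list \<sigma> ys)))"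
    by (rule sum.swap)
  also have "\<dots> \<le> (\<Sum>ys\<in>tup V 6. 4 * of_bool (F7_list a ys))"
  proof (rule sum_mono)
    fix ys assume ys: "ys \<in> tup V 6"
    then have len: "length ys = 6" by (simp add: tup_def)
    have c: "(\<Sum>\<sigma>\<in>?P. of_bool (F7_pattern a (permute_list \<sigma> ys))) = card {\<sigma>. \<sigma> permutes {..<6} \<and>
        F7_pattern a (permute_list \<sigma> ys)}"
      using P(1) by (simp add: Int_def)
    show "(\<Sum>\<sigma>\<in>?P. of_bool (F7_pattern a (permute_list \<sigma> ys))) \<le> (4 * of_bool (F7_list a ys) :: nat)"
    proof (cases "F7_list a ys")
      case True
      then show ?thesis
        unfolding c using card_F7_placements [OF len, of a] by simp
    next
      case False
      have "\<not> F7_pattern a (permute_list \<sigma> ys)" if "\<sigma> permutes {..<6}" for \<sigma>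
        using False F7_list_iff [OF len] mset_permute_list [of \<sigma> ys] that len by metis
      then show ?thesis
        by (simp add: sum.neutral)
    qed
  qed
  also have "\<dots> = 4 * card {ys \<in> tup V 6. F7_list a ys}"
    using assms by (simp add: sum_distrib_left [symmetric] Int_def)
  finally show ?thesis
    by simp
qed

text \<open>
  Choose three distinct triangles \<open>i\<close>, \<open>j\<close>, \<open>k\<close> for the
  path, the edge and the isolated vertex; inside them, there are six ways to place the path
  (whose ends coincide), six for the edge and three for the isolated vertex.
\<close>

lemma card_F7_patterns_b9: "648 \<le> card {ys \<in> tup {..<9} 6. F7_pattern b9 ys}"
proof -
  define T :: "(nat \<times> nat \<times> nat) set" where "T = {(0,1,2),(0,2,1),(1,0,2),(1,2,0),(2,0,1),(2,1,0)}"
  define P :: "(nat \<times> nat) set" where "P = {(0,1),(0,2),(1,0),(1,2),(2,0),(2,1)}"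
  define f where "f = (\<lambda>((i, j, k), (p, q), (r, s), t :: nat). [3*i+p, 3*j+r, 3*i+q, 3*k+t, 3*i+q, 3*j+(s::nat)])"
  have P: "p < 3 \<and> q < 3 \<and> p \<noteq> q" if "(p, q) \<in> P" for p q
    using that by (auto simp: P_def)
  have T: "i < 3 \<and> j < 3 \<and> k < 3 \<and> i \<noteq> j \<and> i \<noteq> k \<and> j \<noteq> k" if "(i, j, k) \<in> T" for i j k
    using that by (auto simp: T_def)
  have mod: "3 * i + p = 3 * i' + p' \<longleftrightarrow> i = i' \<and> p = p'" if "p < 3" "p' < (3::nat)" for i p i' p' :: nat
    using that by presburger
  have inj: "inj_on f (T \<times> P \<times> P \<times> {..<3})"
  proof (rule inj_onI)
    fix x y assume x: "x \<in> T \<times> P \<times> P \<times> {..<3}" and y: "y \<in> T \<times> P \<times> P \<times> {..<3}" and eq: "f x = f y"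
    obtain i j k p q r s t where x': "x = ((i, j, k), (p, q), (r, s), t)"
      by (metis prod.exhaust)
    obtain i' j' k' p' q' r' s' t' where y': "y = ((i', j', k'), (p', q'), (r', s'), t')"
      by (metis prod.exhaust)
    have "3*i+p = 3*i'+p'" "3*j+r = 3*j'+r'" "3*i+q = 3*i'+q'" "3*k+t = 3*k'+t'" "3*j+s = 3*j'+s'"
      using eq by (simp_all add: f_def x' y')
    moreover have "p < 3" "q < 3" "r < 3" "s < 3" "t < 3" "p' < 3" "q' < 3" "r' < 3" "s' < 3" "t' < 3"
      using x y P by (auto simp: x' y')
    ultimately show "x = y"
      unfolding x' y' using mod by blast
  qed
  have sub: "f ` (T \<times> P \<times> P \<times> {..<3}) \<subseteq> {ys \<in> tup {..<9} 6. F7_pattern b9 ys}"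
  proof (rule image_subsetI)
    fix x assume "x \<in> T \<times> P \<times> P \<times> {..<3::nat}"
    then obtain i j k p q r s t where x: "x = ((i, j, k), (p, q), (r, s), t)"
      and a: "(i, j, k) \<in> T" "(p, q) \<in> P" "(r, s) \<in> P" "t \<in> {..<3}"
      by auto
    have dv: "(3 * x + y) div 3 = x" if "y < 3" for x y :: nat
      using that by simp
    have lt: "3 * x + y < 9" if "x < 3" "y < 3" for x y :: nat
      using that by simp
    have "F7_pattern b9 [3*i+p, 3*j+r, 3*i+q, 3*k+t, 3*i+q, 3*j+s]"
      using T [OF a(1)] P [OF a(2)] P [OF a(3)] a(4)
      by (intro b9.F7_patternI) (auto simp: b9_iff dv lt mod)
    then show "f x \<in> {ys \<in> tup {..<9} 6. F7_pattern b9 ys}"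
      using T [OF a(1)] P [OF a(2)] P [OF a(3)] a(4) by (auto simp: x f_def tup_def)
  qed
  have "card (T \<times> P \<times> P \<times> {..<3::nat}) = 648"
    by (simp add: card_cartesian_product T_def P_def)
  then have "648 = card (f ` (T \<times> P \<times> P \<times> {..<3}))"
    using inj by (simp add: card_image)
  also have "\<dots> \<le> card {ys \<in> tup {..<9} 6. F7_pattern b9 ys}"
    by (intro card_mono sub) simp
  finally show ?thesis .
qed

lemma sum_slack7_nonneg:
  assumes "finite V" "\<And>x. x \<in> V \<Longrightarrow> 0 \<le> w x" "simple_adjacency a"
  shows "0 \<le> (\<Sum>xs\<in>tup V 7. weight w xs * real_of_int (slack7 a xs))"
proof (intro sum_nonneg mult_nonneg_nonneg)
  fix xs assume xs: "xs \<in> tup V 7"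
  show "0 \<le> weight w xs"
    using assms(2) xs by (rule weight_nonneg)
  show "0 \<le> real_of_int (slack7 a xs)"
    using simple_adjacency.slack7_nonneg [OF assms(3), of xs] xs by (simp add: tup_def)
qed

lemma sum_gram_form_nonneg:
  assumes "finite V" "\<And>x. x \<in> V \<Longrightarrow> 0 \<le> w x"
  shows "0 \<le> (\<Sum>t\<in>tup V 5. weight w t * gram_form V w a t)"
  using assms by (intro sum_nonneg mult_nonneg_nonneg gram_form_nonneg) (auto intro: weight_nonneg)

text \<open>The identity gives the upper bound and the explicit lists the lower bound.\<close>

theorem leaf_total_b9: "leaf_total {..<9} (\<lambda>_. 1) b9 = 38880"
proof (rule antisym)
  have "57600 * (9::real) ^ 7 \<ge> 787320 * 9 * leaf_total {..<9} (\<lambda>_. 1) b9"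
    using slack_identity [of "{..<9::nat}" "\<lambda>_. 1" b9] sum_slack7_nonneg [of "{..<9::nat}" "\<lambda>_. 1" b9]
      sum_gram_form_nonneg [of "{..<9::nat}" "\<lambda>_. 1" b9] b9.simple_adjacency_axioms by simp
  then show "leaf_total {..<9} (\<lambda>_. 1) b9 \<le> 38880"
    by simp
  have "180 * 648 \<le> card {ys \<in> tup {..<9} 6. F7_list b9 ys}"
    using b9.card_F7_lists_ge [of "{..<9}"] card_F7_patterns_b9 by simp
  moreover have "3 * leaf_total {..<9} (\<lambda>_. 1) b9 = card {ys \<in> tup {..<9} 6. F7_list b9 ys}"
    using b9.leaf_total_eq_F7_lists [of "{..<9}" "\<lambda>_. 1"] by (simp add: Int_def)
  ultimately show "38880 \<le> leaf_total {..<9} (\<lambda>_. 1) b9"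
    by linarith
qed

text \<open>
  Since the balanced pattern attains the bound, all the nonnegative terms of the identity
  vanish.
\<close>

lemma b9_tight:
  shows slack7_b9: "xs \<in> tup {..<9} 7 \<Longrightarrow> slack7 b9 xs = 0"
    and gram_form_b9: "t \<in> tup {..<9} 5 \<Longrightarrow> gram_form {..<9} (\<lambda>_. 1) b9 t = 0"
proof -
  have "(\<Sum>t\<in>tup {..<9} 5. gram_form {..<9} (\<lambda>_. 1) b9 t) + (\<Sum>xs\<in>tup {..<9} 7. real_of_int (slack7 b9 xs)) / 21 = 0"
    using slack_identity [of "{..<9::nat}" "\<lambda>_. 1" b9] by (simp add: leaf_total_b9)
  moreover have "0 \<le> (\<Sum>t\<in>tup {..<9} 5. gram_form {..<9} (\<lambda>_. 1) b9 t)" "0 \<le> (\<Sum>xs\<in>tup {..<9} 7.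
      real_of_int (slack7 b9 xs))"
    using sum_slack7_nonneg [of "{..<9::nat}" "\<lambda>_. 1" b9] sum_gram_form_nonneg [of "{..<9::nat}" "\<lambda>_. 1" b9]
        b9.simple_adjacency_axioms
    by simp_all
  ultimately have "(\<Sum>t\<in>tup {..<9} 5. gram_form {..<9} (\<lambda>_. 1) b9 t) = 0" "(\<Sum>xs\<in>tup {..<9} 7. real_of_int (slack7
      b9 xs)) = 0"
    by linarith+
  moreover have "0 \<le> real_of_int (slack7 b9 xs)" if "xs \<in> tup {..<9} 7" for xs
    using b9.slack7_nonneg that by (simp add: tup_def)
  ultimately show "xs \<in> tup {..<9} 7 \<Longrightarrow> slack7 b9 xs = 0" "t \<in> tup {..<9} 5 \<Longrightarrow> gram_form {..<9}
      (\<lambda>_. 1) b9 t = 0"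
    by (subst (asm) sum_nonneg_eq_0_iff; simp add: gram_form_nonneg)+
qed

section \<open>From densities to list counts\<close>

lemma sum_list_cong: "(\<And>x. x \<in> set xs \<Longrightarrow> f x = g x) \<Longrightarrow> sum_list (map f xs) = sum_list (map g xs)"
  by (metis map_cong)

text \<open>
  The adjacency \<open>a\<close> on \<open>A\<close> is the preimage of \<open>h\<close> under
  \<open>p\<close>.  With \<open>p\<close> the map to the parts this describes blowups, and with
  the identity it says that two graphs agree on \<open>A\<close>.
\<close>

definition pulls_back :: "'v set \<Rightarrow> ('v \<Rightarrow> 'w) \<Rightarrow> ('v \<Rightarrow> 'v \<Rightarrow> bool) \<Rightarrow>
    ('w \<Rightarrow> 'w \<Rightarrow> bool) \<Rightarrow> bool" where
  "pulls_back A p a h \<longleftrightarrow> (\<forall>x\<in>A. \<forall>y\<in>A. a x y \<longleftrightarrow> h (p x) (p y))"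

lemma signature_pullback:
  assumes "pulls_back A p a h" "set t \<subseteq> A" "x \<in> A"
  shows "signature a t x = signature h (map p t) (p x)"
proof -
  note assms = assms [unfolded pulls_back_def]
  have c: "adj_count a t y = adj_count h (map p t) (p y)" if "y \<in> A" for y
    using assms that by (auto simp: adj_count_def o_def intro!: sum_list_cong)
  have w2: "walks2 a t y = walks2 h (map p t) (p y)" if "y \<in> A" for y
    using assms that by (auto simp: walks2_def o_def c subset_iff intro!: sum_list_cong)
  have w3: "walks3 a t y = walks3 h (map p t) (p y)" if "y \<in> A" for y
    using assms that by (auto simp: walks3_def o_def w2 subset_iff intro!: sum_list_cong)
  have tr: "triangles a t y = triangles h (map p t) (p y)" if "y \<in> A" for y
  proof -
    have "(\<Sum>z\<leftarrow>t. of_bool (a y z) * of_bool (a v z)) = (\<Sum>z\<leftarrow>t. of_bool (h (p y) (p z)) * of_bool (h (p v) (p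
        z)) :: nat)"
      if "v \<in> A" for v
      using assms that \<open>y \<in> A\<close> by (intro sum_list_cong) (auto simp: subset_iff)
    then show ?thesis
      using assms that unfolding triangles_def map_map o_def
      by (intro sum_list_cong) (auto simp: subset_iff)
  qed
  show ?thesis
    using assms(3) by (simp add: signature_def c w2 w3 tr)
qed

lemma type_key_pullback:
  assumes "pulls_back A p a h" "set t \<subseteq> A"
  shows "type_key a t = type_key h (map p t)"
proof -
  have "adj_count a t y = adj_count h (map p t) (p y)" "walks2 a t y = walks2 h (map p t) (p y)" if "y \<in> set t" for y
    using signature_pullback [OF assms, of y] that assms(2) by (auto simp: signature_def)
  then show ?thesis
    by (auto simp: type_key_def o_def intro!: sum_list_cong)
qed

lemma leaf_pullback:
  assumes "pulls_back A p a h" "set t \<subseteq> A" "x \<in> A"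
  shows "leaf a t x \<longleftrightarrow> leaf h (map p t) (p x)"
  by (simp add: leaf_def signature_pullback [OF assms] type_key_pullback [OF assms(1,2)])

lemma gram_coef_pullback:
  assumes "pulls_back A p a h" "set t \<subseteq> A" "x \<in> A" "y \<in> A"
  shows "gram_coef a t x y = gram_coef h (map p t) (p x) (p y)"
  unfolding gram_coef_def signature_pullback [OF assms(1-3)] signature_pullback [OF assms(1,2,4)] type_key_pullback [OF assms(1,2)] ..

lemma F7_list_pullback:
  assumes "pulls_back A p a h" "ys \<in> tup A 6"
  shows "F7_list a ys \<longleftrightarrow> F7_list h (map p ys)"
proof -
  have "leaf a (del_at i ys) (ys ! i) \<longleftrightarrow> leaf h (del_at i (map p ys)) (map p ys ! i)" if "i < 6" for i
  proof -
    have "set (del_at i ys) \<subseteq> A" "ys ! i \<in> A" "map p ys ! i = p (ys ! i)"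
      using assms(2) that set_del_at_subset [of i ys] by (auto simp: tup_def)
    then show ?thesis
      using leaf_pullback [OF assms(1), of "del_at i ys" "ys ! i"] by (simp add: del_at_map)
  qed
  then show ?thesis
    unfolding F7_list_def by blast
qed

lemma slack7_pullback:
  assumes "pulls_back A p a h" "xs \<in> tup A 7"
  shows "slack7 a xs = slack7 h (map p xs)"
proof -
  have "local_coef a (del_at j (del_at i xs)) (xs ! j) (xs ! i) =
      local_coef h (del_at j (del_at i (map p xs))) (map p xs ! j) (map p xs ! i)" if "i < 7" "j < i" for i j
  proof -
    have "set (del_at j (del_at i xs)) \<subseteq> A" "xs ! i \<in> A" "xs ! j \<in> A" "map p xs ! i = p (xs ! i)" "map p xs ! j = p (xs ! j)"
      using assms(2) that set_del_at_subset [of i xs] set_del_at_subset [of j "del_at i xs"] by (auto simp: tup_def)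
    then show ?thesis
      by (simp add: local_coef_def del_at_map signature_pullback [OF assms(1)] type_key_pullback [OF assms(1)])
  qed
  then show ?thesis
    by (simp add: slack7_def)
qed

definition adj :: "'v pattern \<Rightarrow> 'v \<Rightarrow> 'v \<Rightarrow> bool" where
  "adj G x y \<longleftrightarrow> {x, y} \<in> edges G"

lemma simple_adjacency_adj: "is_graph G \<Longrightarrow> simple_adjacency (adj G)"
  by (unfold_locales) (auto simp: adj_def is_graph_def insert_commute doubleton_eq_iff)

definition F7_sets :: "'v pattern \<Rightarrow> 'v set set" where
  "F7_sets G = {S. S \<subseteq> verts G \<and> card S = 6 \<and> isomorphic (induced G S) F7}"

lemma density_F7: "density F7 G = real (card (F7_sets G)) / real (card (verts G) choose 6)"
  by (simp add: density_def F7_sets_def F7_def)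

lemma isomorphic_F7_iff:
  assumes "card S = 6"
  shows "isomorphic (induced G S) F7 \<longleftrightarrow> (\<exists>ys. distinct ys \<and> set ys = S \<and> F7_pattern (adj G) ys)"
proof
  assume "isomorphic (induced G S) F7"
  then obtain f where f: "bij_betw f S {..<6}"
    and e: "\<And>x y. x \<in> S \<Longrightarrow> y \<in> S \<Longrightarrow> {x, y} \<in> edges G \<longleftrightarrow> {f x, f y} \<in> edges F7"
    by (auto simp: isomorphic_def is_iso_def induced_def F7_def)
  define g where "g = inv_into S f"
  have g: "bij_betw g {..<6} S"
    unfolding g_def using f by (rule bij_betw_inv_into)
  have fg: "f (g i) = i" "g i \<in> S" if "i < 6" for i
    using f g that bij_betw_inv_into_right [OF f, of i] by (auto simp: g_def bij_betw_def)
  have "distinct (map g [0..<6])"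
    using g by (simp add: distinct_map bij_betw_def lessThan_atLeast0)
  moreover have "set (map g [0..<6]) = S"
    using g by (simp add: bij_betw_def lessThan_atLeast0)
  moreover have "F7_pattern (adj G) (map g [0..<6])"
    using fg e by (simp add: F7_pattern_def adj_def)
  ultimately show "\<exists>ys. distinct ys \<and> set ys = S \<and> F7_pattern (adj G) ys"
    by blast
next
  assume "\<exists>ys. distinct ys \<and> set ys = S \<and> F7_pattern (adj G) ys"
  then obtain ys where ys: "distinct ys" "set ys = S" "F7_pattern (adj G) ys"
    by blast
  then have len: "length ys = 6"
    by (simp add: F7_pattern_def)
  have b: "bij_betw (\<lambda>i. ys ! i) {..<6} S"
    using bij_betw_nth [OF ys(1), of "{..<6}" S] ys(2) len by simp
  define f where "f = inv_into {..<6} (\<lambda>i. ys ! i)"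
  have f: "bij_betw f S {..<6}"
    unfolding f_def by (rule bij_betw_inv_into [OF b])
  have inv: "ys ! f x = x" "f x < 6" if "x \<in> S" for x
    using that b f bij_betw_inv_into_right [OF b that] by (auto simp: f_def bij_betw_def)
  have "is_iso f (induced G S) F7"
    unfolding is_iso_def
  proof (intro conjI ballI)
    show "bij_betw f (verts (induced G S)) (verts F7)"
      using f by (simp add: induced_def F7_def)
    fix x y assume "x \<in> verts (induced G S)" "y \<in> verts (induced G S)"
    then have xy: "x \<in> S" "y \<in> S" by (simp_all add: induced_def)
    have "{x, y} \<in> edges (induced G S) \<longleftrightarrow> adj G (ys ! f x) (ys ! f y)"
      using xy inv by (simp add: induced_def adj_def)
    also have "\<dots> \<longleftrightarrow> {f x, f y} \<in> edges F7"
      using ys(3) inv(2) xy unfolding F7_pattern_def by blast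
    finally show "{x, y} \<in> edges (induced G S) \<longleftrightarrow> {f x, f y} \<in> edges F7" .
  qed
  then show "isomorphic (induced G S) F7"
    unfolding isomorphic_def by blast
qed

text \<open>
  Every vertex set that induces the pattern is listed by its \<open>6! = 720\<close>
  enumerations.
\<close>

lemma card_F7_sets:
  assumes G: "is_graph G"
  shows "720 * card (F7_sets G) = card {ys \<in> tup (verts G) 6. distinct ys \<and> F7_list (adj G) ys}"
proof -
  interpret simple_adjacency "adj G"
    by (rule simple_adjacency_adj [OF G])
  have fin: "finite (verts G)" using G by (simp add: is_graph_def)
  have "{ys \<in> tup (verts G) 6. distinct ys \<and> F7_list (adj G) ys} = (\<Union>S\<in>F7_sets G. permutations_of_set S)"
  proof (intro equalityI subsetI)
    fix ys assume "ys \<in> {ys \<in> tup (verts G) 6. distinct ys \<and> F7_list (adj G) ys}"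
    then have ys: "set ys \<subseteq> verts G" "length ys = 6" "distinct ys" "F7_list (adj G) ys"
      by (auto simp: tup_def)
    then obtain zs where zs: "mset zs = mset ys" "F7_pattern (adj G) zs"
      using F7_list_iff by blast
    have "distinct zs" "set zs = set ys"
      using zs(1) ys(3) mset_eq_imp_distinct_iff mset_eq_setD by metis+
    then have "set ys \<in> F7_sets G"
      using ys zs(2) isomorphic_F7_iff [of "set ys" G] by (auto simp: F7_sets_def distinct_card)
    then show "ys \<in> (\<Union>S\<in>F7_sets G. permutations_of_set S)"
      using ys(3) by (auto simp: permutations_of_set_def)
  next
    fix ys assume "ys \<in> (\<Union>S\<in>F7_sets G. permutations_of_set S)"
    then obtain S where S: "S \<in> F7_sets G" "set ys = S" "distinct ys"
      by (auto simp: permutations_of_set_def)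
    then obtain zs where zs: "distinct zs" "set zs = S" "F7_pattern (adj G) zs"
      using isomorphic_F7_iff [of S G] by (auto simp: F7_sets_def)
    have len: "length ys = 6"
      using S distinct_card [OF S(3)] by (simp add: F7_sets_def)
    have "mset zs = mset ys"
      using zs S by (metis set_eq_iff_mset_eq_distinct)
    then have "F7_list (adj G) ys"
      using F7_list_iff [OF len] zs(3) by blast
    then show "ys \<in> {ys \<in> tup (verts G) 6. distinct ys \<and> F7_list (adj G) ys}"
      using S len by (auto simp: tup_def F7_sets_def)
  qed
  moreover have "card (\<Union>S\<in>F7_sets G. permutations_of_set S) = (\<Sum>S\<in>F7_sets G. card (permutations_of_set S))"
  proof (rule card_UN_disjoint)
    show "finite (F7_sets G)"
      using fin by (rule_tac finite_subset [of _ "Pow (verts G)"]) (auto simp: F7_sets_def)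
    show "\<forall>S\<in>F7_sets G. finite (permutations_of_set S)" by simp
    show "\<forall>S\<in>F7_sets G. \<forall>S'\<in>F7_sets G. S \<noteq> S' \<longrightarrow> permutations_of_set S \<inter>
        permutations_of_set S' = {}"
      by (auto simp: permutations_of_set_def)
  qed
  moreover have "card (permutations_of_set S) = 720" if "S \<in> F7_sets G" for S
  proof -
    have "finite S" using that fin by (auto simp: F7_sets_def intro: finite_subset)
    then show ?thesis using that by (simp add: F7_sets_def fact_numeral)
  qed
  ultimately show ?thesis
    by simp
qed

definition degenerate_F7 :: "'v pattern \<Rightarrow> 'v list set" where
  "degenerate_F7 G = {ys \<in> tup (verts G) 6. \<not> distinct ys \<and> F7_list (adj G) ys}"

lemma leaf_total_eq_F7_sets:
  assumes G: "is_graph G"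
  shows "3 * leaf_total (verts G) (\<lambda>_. 1) (adj G) = 720 * real (card (F7_sets G)) + real (card (degenerate_F7 G))"
proof -
  interpret simple_adjacency "adj G"
    by (rule simple_adjacency_adj [OF G])
  have fin: "finite (verts G)" using G by (simp add: is_graph_def)
  have "3 * leaf_total (verts G) (\<lambda>_. 1) (adj G) = card {ys \<in> tup (verts G) 6. F7_list (adj G) ys}"
    using leaf_total_eq_F7_lists [OF fin, of "\<lambda>_. 1"] fin by (simp add: Int_def)
  also have "{ys \<in> tup (verts G) 6. F7_list (adj G) ys} =
     {ys \<in> tup (verts G) 6. distinct ys \<and> F7_list (adj G) ys} \<union> degenerate_F7 G"
    by (auto simp: degenerate_F7_def)
  also have "card \<dots> = 720 * card (F7_sets G) + card (degenerate_F7 G)"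
    unfolding card_F7_sets [OF G] using fin
    by (intro card_Un_disjoint) (auto simp: degenerate_F7_def)
  finally show ?thesis by simp
qed

text \<open>Deleting one of two equal entries does not change the set of entries.\<close>

lemma card_tup_coincidence:
  assumes "finite V" "j < i" "i < 6"
  shows "card {ys \<in> tup V 6. ys ! j = ys ! i \<and> K (set ys)} \<le> card {t \<in> tup V 5. K (set t)}"
proof -
  have "real (card {ys \<in> tup V 6. ys ! j = ys ! i \<and> K (set ys)}) = (\<Sum>ys\<in>tup V 6. of_bool (ys ! j = ys ! i \<and> K (set ys)))"
    using assms(1) by (simp add: Int_def)
  also have "\<dots> = (\<Sum>ys\<in>tup V (Suc 5). weight (\<lambda>_. 1) ys * of_bool (del_at i ys ! j = ys ! i \<and> K (set (del_at i ys))))"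
  proof (rule sum.cong)
    fix ys assume "ys \<in> tup V (Suc 5)"
    then have len: "length ys = 6"
      by (simp add: tup_def)
    then have "del_at i ys ! j = ys ! j"
      using assms by (simp add: del_at_nth_less)
    moreover have "set (del_at i ys) = set ys" if "ys ! j = ys ! i"
      using assms len that by (intro set_del_at_coincidence [of j]) auto
    ultimately show "of_bool (ys ! j = ys ! i \<and> K (set ys)) =
        weight (\<lambda>_. 1) ys * of_bool (del_at i ys ! j = ys ! i \<and> K (set (del_at i ys)))"
      by auto
  qed simp
  also have "\<dots> = (\<Sum>t\<in>tup V 5. \<Sum>x\<in>V. weight (\<lambda>_. 1) t * 1 * of_bool (t ! j = x \<and> K (set t)))"
    using assms by (intro sum_tup_del_at [where f = "\<lambda>t x. of_bool (t ! j = x \<and> K (set t))"]) auto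
  also have "\<dots> \<le> (\<Sum>t\<in>tup V 5. of_bool (K (set t)))"
  proof (intro sum_mono)
    fix t
    have "(\<Sum>x\<in>V. of_bool (t ! j = x)) \<le> (1::real)"
      using assms(1) by (simp add: of_bool_def if_distrib sum.delta cong: if_cong)
    then show "(\<Sum>x\<in>V. weight (\<lambda>_. 1) t * 1 * of_bool (t ! j = x \<and> K (set t))) \<le> (of_bool (K (set t)) :: real)"
      by (cases "K (set t)") auto
  qed
  also have "\<dots> = real (card {t \<in> tup V 5. K (set t)})"
    using assms(1) by (simp add: Int_def)
  finally show ?thesis
    by simp
qed

lemma card_nondistinct_le:
  assumes V: "finite V"
  shows "card {ys \<in> tup V 6. \<not> distinct ys \<and> K (set ys)} \<le> 15 * card {t \<in> tup V 5. K (set t)}"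
proof -
  let ?I = "{(j, i). j < i \<and> i < (6::nat)}"
  let ?A = "\<lambda>(j, i). {ys \<in> tup V 6. ys ! j = ys ! i \<and> K (set ys)}"
  have I: "?I = (\<Union>i<6. (\<lambda>j. (j, i)) ` {..<i})" by auto
  have cI: "finite ?I" "card ?I = 15"
  proof -
    show "finite ?I" unfolding I by auto
    have "card ?I = (\<Sum>i<(6::nat). i)"
      unfolding I by (subst card_UN_disjoint) (auto simp: card_image inj_on_def)
    then show "card ?I = 15" by (simp add: numeral_eq_Suc)
  qed
  have "{ys \<in> tup V 6. \<not> distinct ys \<and> K (set ys)} \<subseteq> (\<Union>p\<in>?I. ?A p)"
  proof
    fix ys assume "ys \<in> {ys \<in> tup V 6. \<not> distinct ys \<and> K (set ys)}"
    then have ys: "ys \<in> tup V 6" "length ys = 6" "\<not> distinct ys" "K (set ys)"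
      by (auto simp: tup_def)
    then obtain i j where "i < 6" "j < 6" "i \<noteq> j" "ys ! i = ys ! j"
      by (auto simp: distinct_conv_nth)
    then have "\<exists>j i. j < i \<and> i < 6 \<and> ys ! j = ys ! i"
      by (metis nat_neq_iff)
    then show "ys \<in> (\<Union>p\<in>?I. ?A p)"
      using ys(1,4) by auto
  qed
  then have "card {ys \<in> tup V 6. \<not> distinct ys \<and> K (set ys)} \<le> card (\<Union>p\<in>?I. ?A p)"
    using V cI(1) by (intro card_mono) auto
  also have "\<dots> \<le> (\<Sum>p\<in>?I. card (?A p))"
    by (rule card_UN_le [OF cI(1)])
  also have "\<dots> \<le> (\<Sum>p\<in>?I. card {t \<in> tup V 5. K (set t)})"
    using card_tup_coincidence [OF V] by (intro sum_mono) auto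
  also have "\<dots> = 15 * card {t \<in> tup V 5. K (set t)}"
    using cI by simp
  finally show ?thesis .
qed

lemma card_degenerate_F7:
  assumes "is_graph G"
  shows "card (degenerate_F7 G) \<le> 15 * card (verts G) ^ 5"
proof -
  have fin: "finite (verts G)"
    using assms by (simp add: is_graph_def)
  have "card (degenerate_F7 G) \<le> card {ys \<in> tup (verts G) 6. \<not> distinct ys \<and> True}"
    using fin by (intro card_mono) (auto simp: degenerate_F7_def)
  also have "\<dots> \<le> 15 * card {t \<in> tup (verts G) 5. True}"
    by (rule card_nondistinct_le [OF fin])
  finally show ?thesis
    using fin by (simp add: card_tup)
qed

text \<open>Drop the nonnegative terms of the identity.\<close>

lemma leaf_total_le:
  assumes "finite V" "\<And>x. x \<in> V \<Longrightarrow> 0 \<le> w x" "simple_adjacency a" "0 < (\<Sum>x\<in>V. w x)"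
  shows "leaf_total V w a \<le> 160 / 2187 * (\<Sum>x\<in>V. w x) ^ 6"
proof -
  define W where "W = (\<Sum>x\<in>V. w x)"
  have "787320 * W * leaf_total V w a \<le> 57600 * W ^ 7"
    using slack_identity [OF assms(1), of w a] sum_slack7_nonneg [OF assms(1-3)] sum_gram_form_nonneg [OF assms(1,2)]
    unfolding W_def by simp
  moreover have "W ^ 7 = W * W ^ 6"
    by (simp flip: power_Suc)
  ultimately have "W * leaf_total V w a \<le> W * (160 / 2187 * W ^ 6)"
    by simp
  then show ?thesis
    using assms(4) unfolding W_def [symmetric] by simp
qed

section \<open>Three disjoint edges as a coordinate system\<close>

text \<open>
  The six root vertices form the edges \<open>{0, 1}\<close>, \<open>{2, 3}\<close>, \<open>{4,
  5}\<close>.  Part \<open>3 j + q\<close> lies in triangle \<open>j\<close>; its vertices are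
  adjacent to both ends of the edge \<open>j\<close> if \<open>q = 2\<close>, and otherwise only
  to the end \<open>2 j + q\<close>.
\<close>

definition attach_row :: "nat \<Rightarrow> nat \<Rightarrow> bool" where
  "attach_row p i \<longleftrightarrow> i div 2 = p div 3 \<and> (p mod 3 = 2 \<or> p mod 3 = i mod 2)"

definition attached :: "('v \<Rightarrow> 'v \<Rightarrow> bool) \<Rightarrow> 'v list \<Rightarrow> nat \<Rightarrow> 'v \<Rightarrow> bool" where
  "attached a \<rho> p x \<longleftrightarrow> p < 9 \<and> (\<forall>i<6. a (\<rho> ! i) x \<longleftrightarrow> attach_row p i)"

definition matching3 :: "('v \<Rightarrow> 'v \<Rightarrow> bool) \<Rightarrow> 'v list \<Rightarrow> bool" where
  "matching3 a \<rho> \<longleftrightarrow> length \<rho> = 6 \<and> (\<forall>i<6. \<forall>j<6. a (\<rho> ! i) (\<rho> ! j)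
      \<longleftrightarrow> i div 2 = j div 2 \<and> i \<noteq> j)"

definition part_weight :: "'v set \<Rightarrow> ('v \<Rightarrow> real) \<Rightarrow> ('v \<Rightarrow> 'v \<Rightarrow> bool)
    \<Rightarrow> 'v list \<Rightarrow> nat \<Rightarrow> real" where
  "part_weight V w a \<rho> p = (\<Sum>x\<in>{x\<in>V. attached a \<rho> p x}. w x)"

definition stray_weight :: "'v set \<Rightarrow> ('v \<Rightarrow> real) \<Rightarrow> ('v \<Rightarrow> 'v \<Rightarrow> bool)
    \<Rightarrow> 'v list \<Rightarrow> real" where
  "stray_weight V w a \<rho> = (\<Sum>x\<in>{x\<in>V. \<not> (\<exists>p. attached a \<rho> p x)}. w x)"

lemma all_less_6: "(\<forall>i<6. P i) \<longleftrightarrow> P 0 \<and> P 1 \<and> P 2 \<and> P 3 \<and> P 4 \<and> P (5::nat)"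
  by (simp add: numeral_eq_Suc All_less_Suc conj_ac)

lemma less_9_cases: "(p::nat) < 9 \<Longrightarrow> p = 0 \<or> p = 1 \<or> p = 2 \<or> p = 3 \<or> p = 4 \<or> p = 5 \<or> p = 6 \<or> p =
    7 \<or> p = 8"
  by presburger

lemma less_6_cases: "(p::nat) < 6 \<Longrightarrow> p = 0 \<or> p = 1 \<or> p = 2 \<or> p = 3 \<or> p = 4 \<or> p = 5"
  by presburger

lemma attached_unique:
  assumes "attached a \<rho> p x" "attached a \<rho> q x"
  shows "p = q"
proof -
  have "p < 9" "q < 9" and e: "\<forall>i<6. attach_row p i \<longleftrightarrow> attach_row q i"
    using assms by (auto simp: attached_def)
  show ?thesis
    using less_9_cases [OF \<open>p < 9\<close>] less_9_cases [OF \<open>q < 9\<close>] e [unfolded all_less_6]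
    by - (elim disjE; simp add: attach_row_def)
qed

lemma sum_by_part:
  assumes V: "finite V" and w: "\<And>x. x \<in> V \<Longrightarrow> 0 \<le> w x"
    and Q: "\<And>x p. attached a \<rho> p x \<Longrightarrow> Q x \<longleftrightarrow> q p"
  shows "(\<Sum>p<9. of_bool (q p) * part_weight V w a \<rho> p) \<le> (\<Sum>x\<in>{x\<in>V. Q x}. w x)"
    "(\<Sum>x\<in>{x\<in>V. Q x}. w x) \<le> (\<Sum>p<9. of_bool (q p) * part_weight V w a \<rho> p) + stray_weight V w a \<rho>"
proof -
  define good where "good x \<longleftrightarrow> (\<exists>p. attached a \<rho> p x)" for x
  have "(\<Sum>x\<in>{x\<in>V. Q x}. w x) = (\<Sum>x\<in>{x\<in>V. Q x \<and> good x} \<union> {x\<in>V. Q x \<and> \<not> good x}. w x)"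
    by (intro sum.cong) auto
  also have "\<dots> = (\<Sum>x\<in>{x\<in>V. Q x \<and> good x}. w x) + (\<Sum>x\<in>{x\<in>V. Q x \<and> \<not> good x}. w x)"
    using V by (intro sum.union_disjoint) auto
  also have "(\<Sum>x\<in>{x\<in>V. Q x \<and> good x}. w x) = (\<Sum>x\<in>(\<Union>p\<in>{..<9}. {x\<in>V. attached a \<rho> p x \<and> q p}). w x)"
    using Q by (intro sum.cong) (auto simp: good_def attached_def)
  also have "\<dots> = (\<Sum>p<9. \<Sum>x\<in>{x\<in>V. attached a \<rho> p x \<and> q p}. w x)"
  proof (rule sum.UNION_disjoint)
    show "\<forall>p\<in>{..<9}. \<forall>q'\<in>{..<9}. p \<noteq> q' \<longrightarrow> {x\<in>V. attached a \<rho> p x \<and> q p}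
        \<inter> {x\<in>V. attached a \<rho> q' x \<and> q q'} = {}"
      using attached_unique [of a \<rho>] by blast
  qed (use V in auto)
  also have "\<dots> = (\<Sum>p<9. of_bool (q p) * part_weight V w a \<rho> p)"
    by (intro sum.cong) (auto simp: part_weight_def)
  finally have e: "(\<Sum>x\<in>{x\<in>V. Q x}. w x) = (\<Sum>p<9. of_bool (q p) * part_weight V w a \<rho> p) +
     (\<Sum>x\<in>{x\<in>V. Q x \<and> \<not> good x}. w x)" .
  have "0 \<le> (\<Sum>x\<in>{x\<in>V. Q x \<and> \<not> good x}. w x)"
    using w by (intro sum_nonneg) auto
  moreover have "(\<Sum>x\<in>{x\<in>V. Q x \<and> \<not> good x}. w x) \<le> stray_weight V w a \<rho>"
    unfolding stray_weight_def good_def using V w by (intro sum_mono2) auto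
  ultimately show "(\<Sum>p<9. of_bool (q p) * part_weight V w a \<rho> p) \<le> (\<Sum>x\<in>{x\<in>V. Q x}. w x)"
    "(\<Sum>x\<in>{x\<in>V. Q x}. w x) \<le> (\<Sum>p<9. of_bool (q p) * part_weight V w a \<rho> p) + stray_weight V w a \<rho>"
    using e by linarith+
qed

text \<open>
  The relations equate first the two parts of each triangle that contain the ends of its edge,
  then these parts with the third one, and finally the triangles with each other.
\<close>

lemma nine_parts_balanced:
  fixes n0 n1 n2 n3 n4 n5 n6 n7 n8 d \<beta> W :: real
  assumes leaves: "\<bar>n3 + n4 + n6 + n7 - 2 * (n1 + n2)\<bar> \<le> d" "\<bar>n3 + n4 + n6 + n7 - 2 * (n0 + n2)\<bar> \<le> d"
      "\<bar>n0 + n1 + n6 + n7 - 2 * (n4 + n5)\<bar> \<le> d" "\<bar>n0 + n1 + n6 + n7 - 2 * (n3 + n5)\<bar> \<le> d"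
      "\<bar>n0 + n1 + n3 + n4 - 2 * (n7 + n8)\<bar> \<le> d" "\<bar>n0 + n1 + n3 + n4 - 2 * (n6 + n8)\<bar> \<le> d"
    and tops: "\<bar>n5 + n8 - (n1 + n2)\<bar> \<le> d" "\<bar>n2 + n8 - (n4 + n5)\<bar> \<le> d" "\<bar>n2 + n5 - (n7 + n8)\<bar> \<le> d"
    and total: "n0 + n1 + n2 + n3 + n4 + n5 + n6 + n7 + n8 \<le> W" "W \<le> n0 + n1 + n2 + n3 + n4 + n5 + n6 + n7 + n8 + \<beta>"
    and \<beta>: "0 \<le> \<beta>" "\<beta> \<le> d"
  shows "n \<in> {n0, n1, n2, n3, n4, n5, n6, n7, n8} \<Longrightarrow> \<bar>n - W / 9\<bar> \<le> 20 * d"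
proof -
  have twin: "\<bar>n0 - n1\<bar> \<le> d" "\<bar>n3 - n4\<bar> \<le> d" "\<bar>n6 - n7\<bar> \<le> d"
    using leaves by argo+
  have pairs: "\<bar>n4 + n7 - 2 * n2\<bar> \<le> 2 * d" "\<bar>n1 + n7 - 2 * n5\<bar> \<le> 2 * d" "\<bar>n1 + n4 - 2 * n8\<bar> \<le> 2 * d"
    using tops by argo+
  have tri: "\<bar>n2 - n1\<bar> \<le> 4 * d" "\<bar>n5 - n4\<bar> \<le> 4 * d" "\<bar>n8 - n7\<bar> \<le> 4 * d"
    using leaves(1,3,5) [unfolded distrib_left] twin pairs by argo+
  have top: "\<bar>n5 - n2\<bar> \<le> 6 * d" "\<bar>n8 - n2\<bar> \<le> 6 * d"
    using tri [THEN abs_le_D1] tri [THEN abs_le_D2] pairs [THEN abs_le_D1] pairs [THEN abs_le_D2]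
    by - (intro abs_leI; linarith)+
  have near: "\<bar>n0 - n2\<bar> \<le> 11 * d" "\<bar>n1 - n2\<bar> \<le> 11 * d" "\<bar>n3 - n2\<bar> \<le> 11 * d" "\<bar>n4 - n2\<bar>
      \<le> 11 * d"
    "\<bar>n5 - n2\<bar> \<le> 11 * d" "\<bar>n6 - n2\<bar> \<le> 11 * d" "\<bar>n7 - n2\<bar> \<le> 11 * d" "\<bar>n8 - n2\<bar> \<le> 11 * d"
    using twin [THEN abs_le_D1] twin [THEN abs_le_D2] tri [THEN abs_le_D1] tri [THEN abs_le_D2] top [THEN abs_le_D1] top [THEN abs_le_D2] \<beta>
    by - (intro abs_leI; linarith)+
  have "\<bar>9 * n2 - W\<bar> \<le> 68 * d"
    using twin [THEN abs_le_D1] twin [THEN abs_le_D2] tri [THEN abs_le_D1] tri [THEN abs_le_D2] top [THEN abs_le_D1] top [THEN abs_le_D2]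
        total \<beta>
    by - (intro abs_leI; linarith)
  then have *: "\<bar>n2 - W / 9\<bar> \<le> 8 * d"
    using \<beta> by linarith
  show "\<bar>n - W / 9\<bar> \<le> 20 * d" if "n \<in> {n0, n1, n2, n3, n4, n5, n6, n7, n8}"
  proof -
    have "\<bar>n - n2\<bar> \<le> 11 * d"
      using that near \<beta> by auto
    with * show ?thesis by linarith
  qed
qed

context simple_adjacency
begin

text \<open>
  How a vertex of part \<open>p\<close> is attached to the \<open>2K\<^sub>2 + K\<^sub>1\<close>
  that remains after root \<open>i\<close> has been deleted.
\<close>

definition root_signature :: "nat \<Rightarrow> nat \<Rightarrow> nat list" where
  "root_signature i p = (if p div 3 = i div 2
     then if p mod 3 = i mod 2 then [0, 0, 0, 0] else [1, 0, 0, 0]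
     else if p mod 3 = 2 then [2, 2, 2, 2] else [1, 1, 1, 0])"

lemma matching3_bits:
  assumes "matching3 a \<rho>"
  obtains r0 r1 r2 r3 r4 r5 where "\<rho> = [r0, r1, r2, r3, r4, r5]" "a r0 r1" "a r2 r3" "a r4 r5"
    "\<not> a r0 r2" "\<not> a r0 r3" "\<not> a r0 r4" "\<not> a r0 r5" "\<not> a r1 r2" "\<not> a r1 r3" "\<not> a r1 r4" "\<not> a r1 r5"
    "\<not> a r2 r4" "\<not> a r2 r5" "\<not> a r3 r4" "\<not> a r3 r5"
proof -
  have "length \<rho> = 6" using assms by (simp add: matching3_def)
  then obtain r0 r1 r2 r3 r4 r5 where r: "\<rho> = [r0, r1, r2, r3, r4, r5]"
    by (auto simp: length_Suc_conv numeral_eq_Suc)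
  have *: "a (\<rho> ! i) (\<rho> ! j) \<longleftrightarrow> i div 2 = j div 2 \<and> i \<noteq> j" if "i < 6" "j < 6" for i j
    using assms that by (simp add: matching3_def)
  show ?thesis
    using that [OF r] *[of 0 1] *[of 2 3] *[of 4 5] *[of 0 2] *[of 0 3] *[of 0 4] *[of 0 5] *[of 1 2] *[of 1 3] *[of 1 4] *[of 1 5]
      *[of 2 4] *[of 2 5] *[of 3 4] *[of 3 5]
    by (simp add: r)
qed

lemma matching3_del_at:
  assumes "matching3 a \<rho>" "i < 6"
  shows type_key_matching3_del_at: "type_key a (del_at i \<rho>) = (4, 4)"
    and signature_matching3_del_at: "attached a \<rho> p x \<Longrightarrow> signature a (del_at i \<rho>) x = root_signature i p"
proof -
  obtain r0 r1 r2 r3 r4 r5 where r: "\<rho> = [r0, r1, r2, r3, r4, r5]" and e: "a r0 r1" "a r2 r3" "a r4 r5"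
    "\<not> a r0 r2" "\<not> a r0 r3" "\<not> a r0 r4" "\<not> a r0 r5" "\<not> a r1 r2" "\<not> a r1 r3" "\<not> a r1 r4" "\<not> a r1 r5"
    "\<not> a r2 r4" "\<not> a r2 r5" "\<not> a r3 r4" "\<not> a r3 r5"
    using matching3_bits [OF assms(1)] by metis
  have del_at: "del_at 0 \<rho> = [r1, r2, r3, r4, r5]" "del_at 1 \<rho> = [r0, r2, r3, r4, r5]" "del_at 2 \<rho> = [r0, r1, r3, r4, r5]"
    "del_at 3 \<rho> = [r0, r1, r2, r4, r5]" "del_at 4 \<rho> = [r0, r1, r2, r3, r5]" "del_at 5 \<rho> = [r0, r1, r2, r3, r4]"
    by (simp_all add: r numeral_eq_Suc)
  have i: "i = 0 \<or> i = 1 \<or> i = 2 \<or> i = 3 \<or> i = 4 \<or> i = 5"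
    by (rule less_6_cases [OF assms(2)])
  then show "type_key a (del_at i \<rho>) = (4, 4)"
    by (elim disjE; simp only: del_at type_key_eq_bits e; simp add: type_key_bits_def Let_def)
  assume "attached a \<rho> p x"
  then have p: "p < 9" and b: "\<forall>i<6. a (\<rho> ! i) x \<longleftrightarrow> attach_row p i"
    by (auto simp: attached_def)
  from b have b: "a r0 x = attach_row p 0" "a r1 x = attach_row p 1" "a r2 x = attach_row p 2"
    "a r3 x = attach_row p 3" "a r4 x = attach_row p 4" "a r5 x = attach_row p 5"
    unfolding all_less_6 by (simp_all add: r)
  show "signature a (del_at i \<rho>) x = root_signature i p"
    using i less_9_cases [OF p]
    by - (elim disjE; simp only: del_at signature_eq_bits e b; simp add: signature_bits_def Let_def attach_row_def root_signature_def)
qed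

text \<open>
  Deleting any one of the six roots leaves \<open>2K\<^sub>2 + K\<^sub>1\<close>, and the two
  squares of \<open>gram_form_matching_vertex\<close> for these six lists are linear relations
  between the nine part sizes, up to the weight of the stray vertices.
\<close>

theorem parts_balanced:
  fixes V w \<rho> \<eta>
  defines "W \<equiv> \<Sum>x\<in>V. w x" and "N \<equiv> part_weight V w a \<rho>" and "\<beta> \<equiv> stray_weight V w a \<rho>"
  assumes V: "finite V" and w: "\<And>x. x \<in> V \<Longrightarrow> 0 \<le> w x" and \<rho>: "matching3 a \<rho>" and \<eta>: "0 \<le> \<eta>"
    and gram: "\<And>i. i < 6 \<Longrightarrow> gram_form V w a (del_at i \<rho>) \<le> 100 * \<eta>\<^sup>2"
    and p: "p < 9"
  shows "\<bar>N p - W / 9\<bar> \<le> 20 * (\<eta> + 2 * \<beta>)"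
proof -
  have nine: "(\<Sum>p<9. f p) = f 0 + f 1 + f 2 + f 3 + f 4 + f 5 + f 6 + f 7 + f 8" for f :: "nat \<Rightarrow> real"
    by (simp add: numeral_eq_Suc)
  have total: "N 0 + N 1 + N 2 + N 3 + N 4 + N 5 + N 6 + N 7 + N 8 \<le> W"
      "W \<le> N 0 + N 1 + N 2 + N 3 + N 4 + N 5 + N 6 + N 7 + N 8 + \<beta>"
    using sum_by_part [OF V w, where a = a and \<rho> = \<rho> and Q = "\<lambda>_. True" and q = "\<lambda>_. True"] unfolding nine W_def
        N_def \<beta>_def by simp_all
  have \<beta>: "0 \<le> \<beta>"
    unfolding \<beta>_def stray_weight_def using w by (intro sum_nonneg) auto
  have square_parts: "x\<^sup>2 \<le> e" "y\<^sup>2 \<le> e" if "100 * (x\<^sup>2 + y\<^sup>2) \<le> 100 * e" for x y e :: real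
    using that zero_le_power2 [of x] zero_le_power2 [of y] unfolding distrib_left by linarith+
  define S where "S i s = (\<Sum>p<9. of_bool (root_signature i p = s) * N p)" for i s
  have ineq: "\<bar>S i [1,1,1,0] - 2 * S i [1,0,0,0]\<bar> \<le> \<eta> + 2 * \<beta>" "\<bar>S i [2,2,2,2] - S i [1,0,0,0]\<bar> \<le>
      \<eta> + 2 * \<beta>"
    if i: "i < 6" for i
  proof -
    define T where "T s = (\<Sum>x\<in>{x\<in>V. signature a (del_at i \<rho>) x = s}. w x)" for s
    have T: "S i s \<le> T s" "T s \<le> S i s + \<beta>" for s
      using sum_by_part [OF V w, where a = a and \<rho> = \<rho> and Q = "\<lambda>x. signature a (del_at i \<rho>) x = s" and q =
          "\<lambda>p. root_signature i p = s" for s]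
        signature_matching3_del_at [OF \<rho> i]
      unfolding S_def T_def N_def \<beta>_def by simp_all
    have "100 * ((T leaf_sig - 2 * T [1,0,0,0])\<^sup>2 + (T [2,2,2,2] - T [1,0,0,0])\<^sup>2) \<le> 100 * \<eta>\<^sup>2"
      using gram_form_matching_vertex [OF V type_key_matching3_del_at [OF \<rho> i], of w] gram [OF i]
      unfolding T_def by linarith
    then have "(T leaf_sig - 2 * T [1,0,0,0])\<^sup>2 \<le> \<eta>\<^sup>2" "(T [2,2,2,2] - T [1,0,0,0])\<^sup>2 \<le> \<eta>\<^sup>2"
      using square_parts by blast+
    then have "\<bar>T leaf_sig - 2 * T [1,0,0,0]\<bar> \<le> \<eta>" "\<bar>T [2,2,2,2] - T [1,0,0,0]\<bar> \<le> \<eta>"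
      using \<eta> by (auto simp: abs_le_square_iff [symmetric])
    with T [of "[1,1,1,0]"] T [of "[1,0,0,0]"] T [of "[2,2,2,2]"]
    show "\<bar>S i [1,1,1,0] - 2 * S i [1,0,0,0]\<bar> \<le> \<eta> + 2 * \<beta>" "\<bar>S i [2,2,2,2] - S i [1,0,0,0]\<bar> \<le> \<eta>
        + 2 * \<beta>"
      unfolding leaf_sig_def by linarith+
  qed
  have S0: "S 0 [1,0,0,0] = N 1 + N 2" "S 0 [1,1,1,0] = N 3 + N 4 + N 6 + N 7" "S 0 [2,2,2,2] = N 5 + N 8"
    unfolding S_def nine by (simp_all add: root_signature_def)
  have S1: "S 1 [1,0,0,0] = N 0 + N 2" "S 1 [1,1,1,0] = N 3 + N 4 + N 6 + N 7" "S 1 [2,2,2,2] = N 5 + N 8"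
    unfolding S_def nine by (simp_all add: root_signature_def)
  have S2: "S 2 [1,0,0,0] = N 4 + N 5" "S 2 [1,1,1,0] = N 0 + N 1 + N 6 + N 7" "S 2 [2,2,2,2] = N 2 + N 8"
    unfolding S_def nine by (simp_all add: root_signature_def)
  have S3: "S 3 [1,0,0,0] = N 3 + N 5" "S 3 [1,1,1,0] = N 0 + N 1 + N 6 + N 7" "S 3 [2,2,2,2] = N 2 + N 8"
    unfolding S_def nine by (simp_all add: root_signature_def)
  have S4: "S 4 [1,0,0,0] = N 7 + N 8" "S 4 [1,1,1,0] = N 0 + N 1 + N 3 + N 4" "S 4 [2,2,2,2] = N 2 + N 5"
    unfolding S_def nine by (simp_all add: root_signature_def)
  have S5: "S 5 [1,0,0,0] = N 6 + N 8" "S 5 [1,1,1,0] = N 0 + N 1 + N 3 + N 4" "S 5 [2,2,2,2] = N 2 + N 5"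
    unfolding S_def nine by (simp_all add: root_signature_def)
  define d where "d = \<eta> + 2 * \<beta>"
  have I: "\<bar>S i [1,1,1,0] - 2 * S i [1,0,0,0]\<bar> \<le> d" "\<bar>S i [2,2,2,2] - S i [1,0,0,0]\<bar> \<le> d" if "i < 6" for i
    using ineq [OF that] unfolding d_def .
  have less6: "0 < (6::nat)" "1 < (6::nat)" "2 < (6::nat)" "3 < (6::nat)" "4 < (6::nat)" "5 < (6::nat)"
    by simp_all
  note leaves = I(1) [OF less6(1), unfolded S0] I(1) [OF less6(2), unfolded S1] I(1) [OF less6(3), unfolded S2]
    I(1) [OF less6(4), unfolded S3] I(1) [OF less6(5), unfolded S4] I(1) [OF less6(6), unfolded S5]
  note tops = I(2) [OF less6(1), unfolded S0] I(2) [OF less6(3), unfolded S2] I(2) [OF less6(5), unfolded S4]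
  have "N p \<in> {N 0, N 1, N 2, N 3, N 4, N 5, N 6, N 7, N 8}"
    using less_9_cases [OF p] by auto
  moreover have "\<beta> \<le> d"
    unfolding d_def using \<eta> \<beta> by simp
  ultimately show ?thesis
    unfolding d_def [symmetric] using nine_parts_balanced [OF leaves tops total \<beta>] by blast
qed

end

text \<open>
  An attachment is possible in a blowup of three triangles exactly if it meets one of the three
  edges and no other.
\<close>

lemma slack7_bits_attachment:
  assumes "\<not> (((b0 \<or> b1) \<and> \<not> b2 \<and> \<not> b3 \<and> \<not> b4 \<and> \<not> b5) \<or> ((b2 \<or> b3) \<and> \<not>
      b0 \<and> \<not> b1 \<and> \<not> b4 \<and> \<not> b5) \<or> ((b4 \<or> b5) \<and> \<not> b0 \<and> \<not> b1 \<and> \<not> b2 \<and>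
      \<not> b3))"
  shows "1 \<le> slack7_bits True False False False False True False False False False False False False False True b0 b1 b2 b3 b4 b5"
  using assms
  by (cases b0; cases b1; cases b2; cases b3; cases b4; cases b5) (simp_all add: slack7_bits_def coef_bits_eval)

context simple_adjacency
begin

lemma attached_bits:
  "attached a [r0, r1, r2, r3, r4, r5] p x \<longleftrightarrow> p < 9 \<and> a r0 x = attach_row p 0 \<and> a r1 x = attach_row p 1 \<and>
     a r2 x = attach_row p 2 \<and> a r3 x = attach_row p 3 \<and> a r4 x = attach_row p 4 \<and> a r5 x = attach_row p 5"
  unfolding attached_def all_less_6 by simp

lemma slack7_bad_attachment:
  assumes "matching3 a \<rho>" "\<not> (\<exists>p. attached a \<rho> p x)"
  shows "1 \<le> slack7 a (\<rho> @ [x])"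
proof -
  obtain r0 r1 r2 r3 r4 r5 where r: "\<rho> = [r0, r1, r2, r3, r4, r5]" and e: "a r0 r1" "a r2 r3" "a r4 r5"
    "\<not> a r0 r2" "\<not> a r0 r3" "\<not> a r0 r4" "\<not> a r0 r5" "\<not> a r1 r2" "\<not> a r1 r3" "\<not> a r1 r4" "\<not> a r1 r5"
    "\<not> a r2 r4" "\<not> a r2 r5" "\<not> a r3 r4" "\<not> a r3 r5"
    using matching3_bits [OF assms(1)] by metis
  have bad: "\<not> attached a [r0, r1, r2, r3, r4, r5] p x" for p
    using assms(2) r by blast
  have "1 \<le> slack7_bits True False False False False True False False False False False False False False True (a r0 x) (a r1 x) (a r2
      x) (a r3 x) (a r4 x) (a r5 x)"
    using bad [of 0] bad [of 1] bad [of 2] bad [of 3] bad [of 4] bad [of 5] bad [of 6] bad [of 7] bad [of 8]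
    by (intro slack7_bits_attachment) (simp add: attached_bits attach_row_def, argo)
  then show ?thesis
    by (simp add: r slack7_eq_bits e)
qed

text \<open>
  The two vertices lie in at most two of the triangles, so there is an edge of the root that is
  not needed to see the contradiction.  Deleting one end of that edge makes room for both
  vertices in a list of length seven.
\<close>

lemma slack7_wrong_pair:
  assumes "matching3 a \<rho>" "attached a \<rho> p x" "attached a \<rho> q y" "a x y \<noteq> b9 p q"
  shows "\<exists>i<6. 1 \<le> slack7 a (del_at i \<rho> @ [x, y])"
proof -
  obtain r0 r1 r2 r3 r4 r5 where r: "\<rho> = [r0, r1, r2, r3, r4, r5]" and e: "a r0 r1" "a r2 r3" "a r4 r5"
    "\<not> a r0 r2" "\<not> a r0 r3" "\<not> a r0 r4" "\<not> a r0 r5" "\<not> a r1 r2" "\<not> a r1 r3" "\<not> a r1 r4" "\<not> a r1 r5"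
    "\<not> a r2 r4" "\<not> a r2 r5" "\<not> a r3 r4" "\<not> a r3 r5"
    using matching3_bits [OF assms(1)] by metis
  have x: "p < 9" "a r0 x = attach_row p 0" "a r1 x = attach_row p 1"
     "a r2 x = attach_row p 2" "a r3 x = attach_row p 3" "a r4 x = attach_row p 4" "a r5 x = attach_row p 5"
    using assms(2) by (simp_all add: r attached_bits)
  have y: "q < 9" "a r0 y = attach_row q 0" "a r1 y = attach_row q 1"
     "a r2 y = attach_row q 2" "a r3 y = attach_row q 3" "a r4 y = attach_row q 4" "a r5 y = attach_row q 5"
    using assms(3) by (simp_all add: r attached_bits)
  have xy: "a x y \<longleftrightarrow> \<not> b9 p q"
    using assms(4) by blast
  have del_at: "del_at 0 \<rho> = [r1, r2, r3, r4, r5]" "del_at 2 \<rho> = [r0, r1, r3, r4, r5]" "del_at 4 \<rho> = [r0, r1, r2, r3, r5]"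
    by (simp_all add: r numeral_eq_Suc)
  \<comment> \<open>The first root of an edge whose triangle contains neither vertex.\<close>
  define i :: nat where "i = (if p div 3 \<noteq> 0 \<and> q div 3 \<noteq> 0 then 0 else if p div 3 \<noteq> 1 \<and> q div 3 \<noteq> 1
      then 2 else 4)"
  have "i < 6"
    by (simp add: i_def)
  moreover have "1 \<le> slack7 a (del_at i \<rho> @ [x, y])"
    using less_9_cases [OF x(1)] less_9_cases [OF y(1)] unfolding i_def
    by (elim disjE) (simp_all add: del_at slack7_eq_bits e x(2-7) y(2-7) xy b9_iff attach_row_def slack7_bits_def coef_bits_eval)
  ultimately show ?thesis
    by blast
qed

end

section \<open>Densities of blowups\<close>

lemma leaf_total_pullback:
  assumes V: "finite V" and B: "finite B" and p: "p ` V \<subseteq> B" and pb: "pulls_back V p a h"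
    and a: "simple_adjacency a" and h: "simple_adjacency h"
  shows "leaf_total V (\<lambda>_. 1) a = leaf_total B (\<lambda>i. real (card {x \<in> V. p x = i})) h"
proof -
  have "3 * leaf_total V (\<lambda>_. 1) a = (\<Sum>ys\<in>tup V 6. of_bool (F7_list h (map p ys)))"
    using simple_adjacency.leaf_total_eq_F7_lists [OF a V, of "\<lambda>_. 1"] F7_list_pullback [OF pb] by simp
  also have "\<dots> = 3 * leaf_total B (\<lambda>i. real (card {x \<in> V. p x = i})) h"
    unfolding simple_adjacency.leaf_total_eq_F7_lists [OF h B]
    by (rule sum_tup_map [OF V B p, where f = "\<lambda>ys. of_bool (F7_list h ys)"])
  finally show ?thesis
    by simp
qed

lemma leaf_total_cong:
  assumes "\<And>x. x \<in> V \<Longrightarrow> w x = v x"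
  shows "leaf_total V w a = leaf_total V v a"
proof -
  have "weight w t = weight v t" if "t \<in> tup V 5" for t
    using that assms by (intro weight_cong) (auto simp: tup_def)
  then show ?thesis
    unfolding leaf_total_def using assms by simp
qed

lemma leaf_total_scale: "leaf_total V (\<lambda>x. c * w x) a = c ^ 6 * leaf_total V w a"
  unfolding leaf_total_def sum_distrib_left
  by (intro sum.cong refl) (auto simp: weight_scale tup_def power_numeral_reduce)

lemma tendsto_leaf_total:
  assumes "\<And>x. x \<in> V \<Longrightarrow> ((\<lambda>n. w n x) \<longlongrightarrow> v x) F"
  shows "((\<lambda>n. leaf_total V (w n) a) \<longlongrightarrow> leaf_total V v a) F"
  unfolding leaf_total_def
  by (intro tendsto_sum tendsto_mult tendsto_weight tendsto_const assms) (auto simp: tup_def)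

lemma verts_B9: "verts B9 = {..<9}"
  by (simp add: B9_def)

lemma verts_blowup_B9: "verts (blowup B9 P) = (\<Union>i<9. P i)"
  by (simp add: blowup_def verts_B9)

lemma edges_blowup_B9:
  "edges (blowup B9 P) = {{x, y} | x y. x \<noteq> y \<and> (\<exists>i<9. \<exists>j<9. x \<in> P i \<and> y \<in> P j \<and> b9 i j)}"
  unfolding blowup_def verts_B9 b9_def snd_conv by blast

lemma adj_blowup_B9:
  assumes "blowup_parts B9 P" "x \<in> P i" "y \<in> P j" "i < 9" "j < 9"
  shows "adj (blowup B9 P) x y \<longleftrightarrow> b9 i j"
proof
  have unique: "k = l" if "k < 9" "l < 9" "z \<in> P k" "z \<in> P l" for k l z
    using assms(1) that by (auto simp: blowup_parts_def disjoint_family_on_def verts_B9)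
  {
    assume "b9 i j"
    moreover from this have "x \<noteq> y"
      using unique [of i j x] assms(2-5) b9.adj_irrefl by metis
    ultimately show "adj (blowup B9 P) x y"
      using assms(2-5) unfolding adj_def edges_blowup_B9 by blast
  next
    assume "adj (blowup B9 P) x y"
    then obtain x' y' k l where e: "{x, y} = {x', y'}" and kl: "k < 9" "l < 9" "x' \<in> P k" "y' \<in> P l" "b9 k l"
      unfolding adj_def edges_blowup_B9 by blast
    consider "x = x'" "y = y'" | "x = y'" "y = x'"
      using e by (auto simp: doubleton_eq_iff)
    then show "b9 i j"
    proof cases
      case 1
      then have "k = i" "l = j"
        using unique kl assms(2-5) by blast+
      then show ?thesis using kl(5) by simp
    next
      case 2
      then have "k = j" "l = i"
        using unique kl assms(2-5) by blast+
      then show ?thesis using kl(5) b9.adj_sym by simp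
    qed
  }
qed

lemma is_graph_blowup_B9:
  assumes "blowup_parts B9 P"
  shows "is_graph (blowup B9 P)"
  using assms unfolding is_graph_def blowup_parts_def edges_blowup_B9 verts_blowup_B9 verts_B9 by auto

lemma part_of_blowup:
  fixes P :: "nat \<Rightarrow> 'v set"
  assumes "blowup_parts B9 P"
  obtains \<pi> where "\<pi> ` (\<Union>i<9. P i) \<subseteq> {..<9::nat}" "\<And>i. i < 9 \<Longrightarrow> {x \<in> (\<Union>i<9. P i).
      \<pi> x = i} = P i"
    "pulls_back (\<Union>i<9. P i) \<pi> (adj (blowup B9 P)) b9"
proof -
  define \<pi> where "\<pi> x = (SOME i. i < 9 \<and> x \<in> P i)" for x
  have \<pi>: "\<pi> x < 9 \<and> x \<in> P (\<pi> x)" if "x \<in> (\<Union>i<9. P i)" for x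
    unfolding \<pi>_def using that by (intro someI_ex [of "\<lambda>i. i < 9 \<and> x \<in> P i"]) auto
  have unique: "k = l" if "k < 9" "l < 9" "z \<in> P k" "z \<in> P l" for k l z
    using assms(1) that by (auto simp: blowup_parts_def disjoint_family_on_def verts_B9)
  show ?thesis
  proof (rule that [of \<pi>])
    show "\<pi> ` (\<Union>i<9. P i) \<subseteq> {..<9::nat}"
      using \<pi> by blast
    show "{x \<in> (\<Union>i<9. P i). \<pi> x = i} = P i" if "i < 9" for i
    proof (intro equalityI subsetI)
      fix x assume "x \<in> {x \<in> (\<Union>i<9. P i). \<pi> x = i}"
      then show "x \<in> P i"
        using \<pi> by blast
    next
      fix x assume x: "x \<in> P i"
      then have U: "x \<in> (\<Union>i<9. P i)"
        using that by blast
      with \<pi> [OF U] unique [of "\<pi> x" i x] x that show "x \<in> {x \<in> (\<Union>i<9. P i). \<pi> x = i}"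
        by blast
    qed
    show "pulls_back (\<Union>i<9. P i) \<pi> (adj (blowup B9 P)) b9"
      using \<pi> adj_blowup_B9 [OF assms] unfolding pulls_back_def by blast
  qed
qed

lemma leaf_total_blowup_B9:
  assumes "blowup_parts B9 P"
  shows "leaf_total (verts (blowup B9 P)) (\<lambda>_. 1) (adj (blowup B9 P)) = leaf_total {..<9} (\<lambda>i. real (card (P i))) b9"
proof -
  obtain \<pi> where \<pi>: "\<pi> ` (\<Union>i<9. P i) \<subseteq> {..<9::nat}" "\<And>i. i < 9 \<Longrightarrow> {x \<in> (\<Union>i<9. P
      i). \<pi> x = i} = P i"
    "pulls_back (\<Union>i<9. P i) \<pi> (adj (blowup B9 P)) b9"
    using part_of_blowup [OF assms] by blast
  have fin: "finite (\<Union>i<9. P i)"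
    using is_graph_blowup_B9 [OF assms] by (simp add: is_graph_def verts_blowup_B9)
  have "leaf_total (\<Union>i<9. P i) (\<lambda>_. 1) (adj (blowup B9 P)) =
      leaf_total {..<9} (\<lambda>i. real (card {x \<in> (\<Union>i<9. P i). \<pi> x = i})) b9"
    using fin finite_lessThan \<pi>(1,3) simple_adjacency_adj [OF is_graph_blowup_B9 [OF assms]] b9.simple_adjacency_axioms
    by (rule leaf_total_pullback)
  also have "\<dots> = leaf_total {..<9} (\<lambda>i. real (card (P i))) b9"
    using \<pi>(2) by (intro leaf_total_cong) simp
  finally show ?thesis
    by (simp add: verts_blowup_B9)
qed

lemma card_verts_blowup_B9:
  assumes "blowup_parts B9 P"
  shows "card (verts (blowup B9 P)) = (\<Sum>i<9. card (P i))"
  using assms unfolding verts_blowup_B9 blowup_parts_def disjoint_family_on_def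
  by (intro card_UN_disjoint) (auto simp: verts_B9)

lemma tendsto_choose_6: "(\<lambda>n. real (n choose 6) / real n ^ 6) \<longlonglongrightarrow> 1 / 720"
proof -
  have "(\<lambda>n. (\<Prod>i<6. 1 - real i * (1 / real n)) / 720) \<longlonglongrightarrow> (\<Prod>i<6. 1 - real i * 0) / 720"
    by (intro tendsto_intros lim_const_over_n) simp
  moreover have "(\<Prod>i<6. 1 - real i * (1 / real n)) / 720 = real (n choose 6) / real n ^ 6" if "0 < n" for n
  proof -
    have "real (n choose 6) = (\<Prod>i<6. real n - real i) / 720"
      using gbinomial_prod_rev [of "real n" 6] by (simp add: binomial_gbinomial fact_numeral atLeast0LessThan)
    moreover have "(\<Prod>i<6. real n - real i) = (\<Prod>i<6. real n * (1 - real i * (1 / real n)))"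
      using that by (intro prod.cong refl) (simp add: right_diff_distrib)
    then have "(\<Prod>i<6. real n - real i) = real n ^ 6 * (\<Prod>i<6. 1 - real i * (1 / real n))"
      by (simp add: prod.distrib)
    ultimately show ?thesis
      using that by simp
  qed
  then have "\<forall>\<^sub>F n in sequentially. (\<Prod>i<6. 1 - real i * (1 / real n)) / 720 = real (n choose 6) / real n ^ 6"
    by (rule eventually_mono [OF eventually_gt_at_top [of 0]])
  ultimately have "(\<lambda>n. real (n choose 6) / real n ^ 6) \<longlonglongrightarrow> (\<Prod>i<6. 1 - real i * 0) / 720"
    by (rule Lim_transform_eventually)
  then show ?thesis
    by simp
qed

lemma density_F7_eq:
  assumes "is_graph G"
  shows "density F7 G = (3 * leaf_total (verts G) (\<lambda>_. 1) (adj G) - real (card (degenerate_F7 G))) / 720 /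
     real (card (verts G) choose 6)"
  using leaf_total_eq_F7_sets [OF assms] by (simp add: density_F7)

text \<open>
  Lists with repeated entries contribute a lower order term, and the number of leaf pairs of the
  blowup is a polynomial in the part sizes.
\<close>

lemma tendsto_density_blowup_B9:
  assumes P: "\<And>n. blowup_parts B9 (P n)" and lim: "\<And>i. i < 9 \<Longrightarrow> (\<lambda>n. real (card (P n i)) / real n)
      \<longlonglongrightarrow> x i"
    and sum1: "(\<Sum>i<9. x i) = 1"
  shows "(\<lambda>n. density F7 (blowup B9 (P n))) \<longlonglongrightarrow> 3 * leaf_total {..<9} x b9"
proof -
  define G where "G n = blowup B9 (P n)" for n
  define N where "N n = card (verts (G n))" for n
  define L where "L n = leaf_total (verts (G n)) (\<lambda>_. 1) (adj (G n))" for n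
  define D where "D n = real (card (degenerate_F7 (G n)))" for n
  have G: "is_graph (G n)" for n
    unfolding G_def by (rule is_graph_blowup_B9 [OF P])
  have N: "(\<lambda>n. real (N n) / real n) \<longlonglongrightarrow> 1"
  proof -
    have "(\<lambda>n. \<Sum>i<9. real (card (P n i)) / real n) \<longlonglongrightarrow> (\<Sum>i<9. x i)"
      by (intro tendsto_sum lim) simp
    then show ?thesis
      unfolding sum1 N_def G_def card_verts_blowup_B9 [OF P] by (simp add: sum_divide_distrib)
  qed
  have N_at_top: "filterlim N at_top sequentially"
  proof -
    have "filterlim (\<lambda>n. real (N n) / real n * real n) at_top sequentially"
      by (rule filterlim_tendsto_pos_mult_at_top [OF N _ filterlim_real_sequentially]) simp
    moreover have E: "\<forall>\<^sub>F n in sequentially. real (N n) / real n * real n = real (N n)"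
      by (rule eventually_mono [OF eventually_gt_at_top [of 0]]) simp
    ultimately have "filterlim (\<lambda>n. real (N n)) at_top sequentially"
      unfolding filterlim_cong [OF refl refl E] by blast
    then show ?thesis
      by (simp add: filterlim_sequentially_iff_filterlim_real)
  qed
  have L: "(\<lambda>n. L n / real n ^ 6) \<longlonglongrightarrow> leaf_total {..<9} x b9"
  proof -
    have "L n / real n ^ 6 = leaf_total {..<9} (\<lambda>i. real (card (P n i)) / real n) b9" for n
      unfolding L_def G_def leaf_total_blowup_B9 [OF P]
      using leaf_total_scale [of "{..<9}" "1 / real n" "\<lambda>i. real (card (P n i))" b9]
      by (simp add: power_divide)
    then show ?thesis
      using tendsto_leaf_total [of "{..<9}" "\<lambda>n i. real (card (P n i)) / real n" x sequentially b9] lim by simp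
  qed
  have D: "(\<lambda>n. D n / real n ^ 6) \<longlonglongrightarrow> 0"
  proof (rule tendsto_sandwich)
    show "\<forall>\<^sub>F n in sequentially. 0 \<le> D n / real n ^ 6"
      by (simp add: D_def)
    show "\<forall>\<^sub>F n in sequentially. D n / real n ^ 6 \<le> 15 * (real (N n) / real n) ^ 5 * (1 / real n)"
    proof (rule eventually_mono [OF eventually_gt_at_top [of 0]])
      fix n :: nat assume n: "0 < n"
      have "D n \<le> 15 * real (N n) ^ 5"
        unfolding D_def N_def using of_nat_mono [OF card_degenerate_F7 [OF G [of n]], where 'a = real] by simp
      then have "D n / real n ^ 6 \<le> 15 * real (N n) ^ 5 / real n ^ 6"
        by (rule divide_right_mono) simp
      also have "\<dots> = 15 * (real (N n) / real n) ^ 5 * (1 / real n)"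
        by (simp add: power_divide power_numeral_reduce)
      finally show "D n / real n ^ 6 \<le> 15 * (real (N n) / real n) ^ 5 * (1 / real n)" .
    qed
    have "(\<lambda>n. 15 * (real (N n) / real n) ^ 5 * (1 / real n)) \<longlonglongrightarrow> 15 * 1 ^ 5 * 0"
      by (intro tendsto_intros N lim_const_over_n)
    then show "(\<lambda>n. 15 * (real (N n) / real n) ^ 5 * (1 / real n)) \<longlonglongrightarrow> 0"
      by simp
  qed simp
  have C: "(\<lambda>n. real (N n choose 6) / real n ^ 6) \<longlonglongrightarrow> 1 / 720"
  proof -
    have "(\<lambda>n. real (N n choose 6) / real (N n) ^ 6 * (real (N n) / real n) ^ 6) \<longlonglongrightarrow> 1 / 720 * 1 ^ 6"
      by (intro tendsto_intros N filterlim_compose [OF tendsto_choose_6 N_at_top])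
    moreover have "\<forall>\<^sub>F n in sequentially. 0 < N n"
      using N_at_top eventually_gt_at_top [of 0] unfolding filterlim_iff by blast
    then have "\<forall>\<^sub>F n in sequentially. real (N n choose 6) / real (N n) ^ 6 * (real (N n) / real n) ^ 6 =
        real (N n choose 6) / real n ^ 6"
      by (rule eventually_mono) (simp add: power_divide)
    ultimately have "(\<lambda>n. real (N n choose 6) / real n ^ 6) \<longlonglongrightarrow> 1 / 720 * 1 ^ 6"
      by (rule Lim_transform_eventually)
    then show ?thesis
      by simp
  qed
  have "(\<lambda>n. (3 * (L n / real n ^ 6) - D n / real n ^ 6) / 720 / (real (N n choose 6) / real n ^ 6)) \<longlonglongrightarrow>
      (3 * leaf_total {..<9} x b9 - 0) / 720 / (1 / 720)"
    by (intro tendsto_intros L D C) simp_all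
  then have "(\<lambda>n. (3 * (L n / real n ^ 6) - D n / real n ^ 6) / 720 / (real (N n choose 6) / real n ^ 6)) \<longlonglongrightarrow>
      3 * leaf_total {..<9} x b9"
    by simp
  moreover have "\<forall>\<^sub>F n in sequentially. (3 * (L n / real n ^ 6) - D n / real n ^ 6) / 720 / (real (N n choose 6) / real n ^ 6) =
      density F7 (G n)"
  proof (rule eventually_mono [OF eventually_gt_at_top [of 0]])
    fix n :: nat assume n: "0 < n"
    have "(3 * (L n / real n ^ 6) - D n / real n ^ 6) / 720 / (real (N n choose 6) / real n ^ 6) =
       ((3 * L n - D n) / real n ^ 6) / 720 / (real (N n choose 6) / real n ^ 6)"
      by (simp add: diff_divide_distrib)
    also have "\<dots> = (3 * L n - D n) / 720 / real (N n choose 6)"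
      using n by simp
    also have "\<dots> = density F7 (G n)"
      unfolding density_F7_eq [OF G] L_def D_def N_def ..
    finally show "(3 * (L n / real n ^ 6) - D n / real n ^ 6) / 720 / (real (N n choose 6) / real n ^ 6) = density F7 (G n)" .
  qed
  ultimately show ?thesis
    unfolding G_def [symmetric] by (rule Lim_transform_eventually)
qed

text \<open>Residue classes modulo 9 provide disjoint parts of every prescribed size.\<close>

lemma exists_blowup_sequence:
  assumes "\<And>i. i < 9 \<Longrightarrow> 0 \<le> x i"
  obtains P :: "nat \<Rightarrow> nat \<Rightarrow> nat set" where "\<And>n. blowup_parts B9 (P n)"
    "\<And>i. i < 9 \<Longrightarrow> (\<lambda>n. real (card (P n i)) / real n) \<longlonglongrightarrow> x i"
proof (rule that [of "\<lambda>n i. (\<lambda>k. i + 9 * k) ` {..<nat \<lfloor>x i * real n\<rfloor>}"])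
  fix n
  have "(\<lambda>k. i + 9 * k) ` A \<inter> (\<lambda>k. j + 9 * k) ` B = {}" if "i < 9" "j < 9" "i \<noteq> j" for i j :: nat and A B
  proof -
    have "i + 9 * k \<noteq> j + 9 * l" for k l
      using that by presburger
    then show ?thesis by blast
  qed
  then show "blowup_parts B9 (\<lambda>i. (\<lambda>k. i + 9 * k) ` {..<nat \<lfloor>x i * real n\<rfloor>})"
    by (simp add: blowup_parts_def disjoint_family_on_def verts_B9)
next
  fix i :: nat assume i: "i < 9"
  have "(\<lambda>n. real (nat \<lfloor>x i * real n\<rfloor>) / real n) \<longlonglongrightarrow> x i"
  proof (rule tendsto_sandwich)
    show "\<forall>\<^sub>F n in sequentially. x i - 1 / real n \<le> real (nat \<lfloor>x i * real n\<rfloor>) / real n"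
    proof (rule eventually_mono [OF eventually_gt_at_top [of 0]])
      fix n :: nat assume "0 < n"
      moreover have "x i * real n - 1 \<le> real (nat \<lfloor>x i * real n\<rfloor>)"
        by linarith
      then have "(x i * real n - 1) / real n \<le> real (nat \<lfloor>x i * real n\<rfloor>) / real n"
        by (rule divide_right_mono) simp
      ultimately show "x i - 1 / real n \<le> real (nat \<lfloor>x i * real n\<rfloor>) / real n"
        by (simp add: diff_divide_distrib)
    qed
    show "\<forall>\<^sub>F n in sequentially. real (nat \<lfloor>x i * real n\<rfloor>) / real n \<le> x i"
    proof (rule eventually_mono [OF eventually_gt_at_top [of 0]])
      fix n :: nat assume "0 < n"
      moreover have "real (nat \<lfloor>x i * real n\<rfloor>) \<le> x i * real n"
        using assms [OF i] by simp
      ultimately show "real (nat \<lfloor>x i * real n\<rfloor>) / real n \<le> x i"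
        by (simp add: field_simps)
    qed
    have "(\<lambda>n. x i - 1 / real n) \<longlonglongrightarrow> x i - 0"
      by (intro tendsto_intros lim_const_over_n)
    then show "(\<lambda>n. x i - 1 / real n) \<longlonglongrightarrow> x i"
      by simp
  qed simp
  then show "(\<lambda>n. real (card ((\<lambda>k. i + 9 * k) ` {..<nat \<lfloor>x i * real n\<rfloor>})) / real n) \<longlonglongrightarrow> x i"
    by (simp add: card_image inj_on_def)
qed

theorem limit_density_F7_B9:
  assumes "x \<in> std_simplex 9"
  shows "limit_density F7 B9 x = 3 * leaf_total {..<9} x b9"
  unfolding limit_density_def
proof (rule the_equality)
  have x: "\<And>i. i < 9 \<Longrightarrow> 0 \<le> x i" "(\<Sum>i<9. x i) = 1"
    using assms by (auto simp: std_simplex_def)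
  show *: "\<forall>P :: nat \<Rightarrow> nat \<Rightarrow> nat set. (\<forall>n. blowup_parts B9 (P n)) \<longrightarrow>
     (\<forall>i\<in>verts B9. (\<lambda>n. real (card (P n i)) / real n) \<longlonglongrightarrow> x i) \<longrightarrow>
     (\<lambda>n. density F7 (blowup B9 (P n))) \<longlonglongrightarrow> 3 * leaf_total {..<9} x b9"
    using tendsto_density_blowup_B9 [OF _ _ x(2)] by (auto simp: verts_B9)
  fix L
  assume L: "\<forall>P :: nat \<Rightarrow> nat \<Rightarrow> nat set. (\<forall>n. blowup_parts B9 (P n)) \<longrightarrow>
     (\<forall>i\<in>verts B9. (\<lambda>n. real (card (P n i)) / real n) \<longlonglongrightarrow> x i) \<longrightarrow>
     (\<lambda>n. density F7 (blowup B9 (P n))) \<longlonglongrightarrow> L"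
  obtain P :: "nat \<Rightarrow> nat \<Rightarrow> nat set" where P: "\<And>n. blowup_parts B9 (P n)"
    "\<And>i. i < 9 \<Longrightarrow> (\<lambda>n. real (card (P n i)) / real n) \<longlonglongrightarrow> x i"
    using exists_blowup_sequence [of x] x(1) by blast
  have "\<forall>i\<in>verts B9. (\<lambda>n. real (card (P n i)) / real n) \<longlonglongrightarrow> x i"
    using P(2) by (simp add: verts_B9)
  then have "(\<lambda>n. density F7 (blowup B9 (P n))) \<longlonglongrightarrow> L"
    "(\<lambda>n. density F7 (blowup B9 (P n))) \<longlonglongrightarrow> 3 * leaf_total {..<9} x b9"
    using L * P(1) by blast+
  then show "L = 3 * leaf_total {..<9} x b9"
    by (rule LIMSEQ_unique)
qed

section \<open>The limit density and its maximiser\<close>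

lemma F7_sets_subset: "F7_sets G \<subseteq> Pow (verts G)"
  by (auto simp: F7_sets_def)

lemma finite_densities_F7: "finite {density F7 G | G :: nat pattern. is_graph G \<and> card (verts G) = n}"
proof (rule finite_subset)
  show "{density F7 G | G :: nat pattern. is_graph G \<and> card (verts G) = n} \<subseteq> (\<lambda>k. real k / real (n choose 6)) ` {..2 ^ n}"
  proof clarify
    fix G :: "nat pattern" assume G: "is_graph G" "n = card (verts G)"
    have "card (F7_sets G) \<le> card (Pow (verts G))"
      using G F7_sets_subset [of G] by (intro card_mono) (simp_all add: is_graph_def)
    then show "density F7 G \<in> (\<lambda>k. real k / real (card (verts G) choose 6)) ` {..2 ^ card (verts G)}"
      using G by (auto simp: density_F7 card_Pow is_graph_def)
  qed
qed simp

lemma density_le_max_density: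
  fixes G :: "nat pattern"
  assumes "is_graph G"
  shows "density F7 G \<le> max_density F7 (card (verts G))"
  unfolding max_density_def using assms by (intro Max_ge finite_densities_F7) blast

lemma max_density_le:
  assumes "\<And>G :: nat pattern. is_graph G \<Longrightarrow> card (verts G) = n \<Longrightarrow> density F7 G \<le> c"
  shows "max_density F7 n \<le> c"
proof -
  have "is_graph ({..<n}, {})"
    by (simp add: is_graph_def)
  then have "{density F7 G | G :: nat pattern. is_graph G \<and> card (verts G) = n} \<noteq> {}"
    by (metis (mono_tags, lifting) Collect_empty_eq card_lessThan fst_conv)
  then show ?thesis
    unfolding max_density_def using assms by (subst Max_le_iff [OF finite_densities_F7]) auto
qed

lemma leaf_total_graph_le:
  assumes "is_graph G"
  shows "leaf_total (verts G) (\<lambda>_. 1) (adj G) \<le> 160 / 2187 * real (card (verts G)) ^ 6"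
proof (cases "card (verts G) = 0")
  case True
  then have "verts G = {}"
    using assms by (simp add: is_graph_def)
  then show ?thesis
    by (simp add: leaf_total_def)
next
  case False
  then show ?thesis
    using leaf_total_le [of "verts G" "\<lambda>_. 1" "adj G"] simple_adjacency_adj [OF assms] assms
    by (simp add: is_graph_def)
qed

lemma density_F7_le:
  assumes "is_graph G" "card (verts G) = n"
  shows "density F7 G \<le> 160 / 729 / 720 / (real (n choose 6) / real n ^ 6)"
proof -
  have "density F7 G \<le> (3 * leaf_total (verts G) (\<lambda>_. 1) (adj G)) / 720 / real (n choose 6)"
    unfolding density_F7_eq [OF assms(1)] assms(2) by (intro divide_right_mono) auto
  also have "\<dots> \<le> (3 * (160 / 2187 * real n ^ 6)) / 720 / real (n choose 6)"
    using leaf_total_graph_le [OF assms(1)] unfolding assms(2) by (intro divide_right_mono mult_left_mono) auto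
  finally show ?thesis
    by simp
qed

lemma leaf_total_b9_uniform: "leaf_total {..<9} (\<lambda>_. c) b9 = 38880 * c ^ 6"
  using leaf_total_scale [of "{..<9}" c "\<lambda>_. 1" b9] leaf_total_b9 by simp

text \<open>
  The upper bound is the identity; the blowups on the residue classes modulo 9 give the lower
  bound for every \<open>n\<close>.
\<close>

theorem max_density_F7_tendsto: "(\<lambda>n. max_density F7 n) \<longlonglongrightarrow> 160 / 729"
proof (rule tendsto_sandwich)
  define P where "P n i = {v. v < n \<and> v mod 9 = i}" for n i :: nat
  have P: "blowup_parts B9 (P n)" for n
    by (auto simp: blowup_parts_def disjoint_family_on_def P_def)
  have card_P: "card (P n i) = (n + 8 - i) div 9" if "i < 9" for n i
  proof -
    have "P n i = (\<lambda>k. i + 9 * k) ` {..<(n + 8 - i) div 9}"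
    proof (intro equalityI subsetI)
      fix v assume "v \<in> P n i"
      then have v: "v = i + 9 * (v div 9)" "v < n"
        unfolding P_def using mod_mult_div_eq [of v 9] by auto
      then have "9 * (v div 9) + i + 1 \<le> n"
        by linarith
      then have "Suc (v div 9) * 9 \<le> n + 8 - i"
        by simp
      then have "v div 9 < (n + 8 - i) div 9"
        unfolding Suc_le_eq [symmetric] by (simp only: less_eq_div_iff_mult_less_eq)
      then show "v \<in> (\<lambda>k. i + 9 * k) ` {..<(n + 8 - i) div 9}"
        using v(1) by blast
    next
      fix v assume "v \<in> (\<lambda>k. i + 9 * k) ` {..<(n + 8 - i) div 9}"
      then obtain k where k: "v = i + 9 * k" "Suc k \<le> (n + 8 - i) div 9"
        by auto
      then have "Suc k * 9 \<le> n + 8 - i"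
        by (simp only: less_eq_div_iff_mult_less_eq zero_less_numeral)
      then have "9 * k + 9 \<le> n + 8 - i"
        by simp
      then have "v < n"
        using k(1) that by arith
      then show "v \<in> P n i"
        unfolding P_def using that k(1) by simp
    qed
    then show ?thesis
      by (simp add: card_image inj_on_def)
  qed
  have lim: "(\<lambda>n. real (card (P n i)) / real n) \<longlonglongrightarrow> 1 / 9" if i: "i < 9" for i
  proof (rule tendsto_sandwich)
    have b: "real n / 9 - 1 \<le> real (card (P n i))" "real (card (P n i)) \<le> real n / 9 + 1" for n
    proof -
      have "n \<le> 9 * card (P n i) + 9" "9 * card (P n i) \<le> n + 9"
        unfolding card_P [OF i]
        using i times_div_less_eq_dividend [of 9 "n + 8 - i"] dividend_less_times_div [of 9 "n + 8 - i"] by linarith+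
      then show "real n / 9 - 1 \<le> real (card (P n i))" "real (card (P n i)) \<le> real n / 9 + 1"
        by linarith+
    qed
    show "\<forall>\<^sub>F n in sequentially. 1 / 9 - 1 / real n \<le> real (card (P n i)) / real n"
    proof (rule eventually_mono [OF eventually_gt_at_top [of 0]])
      fix n :: nat assume "0 < n"
      then show "1 / 9 - 1 / real n \<le> real (card (P n i)) / real n"
        using divide_right_mono [OF b(1) [of n], of "real n"] by (simp add: diff_divide_distrib)
    qed
    show "\<forall>\<^sub>F n in sequentially. real (card (P n i)) / real n \<le> 1 / 9 + 1 / real n"
    proof (rule eventually_mono [OF eventually_gt_at_top [of 0]])
      fix n :: nat assume "0 < n"
      then show "real (card (P n i)) / real n \<le> 1 / 9 + 1 / real n"
        using divide_right_mono [OF b(2) [of n], of "real n"] by (simp add: add_divide_distrib)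
    qed
    have "(\<lambda>n. 1 / 9 - 1 / real n) \<longlonglongrightarrow> 1 / 9 - 0" "(\<lambda>n. 1 / 9 + 1 / real n) \<longlonglongrightarrow> 1 / 9 + 0"
      by (intro tendsto_intros lim_const_over_n)+
    then show "(\<lambda>n. 1 / 9 - 1 / real n) \<longlonglongrightarrow> 1 / 9" "(\<lambda>n. 1 / 9 + 1 / real n) \<longlonglongrightarrow> 1 / 9"
      by simp_all
  qed
  have "(\<lambda>n. density F7 (blowup B9 (P n))) \<longlonglongrightarrow> 3 * leaf_total {..<9} (\<lambda>_. 1 / 9) b9"
    by (rule tendsto_density_blowup_B9 [OF P lim]) auto
  then show "(\<lambda>n. density F7 (blowup B9 (P n))) \<longlonglongrightarrow> 160 / 729"
    by (simp add: leaf_total_b9_uniform power_divide)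
  have "verts (blowup B9 (P n)) = {..<n}" for n
    unfolding verts_blowup_B9 by (auto simp: P_def)
  then have "density F7 (blowup B9 (P n)) \<le> max_density F7 n" for n
    using density_le_max_density [OF is_graph_blowup_B9 [OF P], of n] by simp
  then show "\<forall>\<^sub>F n in sequentially. density F7 (blowup B9 (P n)) \<le> max_density F7 n"
    by simp
  show "\<forall>\<^sub>F n in sequentially. max_density F7 n \<le> 160 / 729 / 720 / (real (n choose 6) / real n ^ 6)"
    by (intro always_eventually allI max_density_le density_F7_le)
  have "(\<lambda>n. 160 / 729 / 720 / (real (n choose 6) / real n ^ 6)) \<longlonglongrightarrow> 160 / 729 / 720 / (1 / 720)"
    by (intro tendsto_intros tendsto_choose_6) simp
  then show "(\<lambda>n. 160 / 729 / 720 / (real (n choose 6) / real n ^ 6)) \<longlonglongrightarrow> 160 / 729"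
    by simp
qed

text \<open>
  Equality forces all forms of lists in the support to vanish.  A leaf pair in the support then
  yields an induced \<open>3K\<^sub>2\<close> in the support: by \<open>X = 2 Z\<close> there is
  a vertex attached to the isolated vertex only.  Every vertex of the pattern is properly
  attached to it, so \<open>parts_balanced\<close> applies without error terms, and nine parts
  of positive weight on nine vertices are singletons.
\<close>

theorem leaf_total_b9_unique:
  assumes w: "\<And>i. i < 9 \<Longrightarrow> 0 \<le> w i" and sum1: "(\<Sum>i<9. w i) = 1"
    and tight: "leaf_total {..<9} w b9 = 160 / 2187" and i: "i < 9"
  shows "w i = 1 / 9"
proof -
  let ?V = "{..<9::nat}"
  have wV: "\<And>x. x \<in> ?V \<Longrightarrow> 0 \<le> w x" using w by simp
  have "(\<Sum>t\<in>tup ?V 5. weight w t * gram_form ?V w b9 t) = 0"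
    using slack_identity [of ?V w b9] sum_slack7_nonneg [of ?V w b9] b9.simple_adjacency_axioms
      sum_gram_form_nonneg [of ?V w b9] wV sum1 tight by simp
  then have all0: "weight w t * gram_form ?V w b9 t = 0" if "t \<in> tup ?V 5" for t
    using that by (subst (asm) sum_nonneg_eq_0_iff)
      (auto intro!: mult_nonneg_nonneg gram_form_nonneg intro: weight_nonneg [where w = w, OF wV])
  have gram0: "gram_form ?V w b9 t = 0" if "length t = 5" "\<And>x. x \<in> set t \<Longrightarrow> x < 9 \<and> 0 < w x" for t
  proof -
    have "0 < weight w t"
      using that by (intro weight_pos) auto
    then show ?thesis
      using all0 [of t] that by (auto simp: tup_def)
  qed
  have "\<exists>t\<in>tup ?V 5. \<exists>x\<in>?V. weight w t * w x * of_bool (leaf b9 t x) \<noteq> 0"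
  proof (rule ccontr)
    assume "\<not> ?thesis"
    then have "leaf_total ?V w b9 = 0"
      unfolding leaf_total_def by (intro sum.neutral ballI) blast
    with tight show False by simp
  qed
  then obtain t x where t: "t \<in> tup ?V 5" "x < 9" "weight w t \<noteq> 0" "w x \<noteq> 0" "leaf b9 t x"
    by auto
  then have supp: "y < 9 \<and> 0 < w y" if "y \<in> set (x # t)" for y
    using that w [of y] weight_pos_imp [of w t y] by (auto simp: tup_def order_less_le subset_iff)
  obtain zs where zs: "mset zs = mset (x # t)" "F7_pattern b9 zs"
    using b9.leaf_imp_F7_pattern [OF t(5)] t(1) by (auto simp: tup_def)
  then have supp_zs: "y < 9 \<and> 0 < w y" if "y \<in> set zs" for y
    using supp that mset_eq_setD [OF zs(1)] by blast
  obtain v0 v1 v2 v3 v4 v5 where v: "zs = [v0, v1, v2, v3, v4, v5]" and e: "b9 v0 v2" "b9 v0 v4" "b9 v1 v5"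
    "\<not> b9 v0 v1" "\<not> b9 v0 v3" "\<not> b9 v0 v5" "\<not> b9 v1 v2" "\<not> b9 v1 v3" "\<not> b9 v1 v4"
    "\<not> b9 v2 v3" "\<not> b9 v2 v4" "\<not> b9 v2 v5" "\<not> b9 v3 v4" "\<not> b9 v3 v5" "\<not> b9 v4 v5"
    using b9.F7_patternD [OF zs(2)] by metis
  \<comment> \<open>Delete the leaf \<open>v4\<close> from the pattern: two edges and the isolated
    vertex \<open>v3\<close>.\<close>
  define t' where "t' = [v0, v2, v1, v5, v3]"
  have sym: "\<not> b9 v2 v1" "\<not> b9 v5 v3" "\<not> b9 v5 v4"
    using e b9.adj_sym by blast+
  have key: "type_key b9 t' = (4, 4)"
    unfolding t'_def b9.type_key_eq_bits by (simp add: e sym type_key_bits_def Let_def)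
  have sig: "signature b9 t' v4 = leaf_sig"
    unfolding t'_def b9.signature_eq_bits by (simp add: e sym signature_bits_def Let_def leaf_sig_def)
  define X Z where "X = (\<Sum>x\<in>{x\<in>?V. signature b9 t' x = leaf_sig}. w x)"
    and "Z = (\<Sum>x\<in>{x\<in>?V. signature b9 t' x = [1, 0, 0, 0]}. w x)"
  have g0: "gram_form ?V w b9 t' = 0"
    by (rule gram0) (use supp_zs in \<open>auto simp: t'_def v\<close>)
  \<comment> \<open>The form of \<open>t'\<close> vanishes, hence so do the squares that it
    contains.\<close>
  have "100 * (X - 2 * Z)\<^sup>2 \<le> 0"
    using gram_form_matching_vertex [OF _ key, of ?V w] unfolding g0 X_def Z_def distrib_left
    by (smt (verit) finite_lessThan zero_le_power2)
  then have "X = 2 * Z"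
    by simp
  moreover have "0 < X"
  proof -
    have "0 < w v4" "v4 < 9"
      using supp_zs by (auto simp: v)
    moreover have "w v4 \<le> X"
      unfolding X_def using \<open>v4 < 9\<close> sig w by (intro member_le_sum) auto
    ultimately show ?thesis by simp
  qed
  ultimately have "0 < Z"
    by simp
  then obtain z where z: "z < 9" "signature b9 t' z = [1, 0, 0, 0]" "0 < w z"
    unfolding Z_def by (metis (mono_tags, lifting) lessThan_iff mem_Collect_eq not_less sum_nonpos)
  have pend: "b9 v3 z \<and> \<not> b9 v0 z \<and> \<not> b9 v2 z \<and> \<not> b9 v1 z \<and> \<not> b9 v5 z"
    using z(2) unfolding t'_def b9.signature_eq_bits
    by (cases "b9 v0 z"; cases "b9 v1 z"; cases "b9 v2 z"; cases "b9 v3 z"; cases "b9 v5 z")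
      (simp_all add: e sym signature_bits_def Let_def)
  define \<rho> where "\<rho> = t' @ [z]"
  have \<rho>: "matching3 b9 \<rho>"
  proof -
    have s: "b9 v2 v0" "b9 v5 v1" "b9 z v3" "\<not> b9 v1 v0" "\<not> b9 v3 v0" "\<not> b9 v5 v0" "\<not> b9 v2 v1" "\<not> b9 v3 v1" 
      "\<not> b9 v3 v2" "\<not> b9 v5 v2" "\<not> b9 v5 v3" "\<not> b9 z v0" "\<not> b9 z v2" "\<not> b9 z v1" "\<not> b9 z v5"
      using e pend b9.adj_sym by blast+
    show ?thesis
      unfolding matching3_def all_less_6 \<rho>_def t'_def using e pend s b9.adj_irrefl by simp
  qed
  have supp_\<rho>: "y < 9 \<and> 0 < w y" if "y \<in> set \<rho>" for y
    using that supp_zs z by (auto simp: \<rho>_def t'_def v)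
  have len: "length \<rho> = 6"
    by (simp add: \<rho>_def t'_def)
  have attached: "\<exists>p. attached b9 \<rho> p y" if "y < 9" for y
  proof (rule ccontr)
    assume "\<not> ?thesis"
    from b9.slack7_bad_attachment [OF \<rho> this] have "1 \<le> slack7 b9 (\<rho> @ [y])" .
    moreover have "slack7 b9 (\<rho> @ [y]) = 0"
      using supp_\<rho> that len by (intro slack7_b9) (auto simp: tup_def)
    ultimately show False by simp
  qed
  have "{x \<in> ?V. \<not> (\<exists>p. attached b9 \<rho> p x)} = {}"
    using attached by blast
  then have stray: "stray_weight ?V w b9 \<rho> = 0"
    unfolding stray_weight_def by (simp only: sum.empty)
  have parts: "part_weight ?V w b9 \<rho> p = 1 / 9" if "p < 9" for p
  proof -
    have "gram_form ?V w b9 (del_at i \<rho>) \<le> 100 * 0\<^sup>2" if "i < 6" for i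
    proof -
      have "length (del_at i \<rho>) = 5"
        using that len by (simp add: del_at_def)
      then have "gram_form ?V w b9 (del_at i \<rho>) = 0"
        using supp_\<rho> set_del_at_subset [of i \<rho>] by (intro gram0) auto
      then show ?thesis by simp
    qed
    from b9.parts_balanced [OF finite_lessThan wV \<rho> order_refl this that]
    show ?thesis
      by (simp add: stray sum1)
  qed
  define f where "f p = (SOME y. y < 9 \<and> attached b9 \<rho> p y)" for p
  have f: "f p < 9 \<and> attached b9 \<rho> p (f p)" if p: "p < 9" for p
  proof -
    have "\<exists>y. y < 9 \<and> attached b9 \<rho> p y"
    proof (rule ccontr)
      assume "\<not> ?thesis"
      then have "{x \<in> ?V. attached b9 \<rho> p x} = {}"
        by blast
      then have "part_weight ?V w b9 \<rho> p = 0"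
        unfolding part_weight_def by (simp only: sum.empty)
      then show False
        using parts [OF p] by simp
    qed
    then show ?thesis
      unfolding f_def by (rule someI_ex)
  qed
  have inj: "inj_on f ?V"
    using f attached_unique [of b9 \<rho>] by (intro inj_onI) (metis lessThan_iff)
  have "f ` ?V = ?V"
    using f by (intro endo_inj_surj inj) auto
  then obtain p where p: "p < 9" "i = f p"
    using i by (metis imageE lessThan_iff)
  have "{x \<in> ?V. attached b9 \<rho> p x} = {i}"
  proof (intro equalityI subsetI)
    fix y assume y: "y \<in> {x \<in> ?V. attached b9 \<rho> p x}"
    then obtain q where q: "q < 9" "y = f q"
      using \<open>f ` ?V = ?V\<close> by (metis (no_types, lifting) imageE lessThan_iff mem_Collect_eq)
    then have "q = p"
      using y f attached_unique [of b9 \<rho>] by blast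
    then show "y \<in> {i}"
      using q p by simp
  qed (use f p in auto)
  then have "part_weight ?V w b9 \<rho> p = w i"
    unfolding part_weight_def by simp
  then show ?thesis
    using parts [OF p(1)] by simp
qed

theorem unique_maximiser_F7_B9: "unique_maximiser_up_to_aut F7 9 B9 (\<lambda>i. 1 / 9)"
proof -
  have le: "limit_density F7 B9 y \<le> 160 / 729" if "y \<in> std_simplex 9" for y
  proof -
    have "leaf_total {..<9} y b9 \<le> 160 / 2187 * (\<Sum>i<9. y i) ^ 6"
      using that by (intro leaf_total_le b9.simple_adjacency_axioms) (auto simp: std_simplex_def)
    then show ?thesis
      using that by (simp add: limit_density_F7_B9 std_simplex_def)
  qed
  have u: "(\<lambda>i. 1 / 9) \<in> std_simplex 9"
    by (simp add: std_simplex_def)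
  have eq: "limit_density F7 B9 (\<lambda>i. 1 / 9) = 160 / 729"
    unfolding limit_density_F7_B9 [OF u] leaf_total_b9_uniform by (simp add: power_divide)
  have "maximiser F7 9 B9 (\<lambda>i. 1 / 9)"
    using le u unfolding maximiser_def is_arg_max_def eq by (auto simp: not_less)
  moreover have "\<exists>\<sigma>. automorphism \<sigma> B9 \<and> (\<forall>i<9. y i = 1 / 9)" if y: "maximiser F7 9 B9 y" for y
  proof -
    have ys: "y \<in> std_simplex 9" "limit_density F7 B9 y = 160 / 729"
      using y u eq le [of y] by (auto simp: maximiser_def is_arg_max_def not_less intro: antisym)
    then have "leaf_total {..<9} y b9 = 160 / 2187"
      by (simp add: limit_density_F7_B9)
    then have "\<forall>i<9. y i = 1 / 9"
      using leaf_total_b9_unique [of y] ys(1) by (auto simp: std_simplex_def)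
    moreover have "automorphism id B9"
      by (simp add: automorphism_def is_iso_def)
    ultimately show ?thesis
      by blast
  qed
  ultimately show ?thesis
    unfolding unique_maximiser_up_to_aut_def by blast
qed

section \<open>Comparing a graph with a blowup on the same parts\<close>

definition quad :: "nat \<Rightarrow> (nat \<Rightarrow> nat \<Rightarrow> real) \<Rightarrow> (nat \<Rightarrow> real) \<Rightarrow> real" where
  "quad m E y = (\<Sum>i<m. \<Sum>j<m. y i * y j * E i j)"

lemma quad_add:
  "quad m E (\<lambda>i. y i + l * z i) =
     quad m E y + l * (\<Sum>i<m. \<Sum>j<m. (y i * z j + z i * y j) * E i j) + l\<^sup>2 * quad m E z"
  unfolding quad_def sum_distrib_left sum.distrib [symmetric]
  by (intro sum.cong refl) (simp add: algebra_simps power2_eq_square)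

text \<open>
  For a positive semidefinite form, a vector on which the form vanishes lies in the radical.
\<close>

lemma quad_kernel:
  assumes psd: "\<And>y. 0 \<le> quad m E y" and ker: "quad m E u = 0"
  shows "quad m E (\<lambda>i. v i + c * u i) = quad m E v"
proof -
  define b where "b = (\<Sum>i<m. \<Sum>j<m. (v i * u j + u i * v j) * E i j)"
  have eq: "quad m E (\<lambda>i. v i + l * u i) = quad m E v + l * b" for l
    unfolding quad_add b_def using ker by simp
  have "b = 0"
  proof (rule ccontr)
    assume b: "b \<noteq> 0"
    \<comment> \<open>At this argument the affine function \<open>quad m E v + l * b\<close> would
      have the value \<open>- 1\<close>.\<close>
    have "0 \<le> quad m E v + (- (quad m E v + 1) / b) * b"
      using psd [of "\<lambda>i. v i + (- (quad m E v + 1) / b) * u i"] unfolding eq .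
    with b show False by simp
  qed
  then show ?thesis
    using eq [of c] by simp
qed

text \<open>
  Expand the inequality \<open>0 \<le> quad m E (y + l z)\<close>.  The free parameter
  \<open>l\<close> balances the two error terms, as in the Cauchy-Schwarz inequality.
\<close>

lemma quad_add_ge:
  assumes psd: "\<And>y. 0 \<le> quad m E y" and l: "0 < l"
  shows "quad m E y - quad m E y / l - l * quad m E z \<le> quad m E (\<lambda>i. y i + z i)"
proof -
  define b where "b = (\<Sum>i<m. \<Sum>j<m. (y i * z j + z i * y j) * E i j)"
  have "0 \<le> quad m E y + l * b + l\<^sup>2 * quad m E z"
    using psd [of "\<lambda>i. y i + l * z i"] unfolding quad_add b_def .
  then have "0 \<le> (quad m E y + l * b + l\<^sup>2 * quad m E z) / l"
    using l by simp
  then have "0 \<le> quad m E y / l + b + l * quad m E z"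
    using l by (simp add: add_divide_distrib power2_eq_square)
  moreover have "quad m E (\<lambda>i. y i + z i) = quad m E y + b + quad m E z"
    using quad_add [of m E y 1 z] by (simp add: b_def)
  moreover have "0 \<le> quad m E z"
    by (rule psd)
  ultimately show ?thesis
    by linarith
qed

lemma quad_le:
  assumes "\<And>i. i < m \<Longrightarrow> \<bar>y i\<bar> \<le> d"
  shows "quad m E y \<le> d\<^sup>2 * (\<Sum>i<m. \<Sum>j<m. \<bar>E i j\<bar>)"
  unfolding quad_def sum_distrib_left
proof (intro sum_mono)
  fix i j assume ij: "i \<in> {..<m}" "j \<in> {..<m}"
  then have "0 \<le> d"
    using assms [of i] by simp
  have "y i * y j * E i j \<le> \<bar>y i\<bar> * \<bar>y j\<bar> * \<bar>E i j\<bar>"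
    by (metis abs_ge_self abs_mult)
  also have "\<dots> \<le> d * d * \<bar>E i j\<bar>"
    using assms ij \<open>0 \<le> d\<close> by (intro mult_mono) auto
  finally show "y i * y j * E i j \<le> d\<^sup>2 * \<bar>E i j\<bar>"
    by (simp add: power2_eq_square)
qed

definition entries_sum :: "int list list \<Rightarrow> real" where
  "entries_sum G = (\<Sum>i<length G. \<Sum>j<length G. \<bar>real_of_int (entry G i j)\<bar>)"

definition gram_bound :: real where
  "gram_bound = Max (insert 1 ((\<lambda>(k, ss, G). entries_sum G) ` set certificate))"

lemma gram_bound_ge: "1 \<le> gram_bound" "map_of certificate k = Some (ss, G) \<Longrightarrow> entries_sum G \<le> gram_bound"
proof -
  show "1 \<le> gram_bound"
    unfolding gram_bound_def by (intro Max_ge) auto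
  assume "map_of certificate k = Some (ss, G)"
  then have "(k, ss, G) \<in> set certificate"
    by (rule map_of_SomeD)
  then show "entries_sum G \<le> gram_bound"
    unfolding gram_bound_def by (intro Max_ge) (auto simp: image_iff intro!: bexI [of _ "(k, ss, G)"])
qed

lemma gram_form_quad:
  assumes "finite V" "map_of certificate (type_key a t) = Some (ss, G)"
  shows "gram_form V w a t = quad (length G) (\<lambda>i j. real_of_int (entry G i j))
     (\<lambda>i. \<Sum>x\<in>{x\<in>V. position ss (signature a t x) = i}. w x)"
  unfolding quad_def by (rule gram_form_eq [OF assms refl])

lemma certificate_quad_psd:
  assumes "map_of certificate k = Some (ss, G)"
  shows "0 \<le> quad (length G) (\<lambda>i j. real_of_int (entry G i j)) y"
  unfolding quad_def by (rule certificate_psd [OF assms])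

text \<open>The constant vector lies in the radical, so only the squared deviation from it matters.\<close>

lemma gram_form_b9_near_uniform:
  assumes t: "t \<in> tup {..<9} 5" and w: "\<And>p. p < 9 \<Longrightarrow> \<bar>w p - c\<bar> \<le> d"
  shows "gram_form {..<9} w b9 t \<le> 81 * gram_bound * d\<^sup>2"
proof (cases "map_of certificate (type_key b9 t)")
  case None
  then have "gram_form {..<9} w b9 t = 0"
    by (simp add: gram_form_def gram_coef_def)
  then show ?thesis
    using gram_bound_ge(1) by simp
next
  case (Some s)
  then obtain ss G where *: "map_of certificate (type_key b9 t) = Some (ss, G)"
    by (cases s) auto
  define E where "E i j = real_of_int (entry G i j)" for i j
  define cls where "cls i = {x\<in>{..<9}. position ss (signature b9 t x) = i}" for i
  define u where "u i = (\<Sum>x\<in>cls i. 1::real)" for i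
  define v where "v i = (\<Sum>x\<in>cls i. w x - c)" for i
  have d: "0 \<le> d"
    using w [of 0] by simp
  have psd: "0 \<le> quad (length G) E y" for y
    unfolding E_def by (rule certificate_quad_psd [OF *])
  have "gram_form {..<9} w b9 t = quad (length G) E (\<lambda>i. v i + c * u i)"
    unfolding gram_form_quad [OF finite_lessThan *] E_def v_def u_def cls_def sum_distrib_left sum.distrib [symmetric]
    by simp
  also have "\<dots> = quad (length G) E v"
  proof (rule quad_kernel [OF psd])
    show "quad (length G) E u = 0"
      using gram_form_b9 [OF t] unfolding gram_form_quad [OF finite_lessThan *] E_def u_def cls_def .
  qed
  also have "\<dots> \<le> (9 * d)\<^sup>2 * (\<Sum>i<length G. \<Sum>j<length G. \<bar>E i j\<bar>)"
  proof (rule quad_le)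
    fix i
    have "\<bar>v i\<bar> \<le> (\<Sum>x\<in>cls i. \<bar>w x - c\<bar>)"
      unfolding v_def by (rule sum_abs)
    also have "\<dots> \<le> (\<Sum>x\<in>{..<9}. \<bar>w x - c\<bar>)"
      by (rule sum_mono2) (auto simp: cls_def)
    also have "\<dots> \<le> (\<Sum>x\<in>{..<9::nat}. d)"
      using w by (intro sum_mono) auto
    finally show "\<bar>v i\<bar> \<le> 9 * d"
      by simp
  qed
  also have "\<dots> = 81 * d\<^sup>2 * entries_sum G"
    by (simp add: entries_sum_def E_def power_mult_distrib)
  also have "\<dots> \<le> 81 * d\<^sup>2 * gram_bound"
    using gram_bound_ge(2) [OF *] by (intro mult_left_mono) auto
  finally show ?thesis
    by (simp add: mult_ac)
qed

lemma gram_form_pullback: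
  assumes V: "finite V" and B: "finite B" and p: "p ` V \<subseteq> B" and pb: "pulls_back V p a h" and t: "set t \<subseteq> V"
  shows "gram_form V (\<lambda>_. 1) a t = gram_form B (\<lambda>i. real (card {x \<in> V. p x = i})) h (map p t)"
proof -
  have "gram_form V (\<lambda>_. 1) a t = (\<Sum>x\<in>V. \<Sum>y\<in>V. real_of_int (gram_coef h (map p t) (p x) (p y)))"
    unfolding gram_form_def using gram_coef_pullback [OF pb t] by (intro sum.cong refl) simp
  also have "\<dots> = (\<Sum>i\<in>B. real (card {x \<in> V. p x = i}) *
      (\<Sum>j\<in>B. real (card {x \<in> V. p x = j}) * real_of_int (gram_coef h (map p t) i j)))"
    using sum_fun_comp [OF V B p, of "\<lambda>j. real_of_int (gram_coef h (map p t) i j)" for i]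
      sum_fun_comp [OF V B p, of "\<lambda>i. \<Sum>y\<in>V. real_of_int (gram_coef h (map p t) i (p y))"] by simp
  finally show ?thesis
    unfolding gram_form_def by (simp add: sum_distrib_left mult_ac)
qed

definition wrong_at :: "'v set \<Rightarrow> ('v \<Rightarrow> 'v \<Rightarrow> bool) \<Rightarrow> ('v \<Rightarrow> 'v \<Rightarrow>
    bool) \<Rightarrow> 'v list \<Rightarrow> 'v set" where
  "wrong_at V a h t = {x \<in> V. \<exists>u\<in>set t. a u x \<noteq> h u x}"

definition agree_on :: "'v set \<Rightarrow> ('v \<Rightarrow> 'v \<Rightarrow> bool) \<Rightarrow> ('v \<Rightarrow> 'v \<Rightarrow>
    bool) \<Rightarrow> bool" where
  "agree_on S a h \<longleftrightarrow> (\<forall>x\<in>S. \<forall>y\<in>S. a x y \<longleftrightarrow> h x y)"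

lemma agree_on_pulls_back: "agree_on S a h \<longleftrightarrow> pulls_back S id a h"
  by (simp add: agree_on_def pulls_back_def)

text \<open>
  If the two graphs agree on \<open>t\<close>, then the vectors of their attachment numbers
  differ only by the vertices that are joined differently to \<open>t\<close>.  The form of
  \<open>h\<close> is at most of order \<open>d\<^sup>2\<close>, so the mixed term is at most of
  order \<open>d\<close> times the number of such vertices.
\<close>

lemma gram_form_agree_ge:
  assumes V: "finite V" and a: "simple_adjacency a" and h: "simple_adjacency h" and agree: "agree_on (set t) a h"
    and d: "0 < d" and small: "gram_form V (\<lambda>_. 1) h t \<le> 81 * gram_bound * d\<^sup>2"
  shows "gram_form V (\<lambda>_. 1) h t - 82 * gram_bound * d * real (card (wrong_at V a h t)) \<le> gram_form V (\<lambda>_. 1) a t"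
proof -
  have key: "type_key a t = type_key h t"
    using type_key_pullback [of "set t" id a h t] agree by (simp add: agree_on_pulls_back)
  have sig: "signature a t x = signature h t x" if "x \<in> V - wrong_at V a h t" for x
  proof -
    have e: "a u x = h u x \<and> a x u = h x u" if "u \<in> set t" for u
      using \<open>x \<in> V - wrong_at V a h t\<close> that simple_adjacency.adj_sym [OF a, of x u] simple_adjacency.adj_sym [OF h, of x u]
      by (auto simp: wrong_at_def)
    have "pulls_back (insert x (set t)) id a h"
      using agree e simple_adjacency.adj_irrefl [OF a] simple_adjacency.adj_irrefl [OF h]
      by (auto simp: pulls_back_def agree_on_def)
    from signature_pullback [OF this, of t x] show ?thesis
      by auto
  qed
  show ?thesis
  proof (cases "map_of certificate (type_key h t)")
    case None
    then show ?thesis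
      using key d gram_bound_ge(1) by (simp add: gram_form_def gram_coef_def)
  next
    case (Some s)
    then obtain ss G where *: "map_of certificate (type_key h t) = Some (ss, G)" "map_of certificate (type_key a t) = Some (ss, G)"
      unfolding key by (cases s) auto
    define E where "E i j = real_of_int (entry G i j)" for i j
    define A where "A i = {x\<in>V. position ss (signature a t x) = i}" for i
    define H where "H i = {x\<in>V. position ss (signature h t x) = i}" for i
    define y where "y i = real (card (H i))" for i
    define z where "z i = real (card (A i)) - real (card (H i))" for i
    define k where "k = card (wrong_at V a h t)"
    have fin: "finite (A i)" "finite (H i)" "finite (wrong_at V a h t)" for i
      using V by (simp_all add: A_def H_def wrong_at_def)
    have z: "\<bar>z i\<bar> \<le> real k" for i
    proof -
      have "A i \<subseteq> H i \<union> wrong_at V a h t" "H i \<subseteq> A i \<union> wrong_at V a h t"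
        using sig by (auto simp: A_def H_def)
      then have "card (A i) \<le> card (H i \<union> wrong_at V a h t)" "card (H i) \<le> card (A i \<union> wrong_at V a h t)"
        using fin by (auto intro!: card_mono)
      then have "card (A i) \<le> card (H i) + k" "card (H i) \<le> card (A i) + k"
        using card_Un_le [of "H i" "wrong_at V a h t"] card_Un_le [of "A i" "wrong_at V a h t"] unfolding k_def by linarith+
      then show ?thesis
        unfolding z_def by linarith
    qed
    have psd: "0 \<le> quad (length G) E y" for y
      unfolding E_def by (rule certificate_quad_psd [OF *(1)])
    have qh: "gram_form V (\<lambda>_. 1) h t = quad (length G) E y"
      unfolding gram_form_quad [OF V *(1)] E_def y_def H_def by simp
    have qa: "gram_form V (\<lambda>_. 1) a t = quad (length G) E (\<lambda>i. y i + z i)"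
      unfolding gram_form_quad [OF V *(2)] E_def y_def z_def A_def H_def by simp
    have qz: "quad (length G) E z \<le> (real k)\<^sup>2 * gram_bound"
    proof -
      have "quad (length G) E z \<le> (real k)\<^sup>2 * (\<Sum>i<length G. \<Sum>j<length G. \<bar>E i j\<bar>)"
        using z by (intro quad_le)
      also have "\<dots> \<le> (real k)\<^sup>2 * gram_bound"
        using gram_bound_ge(2) [OF *(1)] by (intro mult_left_mono) (auto simp: entries_sum_def E_def)
      finally show ?thesis .
    qed
    show ?thesis
    proof (cases "k = 0")
      case True
      then have "z i = 0" for i
        using z [of i] by simp
      then show ?thesis
        using True by (simp add: qa qh k_def)
    next
      case False
      \<comment> \<open>The two error terms of \<open>quad_add_ge\<close> become equal, up to
        constants, for this \<open>l\<close>.\<close>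
      define l where "l = d / real k"
      have l: "0 < l"
        using False d by (simp add: l_def)
      have "quad (length G) E y / l \<le> 81 * gram_bound * d\<^sup>2 / l"
        using small l unfolding qh by (intro divide_right_mono) auto
      also have "\<dots> = 81 * gram_bound * d * real k"
        using False d by (simp add: l_def power2_eq_square)
      finally have 1: "quad (length G) E y / l \<le> 81 * gram_bound * d * real k" .
      have "l * quad (length G) E z \<le> l * ((real k)\<^sup>2 * gram_bound)"
        using qz l by (intro mult_left_mono) auto
      also have "\<dots> = gram_bound * d * real k"
        using False by (simp add: l_def power2_eq_square)
      finally have 2: "l * quad (length G) E z \<le> gram_bound * d * real k" .
      show ?thesis
        using quad_add_ge [OF psd l, of y z] 1 2 unfolding qa qh k_def [symmetric] by linarith
    qed
  qed
qed

definition disagreement :: "'v set \<Rightarrow> ('v \<Rightarrow> 'v \<Rightarrow> bool) \<Rightarrow> ('v \<Rightarrow> 'v \<Rightarrow>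
    bool) \<Rightarrow> real" where
  "disagreement V a h = (\<Sum>x\<in>V. \<Sum>y\<in>V. of_bool (a x y \<noteq> h x y))"

lemma sum_wrong_at_le:
  assumes "finite V"
  shows "(\<Sum>t\<in>tup V (Suc k). real (card (wrong_at V a h t))) \<le> real (Suc k) * real (card V) ^ k * disagreement V a h"
proof -
  have "(\<Sum>t\<in>tup V (Suc k). real (card (wrong_at V a h t))) \<le>
    (\<Sum>t\<in>tup V (Suc k). \<Sum>i<Suc k. \<Sum>x\<in>V. of_bool (a (t ! i) x \<noteq> h (t ! i) x))"
  proof (rule sum_mono)
    fix t assume "t \<in> tup V (Suc k)"
    then have len: "length t = Suc k" by (simp add: tup_def)
    have "real (card (wrong_at V a h t)) = (\<Sum>x\<in>V. of_bool (\<exists>u\<in>set t. a u x \<noteq> h u x))"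
      using assms by (simp add: wrong_at_def Int_def)
    also have "\<dots> \<le> (\<Sum>x\<in>V. \<Sum>i<Suc k. of_bool (a (t ! i) x \<noteq> h (t ! i) x))"
    proof (rule sum_mono)
      fix x
      show "of_bool (\<exists>u\<in>set t. a u x \<noteq> h u x) \<le> (\<Sum>i<Suc k. of_bool (a (t ! i) x \<noteq> h (t ! i) x) :: real)"
      proof (cases "\<exists>u\<in>set t. a u x \<noteq> h u x")
        case True
        then obtain i where i: "i < Suc k" "a (t ! i) x \<noteq> h (t ! i) x"
          using len by (metis in_set_conv_nth)
        then have "of_bool (a (t ! i) x \<noteq> h (t ! i) x) \<le> (\<Sum>i<Suc k. of_bool (a (t ! i) x \<noteq> h (t ! i) x) :: real)"
          by (intro member_le_sum) auto
        with i show ?thesis by simp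
      next
        case False
        then show ?thesis by (simp add: sum_nonneg)
      qed
    qed
    also have "\<dots> = (\<Sum>i<Suc k. \<Sum>x\<in>V. of_bool (a (t ! i) x \<noteq> h (t ! i) x))"
      by (rule sum.swap)
    finally show "real (card (wrong_at V a h t)) \<le> (\<Sum>i<Suc k. \<Sum>x\<in>V. of_bool (a (t ! i) x \<noteq> h (t ! i) x))" .
  qed
  also have "\<dots> = (\<Sum>i<Suc k. \<Sum>t\<in>tup V (Suc k). \<Sum>x\<in>V. of_bool (a (t ! i) x \<noteq> h (t ! i) x))"
    by (rule sum.swap)
  also have "\<dots> = (\<Sum>i<Suc k. real (card V) ^ k * disagreement V a h)"
    unfolding disagreement_def by (intro sum.cong refl sum_tup_nth [OF assms, where F = "\<lambda>u. \<Sum>x\<in>V. of_bool (a u x \<noteq>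
        h u x)"]) simp
  finally show ?thesis
    by (simp add: mult.assoc)
qed

lemma card_disagreeing_tuples_le:
  assumes V: "finite V" and a: "simple_adjacency a" and h: "simple_adjacency h"
  shows "real (card {t \<in> tup V 5. \<not> agree_on (set t) a h}) \<le> 25 * real (card V) ^ 3 * disagreement V a h"
proof -
  have W: "0 \<le> disagreement V a h"
    unfolding disagreement_def by (intro sum_nonneg) auto
  have "real (card {t \<in> tup V 5. \<not> agree_on (set t) a h}) = (\<Sum>t\<in>tup V 5. of_bool (\<not> agree_on (set t) a h))"
    using V by (simp add: Int_def)
  also have "\<dots> \<le> (\<Sum>t\<in>tup V 5. \<Sum>i<5. \<Sum>j<5. of_bool (a (t ! j) (t ! i) \<noteq> h (t ! j) (t ! i)))"
  proof (rule sum_mono)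
    fix t assume "t \<in> tup V 5"
    then have len: "length t = 5" by (simp add: tup_def)
    show "of_bool (\<not> agree_on (set t) a h) \<le> (\<Sum>i<5. \<Sum>j<5. of_bool (a (t ! j) (t ! i) \<noteq> h (t ! j) (t ! i)) :: real)"
    proof (cases "agree_on (set t) a h")
      case True
      then show ?thesis by (simp add: sum_nonneg)
    next
      case False
      then obtain i j where ij: "i < 5" "j < 5" "a (t ! j) (t ! i) \<noteq> h (t ! j) (t ! i)"
        using len unfolding agree_on_def by (metis in_set_conv_nth)
      then have "1 \<le> (\<Sum>j<5. of_bool (a (t ! j) (t ! i) \<noteq> h (t ! j) (t ! i)) :: real)"
        using member_le_sum [of j "{..<5}" "\<lambda>j. of_bool (a (t ! j) (t ! i) \<noteq> h (t ! j) (t ! i)) :: real"] by simp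
      also have "\<dots> \<le> (\<Sum>i<5. \<Sum>j<5. of_bool (a (t ! j) (t ! i) \<noteq> h (t ! j) (t ! i)))"
        using ij by (intro member_le_sum [of i "{..<5}" "\<lambda>i. \<Sum>j<5. of_bool (a (t ! j) (t ! i) \<noteq> h (t ! j) (t ! i)) ::
            real"] sum_nonneg) auto
      finally show ?thesis
        using False by simp
    qed
  qed
  also have "\<dots> = (\<Sum>i<5. \<Sum>j<5. \<Sum>t\<in>tup V 5. of_bool (a (t ! j) (t ! i) \<noteq> h (t ! j) (t ! i)))"
    by (subst sum.swap, intro sum.cong refl, rule sum.swap)
  also have "\<dots> \<le> (\<Sum>i<(5::nat). \<Sum>j<(5::nat). real (card V) ^ 3 * disagreement V a h)"
  proof (intro sum_mono)
    fix i j assume ij: "i \<in> {..<5::nat}" "j \<in> {..<5::nat}"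
    define F where "F x y = (of_bool (a x y \<noteq> h x y) :: real)" for x y
    have sym: "F x y = F y x" for x y
      unfolding F_def using simple_adjacency.adj_sym [OF a, of x y] simple_adjacency.adj_sym [OF h, of x y] by simp
    have lt: "(\<Sum>t\<in>tup V 5. F (t ! j) (t ! i)) = real (card V) ^ 3 * disagreement V a h" if "j < i" "i < 5" for i j
      using sum_tup_nth2 [OF V that(1), of 3 F] that by (simp add: disagreement_def F_def)
    consider "j < i" | "i < j" | "i = j" by linarith
    then have "(\<Sum>t\<in>tup V 5. F (t ! j) (t ! i)) \<le> real (card V) ^ 3 * disagreement V a h"
    proof cases
      case 3
      then have "(\<Sum>t\<in>tup V 5. F (t ! j) (t ! i)) = 0"
        using simple_adjacency.adj_irrefl [OF a] simple_adjacency.adj_irrefl [OF h] by (simp add: F_def)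
      then show ?thesis using W by simp
    qed (use lt [of j i] lt [of i j] ij sym in auto)
    then show "(\<Sum>t\<in>tup V 5. of_bool (a (t ! j) (t ! i) \<noteq> h (t ! j) (t ! i))) \<le> real (card V) ^ 3 * disagreement V a h"
      unfolding F_def .
  qed
  finally show ?thesis
    by simp
qed

text \<open>
  Lists on which the two graphs agree are compared by \<open>gram_form_agree_ge\<close>; for the
  others, the form of \<open>a\<close> is nonnegative and that of \<open>h\<close> is of order
  \<open>d\<^sup>2\<close>.  The constant is \<open>2435 = 5 * 82 + 25 * 81\<close>.
\<close>

theorem sum_gram_form_comparison:
  assumes V: "finite V" and a: "simple_adjacency a" and \<pi>: "\<pi> ` V \<subseteq> {..<9}"
    and parts: "\<And>p. p < 9 \<Longrightarrow> \<bar>real (card {x\<in>V. \<pi> x = p}) - c\<bar> \<le> d"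
    and d: "0 < d" "d \<le> real (card V)"
  defines "h \<equiv> (\<lambda>x y. b9 (\<pi> x) (\<pi> y))"
  shows "(\<Sum>t\<in>tup V 5. gram_form V (\<lambda>_. 1) h t) - 2435 * gram_bound * d * real (card V) ^ 4 * disagreement V a h
     \<le> (\<Sum>t\<in>tup V 5. gram_form V (\<lambda>_. 1) a t)"
proof -
  define n where "n = real (card V)"
  define W where "W = disagreement V a h"
  have h: "simple_adjacency h"
    unfolding h_def by (unfold_locales) (simp_all add: b9.adj_irrefl b9.adj_sym)
  have W: "0 \<le> W"
    unfolding W_def disagreement_def by (intro sum_nonneg) auto
  have M: "1 \<le> gram_bound"
    by (rule gram_bound_ge)
  have small: "gram_form V (\<lambda>_. 1) h t \<le> 81 * gram_bound * d\<^sup>2" if t: "t \<in> tup V 5" for t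
  proof -
    have "gram_form V (\<lambda>_. 1) h t = gram_form {..<9} (\<lambda>p. real (card {x \<in> V. \<pi> x = p})) b9 (map \<pi> t)"
      using t by (intro gram_form_pullback [OF V _ \<pi>]) (auto simp: pulls_back_def h_def tup_def)
    also have "\<dots> \<le> 81 * gram_bound * d\<^sup>2"
      using t \<pi> parts by (intro gram_form_b9_near_uniform) (auto simp: tup_def)
    finally show ?thesis .
  qed
  have one: "gram_form V (\<lambda>_. 1) h t - 82 * gram_bound * d * real (card (wrong_at V a h t)) -
      81 * gram_bound * d\<^sup>2 * of_bool (\<not> agree_on (set t) a h) \<le> gram_form V (\<lambda>_. 1) a t" if t: "t \<in> tup V 5" for t
  proof (cases "agree_on (set t) a h")
    case True
    then show ?thesis
      using gram_form_agree_ge [OF V a h True d(1) small [OF t]] by simp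
  next
    case False
    have "0 \<le> gram_form V (\<lambda>_. 1) a t"
      by (rule gram_form_nonneg [OF V])
    moreover have "0 \<le> 82 * gram_bound * d * real (card (wrong_at V a h t))"
      using M d by simp
    ultimately show ?thesis
      using small [OF t] False by simp
  qed
  have "(\<Sum>t\<in>tup V 5. gram_form V (\<lambda>_. 1) h t) - 82 * gram_bound * d * (\<Sum>t\<in>tup V 5. real (card (wrong_at V a h t))) -
      81 * gram_bound * d\<^sup>2 * real (card {t \<in> tup V 5. \<not> agree_on (set t) a h}) =
    (\<Sum>t\<in>tup V 5. gram_form V (\<lambda>_. 1) h t - 82 * gram_bound * d * real (card (wrong_at V a h t)) -
      81 * gram_bound * d\<^sup>2 * of_bool (\<not> agree_on (set t) a h))"
    using V by (simp add: sum_subtractf sum_distrib_left [symmetric] Int_def)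
  also have "\<dots> \<le> (\<Sum>t\<in>tup V 5. gram_form V (\<lambda>_. 1) a t)"
    by (intro sum_mono one)
  finally have main: "(\<Sum>t\<in>tup V 5. gram_form V (\<lambda>_. 1) h t) - 82 * gram_bound * d * (\<Sum>t\<in>tup V 5. real (card
      (wrong_at V a h t))) -
      81 * gram_bound * d\<^sup>2 * real (card {t \<in> tup V 5. \<not> agree_on (set t) a h}) \<le> (\<Sum>t\<in>tup V 5. gram_form V
          (\<lambda>_. 1) a t)" .
  have "82 * gram_bound * d * (\<Sum>t\<in>tup V 5. real (card (wrong_at V a h t))) \<le> 82 * gram_bound * d * (5 * n ^ 4 * W)"
    using sum_wrong_at_le [OF V, where k = 4 and a = a and h = h] M d unfolding n_def W_def by (intro mult_left_mono) auto
  moreover have "81 * gram_bound * d\<^sup>2 * real (card {t \<in> tup V 5. \<not> agree_on (set t) a h}) \<le> 81 * gram_bound * d\<^sup>2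
      * (25 * n ^ 3 * W)"
    using card_disagreeing_tuples_le [OF V a h] M unfolding n_def W_def by (intro mult_left_mono) auto
  moreover have "81 * gram_bound * d\<^sup>2 * (25 * n ^ 3 * W) \<le> 2025 * gram_bound * d * n ^ 4 * W"
  proof -
    have "d\<^sup>2 * n ^ 3 \<le> d * n ^ 4"
      using d unfolding n_def [symmetric] by (simp add: power2_eq_square power_numeral_reduce mult_left_mono mult_right_mono)
    then have "2025 * gram_bound * W * (d\<^sup>2 * n ^ 3) \<le> 2025 * gram_bound * W * (d * n ^ 4)"
      using M W by (intro mult_left_mono) auto
    then show ?thesis
      by (simp add: mult_ac)
  qed
  moreover have "82 * gram_bound * d * (5 * n ^ 4 * W) = 410 * gram_bound * d * n ^ 4 * W"
    by simp
  moreover have "410 * gram_bound * d * n ^ 4 * W + 2025 * gram_bound * d * n ^ 4 * W = 2435 * gram_bound * d * n ^ 4 * W"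
    by simp
  ultimately show ?thesis
    using main unfolding n_def [symmetric] W_def [symmetric] by linarith
qed

section \<open>Most graphs near the maximum have many induced matchings\<close>

text \<open>
  Each of the two bounds fails for fewer than half of the elements, by Markov's inequality.
\<close>

lemma exists_below_average:
  fixes f g :: "'b \<Rightarrow> real"
  assumes S: "finite S" "S \<noteq> {}" and f: "\<And>s. s \<in> S \<Longrightarrow> 0 \<le> f s" and g: "\<And>s. s \<in> S
      \<Longrightarrow> 0 \<le> g s"
    and F: "(\<Sum>s\<in>S. f s) \<le> F" and G: "(\<Sum>s\<in>S. g s) \<le> G"
  obtains s where "s \<in> S" "f s * real (card S) \<le> 2 * F" "g s * real (card S) \<le> 2 * G"
proof -
  have half: "2 * card {s\<in>S. 2 * B < b s * real (card S)} < card S"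
    if b: "\<And>s. s \<in> S \<Longrightarrow> 0 \<le> b s" and B: "(\<Sum>s\<in>S. b s) \<le> B" for b :: "'b \<Rightarrow> real" and B
  proof (cases "{s\<in>S. 2 * B < b s * real (card S)} = {}")
    case True
    have "0 < card S"
      using S by (simp add: card_gt_0_iff)
    then show ?thesis
      unfolding True by simp
  next
    case False
    let ?A = "{s\<in>S. 2 * B < b s * real (card S)}"
    have "0 \<le> B"
      using sum_nonneg [of S b] b B by simp
    have "real (card ?A) * (2 * B) = (\<Sum>s\<in>?A. 2 * B)"
      by simp
    also have "\<dots> < (\<Sum>s\<in>?A. b s * real (card S))"
    proof (rule sum_strict_mono)
      show "finite ?A"
        using S(1) by simp
    qed (use False in auto)
    also have "\<dots> = (\<Sum>s\<in>?A. b s) * real (card S)"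
      by (simp add: sum_distrib_right)
    also have "\<dots> \<le> (\<Sum>s\<in>S. b s) * real (card S)"
      using S b by (intro mult_right_mono sum_mono2) auto
    also have "\<dots> \<le> B * real (card S)"
      using B by (intro mult_right_mono) auto
    finally have "B * real (2 * card ?A) < B * real (card S)"
      by (simp add: mult_ac)
    then have "real (2 * card ?A) < real (card S)"
      using \<open>0 \<le> B\<close> by (simp add: mult_less_cancel_left)
    then show ?thesis
      by (simp only: of_nat_less_iff)
  qed
  let ?A = "{s\<in>S. 2 * F < f s * real (card S)}" and ?B = "{s\<in>S. 2 * G < g s * real (card S)}"
  have "card (?A \<union> ?B) \<le> card ?A + card ?B"
    by (rule card_Un_le)
  also have "\<dots> < card S"
    using half [OF f F] half [OF g G] by simp
  finally have "?A \<union> ?B \<noteq> S"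
    by auto
  then obtain s where "s \<in> S" "s \<notin> ?A" "s \<notin> ?B"
    by blast
  then show ?thesis
    using that by (auto simp: not_less)
qed

lemma card_rearrangements_le:
  assumes "finite R" "\<And>\<rho>. \<rho> \<in> R \<Longrightarrow> length \<rho> = k"
  shows "card {xs. \<exists>\<rho>\<in>R. mset \<rho> = mset xs} \<le> fact k * card R"
proof -
  let ?P = "{\<sigma>. \<sigma> permutes {..<k}}"
  have "{xs. \<exists>\<rho>\<in>R. mset \<rho> = mset xs} \<subseteq> (\<lambda>(\<sigma>, \<rho>). permute_list \<sigma> \<rho>) ` (?P \<times> R)"
  proof
    fix xs assume "xs \<in> {xs. \<exists>\<rho>\<in>R. mset \<rho> = mset xs}"
    then obtain \<rho> where \<rho>: "\<rho> \<in> R" "mset xs = mset \<rho>"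
      by auto
    then obtain \<sigma> where "\<sigma> permutes {..<k}" "permute_list \<sigma> \<rho> = xs"
      using mset_eq_permutation [OF \<rho>(2)] assms(2) by metis
    then show "xs \<in> (\<lambda>(\<sigma>, \<rho>). permute_list \<sigma> \<rho>) ` (?P \<times> R)"
      using \<rho>(1) by (intro image_eqI [of _ _ "(\<sigma>, \<rho>)"]) auto
  qed
  then have "card {xs. \<exists>\<rho>\<in>R. mset \<rho> = mset xs} \<le> card (?P \<times> R)"
    using assms(1) by (intro surj_card_le finite_cartesian_product finite_permutations) auto
  also have "\<dots> = fact k * card R"
    by (simp add: card_cartesian_product card_permutations)
  finally show ?thesis .
qed

context simple_adjacency
begin

text \<open>
  A vertex attached to the isolated vertex only completes \<open>2K\<^sub>2 + K\<^sub>1\<close>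
  to \<open>3K\<^sub>2\<close>.
\<close>

lemma pendant_imp_matching3:
  assumes "length t = 5" "type_key a t = (4, 4)" "signature a t z = [1, 0, 0, 0]"
  obtains \<rho> where "mset \<rho> = mset (z # t)" "matching3 a \<rho>"
proof -
  obtain y0 y1 y2 y3 y4 where m: "mset [y0, y1, y2, y3, y4] = mset t"
    and rows: "[a y0 y2, a y0 y3, a y0 y4] \<le> [a y1 y2, a y1 y3, a y1 y4]" "[a y0 y1, a y1 y3, a y1 y4] \<le> [a y0 y2, a y2 y3, a y2 y4]"
      "[a y0 y2, a y1 y2, a y2 y4] \<le> [a y0 y3, a y1 y3, a y3 y4]" "[a y0 y3, a y1 y3, a y2 y3] \<le> [a y0 y4, a y1 y4, a y2 y4]"
    using assms(1) by (rule sorted_rows_5)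
  have k: "type_key_bits (a y0 y1) (a y0 y2) (a y1 y2) (a y0 y3) (a y1 y3) (a y2 y3) (a y0 y4) (a y1 y4) (a y2 y4) (a y3 y4) = (4, 4)"
    using assms(2) type_key_mset [OF m, of a] by (simp add: type_key_eq_bits)
  note e = sorted_matching_bits [OF rows k]
  have s: "signature_bits (a y0 y1) (a y0 y2) (a y1 y2) (a y0 y3) (a y1 y3) (a y2 y3) (a y0 y4) (a y1 y4) (a y2 y4) (a y3 y4)
      (a y0 z) (a y1 z) (a y2 z) (a y3 z) (a y4 z) = [1, 0, 0, 0]"
    using assms(3) signature_mset [OF m, of a z] by (simp add: signature_eq_bits)
  have ex: "a y0 z \<and> \<not> a y1 z \<and> \<not> a y2 z \<and> \<not> a y3 z \<and> \<not> a y4 z"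
    using s e by (cases "a y0 z"; cases "a y1 z"; cases "a y2 z"; cases "a y3 z"; cases "a y4 z")
      (simp_all add: signature_bits_def Let_def)
  have sym: "a y1 y0 = a y0 y1" "a y2 y0 = a y0 y2" "a y2 y1 = a y1 y2" "a y3 y0 = a y0 y3" "a y3 y1 = a y1 y3" "a y3 y2 = a y2 y3"
    "a y4 y0 = a y0 y4" "a y4 y1 = a y1 y4" "a y4 y2 = a y2 y4" "a y4 y3 = a y3 y4"
    "a z y0 = a y0 z" "a z y1 = a y1 z" "a z y2 = a y2 z" "a z y3 = a y3 z" "a z y4 = a y4 z"
    using adj_sym by blast+
  show ?thesis
  proof (rule that [of "[y0, z, y1, y4, y2, y3]"])
    show "mset [y0, z, y1, y4, y2, y3] = mset (z # t)"
      using m by (simp add: add_mset_commute)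
    show "matching3 a [y0, z, y1, y4, y2, y3]"
      unfolding matching3_def all_less_6 using e ex sym adj_irrefl by simp
  qed
qed

end

definition matching_roots :: "'v set \<Rightarrow> ('v \<Rightarrow> 'v \<Rightarrow> bool) \<Rightarrow> 'v list set" where
  "matching_roots V a = {\<rho> \<in> tup V 6. matching3 a \<rho>}"

definition slack_total :: "'v set \<Rightarrow> ('v \<Rightarrow> 'v \<Rightarrow> bool) \<Rightarrow> real" where
  "slack_total V a = (\<Sum>xs\<in>tup V 7. real_of_int (slack7 a xs))"

definition gram_total :: "'v set \<Rightarrow> ('v \<Rightarrow> 'v \<Rightarrow> bool) \<Rightarrow> real" where
  "gram_total V a = (\<Sum>t\<in>tup V 5. gram_form V (\<lambda>_. 1) a t)"

lemma deficit_identity: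
  assumes "finite V"
  shows "787320 * real (card V) * (160 / 2187 * real (card V) ^ 6 - leaf_total V (\<lambda>_. 1) a) = gram_total V a + slack_total V a / 21"
proof -
  have "57600 * real (card V) ^ 7 = 787320 * real (card V) * (160 / 2187 * real (card V) ^ 6)"
    by (simp add: power_numeral_reduce)
  then show ?thesis
    using slack_identity [OF assms, of "\<lambda>_. 1" a] unfolding gram_total_def slack_total_def
    by (simp add: right_diff_distrib)
qed

lemma slack_total_nonneg: "finite V \<Longrightarrow> simple_adjacency a \<Longrightarrow> 0 \<le> slack_total V a"
  using sum_slack7_nonneg [of V "\<lambda>_. 1" a] by (simp add: slack_total_def)

lemma gram_total_nonneg: "finite V \<Longrightarrow> 0 \<le> gram_total V a"
  using sum_gram_form_nonneg [of V "\<lambda>_. 1" a] by (simp add: gram_total_def)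

lemma le_add_square_div: "u \<le> n / 100 + 100 * u\<^sup>2 / n" if "0 < n" for u n :: real
proof (cases "u \<le> n / 100")
  case True
  then show ?thesis
    using that by (simp add: add_increasing2)
next
  case False
  then have "n * u \<le> 100 * u * u"
    using that by (intro mult_right_mono) auto
  then have "u \<le> 100 * u\<^sup>2 / n"
    using that by (simp add: field_simps power2_eq_square)
  then show ?thesis
    using that by (simp add: add_increasing)
qed

text \<open>
  There are many leaf pairs, and the square \<open>(X - 2 Z)\<^sup>2\<close> in the forms is
  small on average; so there are many pairs of a \<open>2K\<^sub>2 + K\<^sub>1\<close> and a
  vertex attached to its isolated vertex only, which are rearrangements of induced
  \<open>3K\<^sub>2\<close>.
\<close>

lemma card_matching_roots_ge:
  assumes V: "finite V" "V \<noteq> {}" and a: "simple_adjacency a" and \<epsilon>: "\<epsilon> \<le> 1 / 10 ^ 8"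
    and L: "(160 / 2187 - \<epsilon>) * real (card V) ^ 6 \<le> leaf_total V (\<lambda>_. 1) a"
  shows "real (card V) ^ 6 / 28800 \<le> real (card (matching_roots V a))"
proof -
  interpret simple_adjacency a by fact
  define n where "n = real (card V)"
  have n: "0 < n"
    using V by (simp add: n_def card_gt_0_iff)
  define pend where "pend t x \<longleftrightarrow> type_key a t = (4, 4) \<and> signature a t x = [1, 0, 0, 0]" for t x
  define Z where "Z t = (\<Sum>x\<in>V. of_bool (pend t x) :: real)" for t
  define X where "X t = (\<Sum>x\<in>V. of_bool (leaf a t x) :: real)" for t
  have "787320 * n * (160 / 2187 * n ^ 6 - leaf_total V (\<lambda>_. 1) a) \<le> 787320 * n * (\<epsilon> * n ^ 6)"
    using L n unfolding n_def [symmetric] by (intro mult_left_mono) (auto simp: left_diff_distrib)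
  then have "gram_total V a \<le> 787320 * n * (\<epsilon> * n ^ 6)"
    using deficit_identity [OF V(1), of a] slack_total_nonneg [OF V(1) a] unfolding n_def by linarith
  then have "gram_total V a / n \<le> 787320 * n * (\<epsilon> * n ^ 6) / n"
    using n by (intro divide_right_mono) auto
  also have "\<dots> = 787320 * \<epsilon> * n ^ 6"
    using n by simp
  also have "\<dots> \<le> 8 / 1000 * n ^ 6"
    using \<epsilon> by (intro mult_right_mono) auto
  finally have Q: "gram_total V a / n \<le> 8 / 1000 * n ^ 6" .
  have arith: "p / 40 \<le> z" if "l \<le> 2 * z + p / 100 + q" "73 / 1000 * p \<le> l" "q \<le> 8 / 1000 * p" "0 \<le> p" for p q l z :: real
    using that by (simp add: field_simps)
  have one: "X t \<le> 2 * Z t + n / 100 + gram_form V (\<lambda>_. 1) a t / n" for t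
  proof (cases "type_key a t = (4, 4)")
    case True
    have X: "X t = (\<Sum>x\<in>{x\<in>V. signature a t x = leaf_sig}. 1)" and Z: "Z t = (\<Sum>x\<in>{x\<in>V. signature a t x = [1, 0, 0, 0]}. 1)"
      using V(1) True by (simp_all add: X_def Z_def leaf_def pend_def Int_def)
    have "100 * (X t - 2 * Z t)\<^sup>2 \<le> gram_form V (\<lambda>_. 1) a t"
    proof -
      have "100 * (u\<^sup>2 + v\<^sup>2) \<le> g \<Longrightarrow> 100 * u\<^sup>2 \<le> g" for u v g :: real
        by (smt (verit) zero_le_power2)
      then show ?thesis
        using gram_form_matching_vertex [OF V(1) True, of "\<lambda>_. 1"] unfolding X Z by blast
    qed
    then have "100 * (X t - 2 * Z t)\<^sup>2 / n \<le> gram_form V (\<lambda>_. 1) a t / n"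
      using n by (intro divide_right_mono) auto
    then show ?thesis
      using le_add_square_div [OF n, of "X t - 2 * Z t"] by linarith
  next
    case False
    then have "X t = 0"
      by (simp add: X_def leaf_def)
    moreover have "0 \<le> Z t"
      unfolding Z_def by (intro sum_nonneg) auto
    ultimately show ?thesis
      using n gram_form_nonneg [OF V(1), of "\<lambda>_. 1" a t] by simp
  qed
  have "leaf_total V (\<lambda>_. 1) a = (\<Sum>t\<in>tup V 5. X t)"
    by (simp add: leaf_total_def X_def)
  also have "\<dots> \<le> (\<Sum>t\<in>tup V 5. 2 * Z t + n / 100 + gram_form V (\<lambda>_. 1) a t / n)"
    by (intro sum_mono one)
  also have "\<dots> = 2 * (\<Sum>t\<in>tup V 5. Z t) + n ^ 5 * (n / 100) + gram_total V a / n"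
    using V(1) by (simp add: sum.distrib sum_distrib_left [symmetric] sum_divide_distrib [symmetric] gram_total_def card_tup n_def)
  finally have "leaf_total V (\<lambda>_. 1) a \<le> 2 * (\<Sum>t\<in>tup V 5. Z t) + n ^ 6 / 100 + gram_total V a / n"
    by (simp add: power_numeral_reduce)
  moreover have "73 / 1000 * n ^ 6 \<le> leaf_total V (\<lambda>_. 1) a"
  proof -
    have "73 / 1000 * n ^ 6 \<le> (160 / 2187 - \<epsilon>) * n ^ 6"
      using \<epsilon> by (intro mult_right_mono) auto
    then show ?thesis
      using L unfolding n_def by linarith
  qed
  ultimately have "n ^ 6 / 40 \<le> (\<Sum>t\<in>tup V 5. Z t)"
    using Q n by (intro arith [of _ _ "n ^ 6" "gram_total V a / n"]) auto
  also have "(\<Sum>t\<in>tup V 5. Z t) = (\<Sum>xs\<in>tup V 6. of_bool (pend (del_at 5 xs) (xs ! 5)))"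
    unfolding Z_def using sum_tup_del_at [OF V(1), of 5 5 "\<lambda>_. 1" "\<lambda>t x. of_bool (pend t x)"] by simp
  also have "\<dots> = real (card {xs \<in> tup V 6. pend (del_at 5 xs) (xs ! 5)})"
    using V(1) by (simp add: Int_def)
  also have "card {xs \<in> tup V 6. pend (del_at 5 xs) (xs ! 5)} \<le> card {xs. \<exists>\<rho>\<in>matching_roots V a. mset \<rho> = mset xs}"
  proof (rule card_mono)
    have "{xs. \<exists>\<rho>\<in>matching_roots V a. mset \<rho> = mset xs} \<subseteq> tup V 6"
      unfolding matching_roots_def tup_def by (auto dest: mset_eq_setD mset_eq_length)
    then show "finite {xs. \<exists>\<rho>\<in>matching_roots V a. mset \<rho> = mset xs}"
      using V(1) finite_subset finite_tup by metis
    show "{xs \<in> tup V 6. pend (del_at 5 xs) (xs ! 5)} \<subseteq> {xs. \<exists>\<rho>\<in>matching_roots V a. mset \<rho> = mset xs}"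
    proof
      fix xs assume "xs \<in> {xs \<in> tup V 6. pend (del_at 5 xs) (xs ! 5)}"
      then have xs: "length xs = 6" "set xs \<subseteq> V" "pend (del_at 5 xs) (xs ! 5)"
        by (auto simp: tup_def)
      have m: "mset (xs ! 5 # del_at 5 xs) = mset xs"
        using xs(1) by (intro mset_del_at) simp
      obtain \<rho> where "mset \<rho> = mset xs" "matching3 a \<rho>"
        using pendant_imp_matching3 [of "del_at 5 xs" "xs ! 5"] xs unfolding m [symmetric] pend_def by (auto simp: del_at_def)
      moreover from this have "\<rho> \<in> tup V 6"
        using xs mset_eq_setD [of \<rho> xs] by (auto simp: tup_def matching3_def)
      ultimately show "xs \<in> {xs. \<exists>\<rho>\<in>matching_roots V a. mset \<rho> = mset xs}"
        by (auto simp: matching_roots_def)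
    qed
  qed
  also have "card {xs. \<exists>\<rho>\<in>matching_roots V a. mset \<rho> = mset xs} \<le> 720 * card (matching_roots V a)"
  proof -
    have "finite (matching_roots V a)" "\<And>\<rho>. \<rho> \<in> matching_roots V a \<Longrightarrow> length \<rho> = 6"
      using V(1) by (auto simp: matching_roots_def tup_def [of V 6, symmetric] intro: finite_subset [OF _ finite_tup]) (simp add: tup_def)
    from card_rearrangements_le [OF this] show ?thesis
      by (simp add: fact_numeral)
  qed
  finally show ?thesis
    unfolding n_def by simp
qed

section \<open>A nearby blowup\<close>

definition stray :: "('v \<Rightarrow> 'v \<Rightarrow> bool) \<Rightarrow> 'v list \<Rightarrow> 'v \<Rightarrow> bool" where
  "stray a \<rho> x \<longleftrightarrow> \<not> (\<exists>p. attached a \<rho> p x)"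

definition misjoined :: "('v \<Rightarrow> 'v \<Rightarrow> bool) \<Rightarrow> 'v list \<Rightarrow> 'v \<Rightarrow> 'v \<Rightarrow> bool" where
  "misjoined a \<rho> x y \<longleftrightarrow> (\<exists>p q. attached a \<rho> p x \<and> attached a \<rho> q y \<and> a x y \<noteq> b9 p q)"

text \<open>A root together with a stray vertex is a list of positive slack.\<close>

lemma sum_stray_le:
  assumes V: "finite V" and a: "simple_adjacency a"
  shows "(\<Sum>\<rho>\<in>matching_roots V a. \<Sum>x\<in>V. of_bool (stray a \<rho> x)) \<le> slack_total V a"
proof -
  interpret simple_adjacency a by fact
  have nonneg: "0 \<le> real_of_int (slack7 a (\<rho> @ [x]))" if "\<rho> \<in> tup V 6" for \<rho> x
    using slack7_nonneg that by (simp add: tup_def)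
  have "(\<Sum>\<rho>\<in>matching_roots V a. \<Sum>x\<in>V. of_bool (stray a \<rho> x)) \<le>
    (\<Sum>\<rho>\<in>matching_roots V a. \<Sum>x\<in>V. real_of_int (slack7 a (\<rho> @ [x])))"
  proof (intro sum_mono)
    fix \<rho> x assume \<rho>: "\<rho> \<in> matching_roots V a"
    then have "matching3 a \<rho>" "\<rho> \<in> tup V 6"
      by (auto simp: matching_roots_def)
    then show "of_bool (stray a \<rho> x) \<le> real_of_int (slack7 a (\<rho> @ [x]))"
      using slack7_bad_attachment [of \<rho> x] nonneg [of \<rho> x] by (cases "stray a \<rho> x") (auto simp: stray_def)
  qed
  also have "\<dots> \<le> (\<Sum>\<rho>\<in>tup V 6. \<Sum>x\<in>V. real_of_int (slack7 a (\<rho> @ [x])))"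
    using V nonneg by (intro sum_mono2 sum_nonneg) (auto simp: matching_roots_def)
  also have "\<dots> = slack_total V a"
    using sum_tup_snoc [OF V, of "\<lambda>xs. real_of_int (slack7 a xs)" 6] by (simp add: slack_total_def)
  finally show ?thesis .
qed

text \<open>
  A misjoined pair has positive slack together with five of the six roots; summing over the
  omitted root costs a factor \<open>n\<close>.
\<close>

lemma sum_misjoined_le:
  assumes V: "finite V" and a: "simple_adjacency a"
  shows "(\<Sum>\<rho>\<in>matching_roots V a. \<Sum>x\<in>V. \<Sum>y\<in>V. of_bool (misjoined a \<rho> x y)) \<le> 6 * real (card V) *
      slack_total V a"
proof -
  interpret simple_adjacency a by fact
  define S where "S t = (\<Sum>x\<in>V. \<Sum>y\<in>V. real_of_int (slack7 a (t @ [x, y])))" for t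
  have nonneg: "0 \<le> real_of_int (slack7 a (del_at i \<rho> @ [x, y]))" if "\<rho> \<in> tup V 6" "i < 6" for \<rho> x y i
    using slack7_nonneg that by (simp add: tup_def del_at_def)
  have S_nonneg: "0 \<le> S (del_at i \<rho>)" if "\<rho> \<in> tup V 6" "i < 6" for \<rho> i
    unfolding S_def using nonneg [OF that] by (intro sum_nonneg)
  have "(\<Sum>\<rho>\<in>matching_roots V a. \<Sum>x\<in>V. \<Sum>y\<in>V. of_bool (misjoined a \<rho> x y)) \<le>
    (\<Sum>\<rho>\<in>matching_roots V a. \<Sum>x\<in>V. \<Sum>y\<in>V. \<Sum>i<6. real_of_int (slack7 a (del_at i \<rho> @ [x, y])))"
  proof (intro sum_mono)
    fix \<rho> x y assume "\<rho> \<in> matching_roots V a"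
    then have \<rho>: "matching3 a \<rho>" "\<rho> \<in> tup V 6"
      by (auto simp: matching_roots_def)
    show "of_bool (misjoined a \<rho> x y) \<le> (\<Sum>i<6. real_of_int (slack7 a (del_at i \<rho> @ [x, y])))"
    proof (cases "misjoined a \<rho> x y")
      case True
      then obtain i where i: "i < 6" "1 \<le> slack7 a (del_at i \<rho> @ [x, y])"
        using slack7_wrong_pair [OF \<rho>(1)] unfolding misjoined_def by blast
      then have "1 \<le> real_of_int (slack7 a (del_at i \<rho> @ [x, y]))"
        by simp
      also have "\<dots> \<le> (\<Sum>i<6. real_of_int (slack7 a (del_at i \<rho> @ [x, y])))"
        using i(1) nonneg [OF \<rho>(2)] by (intro member_le_sum) auto
      finally show ?thesis
        using True by simp
    next
      case False
      moreover have "0 \<le> (\<Sum>i<6. real_of_int (slack7 a (del_at i \<rho> @ [x, y])))"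
        using nonneg [OF \<rho>(2)] by (intro sum_nonneg) auto
      ultimately show ?thesis
        by simp
    qed
  qed
  also have "\<dots> = (\<Sum>\<rho>\<in>matching_roots V a. \<Sum>i<6. S (del_at i \<rho>))"
    unfolding S_def by (intro sum.cong refl, subst (2) sum.swap, subst sum.swap) (rule refl)
  also have "\<dots> \<le> (\<Sum>\<rho>\<in>tup V 6. \<Sum>i<6. S (del_at i \<rho>))"
    using V S_nonneg by (intro sum_mono2 sum_nonneg) (auto simp: matching_roots_def)
  also have "\<dots> = (\<Sum>i<(6::nat). real (card V) * slack_total V a)"
  proof (subst sum.swap, intro sum.cong refl)
    fix i :: nat assume "i \<in> {..<6}"
    then have "(\<Sum>\<rho>\<in>tup V 6. S (del_at i \<rho>)) = real (card V) * (\<Sum>t\<in>tup V 5. S t)"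
      using sum_tup_of_del_at [OF V, of i 5 S] by simp
    also have "(\<Sum>t\<in>tup V 5. S t) = slack_total V a"
      using sum_tup_snoc [OF V, of "\<lambda>xs. real_of_int (slack7 a xs)" 6]
        sum_tup_snoc [OF V, of "\<lambda>t. \<Sum>y\<in>V. real_of_int (slack7 a (t @ [y]))" 5]
      by (simp add: slack_total_def S_def)
    finally show "(\<Sum>\<rho>\<in>tup V 6. S (del_at i \<rho>)) = real (card V) * slack_total V a" .
  qed
  finally show ?thesis
    by simp
qed

lemma sum_root_gram_le:
  assumes V: "finite V"
  shows "(\<Sum>\<rho>\<in>matching_roots V a. \<Sum>i<6. gram_form V (\<lambda>_. 1) a (del_at i \<rho>)) \<le> 6 * real (card V) * gram_total V a"
proof -
  have "(\<Sum>\<rho>\<in>matching_roots V a. \<Sum>i<6. gram_form V (\<lambda>_. 1) a (del_at i \<rho>)) \<le>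
    (\<Sum>\<rho>\<in>tup V 6. \<Sum>i<6. gram_form V (\<lambda>_. 1) a (del_at i \<rho>))"
    using V gram_form_nonneg [OF V] by (intro sum_mono2 sum_nonneg) (auto simp: matching_roots_def)
  also have "\<dots> = (\<Sum>i<(6::nat). real (card V) * gram_total V a)"
    using sum_tup_of_del_at [OF V, of _ 5 "gram_form V (\<lambda>_. 1) a"]
    by (subst sum.swap, intro sum.cong refl) (simp add: gram_total_def)
  finally show ?thesis
    by simp
qed

text \<open>
  A root that is below twice the average for its conflicts and for its forms has few of both.
  Few conflicts means that the parts disagree with the graph in few pairs and that there are few
  stray vertices; small forms mean that the parts are balanced.
\<close>

theorem near_blowup:
  assumes V: "finite V" "V \<noteq> {}" and a: "simple_adjacency a" and \<kappa>: "0 < \<kappa>" "\<kappa> \<le> 1"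
    and L: "(160 / 2187 - \<kappa>\<^sup>2 / 10 ^ 15) * real (card V) ^ 6 \<le> leaf_total V (\<lambda>_. 1) a"
  obtains \<pi> where "\<pi> ` V \<subseteq> {..<9}" "\<And>p. p < 9 \<Longrightarrow> \<bar>real (card {x\<in>V. \<pi> x = p}) - real
      (card V) / 9\<bar> \<le> \<kappa> * real (card V)"
    "disagreement V a (\<lambda>x y. b9 (\<pi> x) (\<pi> y)) * real (card V) ^ 5 \<le> 460800 * slack_total V a"
proof -
  interpret simple_adjacency a by fact
  define n where "n = real (card V)"
  define R where "R = real (card (matching_roots V a))"
  define S where "S = slack_total V a"
  define Q where "Q = gram_total V a"
  define \<epsilon> where "\<epsilon> = \<kappa>\<^sup>2 / 10 ^ 15"
  have \<kappa>2: "\<kappa>\<^sup>2 \<le> \<kappa>" "\<kappa>\<^sup>2 \<le> 1" "0 \<le> \<kappa>\<^sup>2"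
    using \<kappa> by (simp_all add: power2_eq_square mult_left_le power_le_one mult_le_one)
  have n: "0 < n"
    using V by (simp add: n_def card_gt_0_iff)
  have S0: "0 \<le> S"
    unfolding S_def by (rule slack_total_nonneg [OF V(1) a])
  have Q0: "0 \<le> Q"
    unfolding Q_def by (rule gram_total_nonneg [OF V(1)])
  have R: "n ^ 6 / 28800 \<le> R"
    unfolding n_def R_def using L \<kappa>2 by (intro card_matching_roots_ge [OF V a, of "\<kappa>\<^sup>2 / 10 ^ 15"]) auto
  have "0 < n ^ 6 / 28800"
    using n by simp
  with R have R0: "0 < R"
    by linarith
  have "160 / 2187 * n ^ 6 - leaf_total V (\<lambda>_. 1) a \<le> \<epsilon> * n ^ 6"
    using L unfolding n_def [symmetric] \<epsilon>_def [symmetric] by (simp add: left_diff_distrib)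
  then have "787320 * n * (160 / 2187 * n ^ 6 - leaf_total V (\<lambda>_. 1) a) \<le> 787320 * n * (\<epsilon> * n ^ 6)"
    using n by (intro mult_left_mono) auto
  then have QS: "Q + S / 21 \<le> 787320 * \<epsilon> * n ^ 7"
    using deficit_identity [OF V(1), of a] unfolding n_def [symmetric] Q_def S_def by (simp add: power_numeral_reduce mult_ac)
  \<comment> \<open>A stray vertex may spoil up to \<open>2 n\<close> ordered pairs.\<close>
  define bad where "bad \<rho> = (\<Sum>x\<in>V. \<Sum>y\<in>V. of_bool (misjoined a \<rho> x y)) + 2 * n * (\<Sum>x\<in>V. of_bool (stray
      a \<rho> x))" for \<rho>
  define gr where "gr \<rho> = (\<Sum>i<6. gram_form V (\<lambda>_. 1) a (del_at i \<rho>))" for \<rho>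
  have fin: "finite (matching_roots V a)" "matching_roots V a \<noteq> {}"
    using R0 unfolding R_def by (auto intro: card_ge_0_finite)
  have "(\<Sum>\<rho>\<in>matching_roots V a. bad \<rho>) \<le> 8 * n * S"
  proof -
    have "(\<Sum>\<rho>\<in>matching_roots V a. bad \<rho>) = (\<Sum>\<rho>\<in>matching_roots V a. \<Sum>x\<in>V. \<Sum>y\<in>V. of_bool
        (misjoined a \<rho> x y)) +
      2 * n * (\<Sum>\<rho>\<in>matching_roots V a. \<Sum>x\<in>V. of_bool (stray a \<rho> x))"
      unfolding bad_def by (simp add: sum.distrib sum_distrib_left)
    also have "\<dots> \<le> 6 * n * S + 2 * n * S"
      using sum_misjoined_le [OF V(1) a] sum_stray_le [OF V(1) a] n unfolding n_def S_def
      by (intro add_mono mult_left_mono) auto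
    finally show ?thesis
      by (simp add: mult_ac)
  qed
  moreover have "(\<Sum>\<rho>\<in>matching_roots V a. gr \<rho>) \<le> 6 * n * Q"
    unfolding gr_def n_def Q_def by (rule sum_root_gram_le [OF V(1)])
  moreover have "0 \<le> bad \<rho>" for \<rho>
    unfolding bad_def using n by (intro add_nonneg_nonneg mult_nonneg_nonneg sum_nonneg) auto
  moreover have "0 \<le> gr \<rho>" for \<rho>
    unfolding gr_def by (intro sum_nonneg gram_form_nonneg [OF V(1)])
  ultimately obtain \<rho> where \<rho>: "\<rho> \<in> matching_roots V a" "bad \<rho> * R \<le> 2 * (8 * n * S)" "gr \<rho> * R \<le> 2 *
      (6 * n * Q)"
    using exists_below_average [OF fin, of bad gr "8 * n * S" "6 * n * Q"] unfolding R_def by metis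
  have bound: "c * n ^ 5 \<le> 28800 * e" if "c * R \<le> n * e" "0 \<le> c" for c e
  proof -
    have "c * (n ^ 6 / 28800) \<le> c * R"
      using R that(2) by (rule mult_left_mono)
    also have "\<dots> \<le> n * e"
      by (rule that(1))
    finally have "n * (c * n ^ 5) \<le> n * (28800 * e)"
      by (simp add: power_numeral_reduce mult_ac)
    then show ?thesis
      using n by simp
  qed
  \<comment> \<open>The constants are \<open>460800 = 2 * 8 * 28800\<close> and \<open>345600 = 2 *
    6 * 28800\<close>.\<close>
  have bad: "bad \<rho> * n ^ 5 \<le> 460800 * S"
    using bound [of "bad \<rho>" "16 * S"] \<rho>(2) \<open>0 \<le> bad \<rho>\<close> by (simp add: mult_ac)
  have gr: "gr \<rho> * n ^ 5 \<le> 345600 * Q"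
    using bound [of "gr \<rho>" "12 * Q"] \<rho>(3) \<open>0 \<le> gr \<rho>\<close> by (simp add: mult_ac)
  define s where "s = (\<Sum>x\<in>V. of_bool (stray a \<rho> x) :: real)"
  have s0: "0 \<le> s"
    unfolding s_def by (intro sum_nonneg) auto
  \<comment> \<open>The denominator \<open>10 ^ 15\<close> is large enough for stray vertices and
    forms to use up at most half of the tolerance \<open>\<kappa> n\<close> each.\<close>
  have s: "82 * s \<le> \<kappa> * n"
  proof -
    have "0 \<le> (\<Sum>x\<in>V. \<Sum>y\<in>V. of_bool (misjoined a \<rho> x y) :: real)"
      by (intro sum_nonneg) auto
    then have "2 * n * s \<le> bad \<rho>"
      unfolding bad_def s_def by simp
    then have "2 * n * s * n ^ 5 \<le> bad \<rho> * n ^ 5"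
      using n by (intro mult_right_mono) auto
    also have "\<dots> \<le> 460800 * (21 * (787320 * \<epsilon> * n ^ 7))"
      using bad QS Q0 by linarith
    finally have "n ^ 6 * (2 * s) \<le> n ^ 6 * (460800 * 21 * 787320 * \<epsilon> * n)"
      by (simp add: power_numeral_reduce mult_ac)
    then have "2 * s \<le> 460800 * 21 * 787320 * \<epsilon> * n"
      using n by simp
    then have "82 * s \<le> 41 * 460800 * 21 * 787320 * \<epsilon> * n"
      by simp
    also have "\<dots> = 312368265216000 / 10 ^ 15 * \<kappa>\<^sup>2 * n"
      by (simp add: \<epsilon>_def)
    also have "\<dots> \<le> 1 * \<kappa> * n"
      using \<kappa>2 n by (intro mult_right_mono mult_mono) auto
    finally show ?thesis by simp
  qed
  have gram: "gram_form V (\<lambda>_. 1) a (del_at i \<rho>) \<le> 100 * (\<kappa> * n / 40)\<^sup>2" if i: "i < 6" for i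
  proof -
    have "gr \<rho> * n ^ 5 \<le> 345600 * (787320 * \<epsilon> * n ^ 7)"
      using gr QS S0 by linarith
    then have "n ^ 5 * gr \<rho> \<le> n ^ 5 * (345600 * 787320 * \<epsilon> * n\<^sup>2)"
      by (simp add: power_numeral_reduce mult_ac)
    then have "gr \<rho> \<le> 345600 * 787320 * \<epsilon> * n\<^sup>2"
      using n by simp
    also have "\<dots> = 272097792000 / 10 ^ 15 * \<kappa>\<^sup>2 * n\<^sup>2"
      by (simp add: \<epsilon>_def)
    also have "\<dots> \<le> 1 / 16 * \<kappa>\<^sup>2 * n\<^sup>2"
      using \<kappa>2 by (intro mult_right_mono) auto
    also have "\<dots> = 100 * (\<kappa> * n / 40)\<^sup>2"
      by (simp add: power_mult_distrib power_divide)
    finally have "gr \<rho> \<le> 100 * (\<kappa> * n / 40)\<^sup>2" .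
    moreover have "gram_form V (\<lambda>_. 1) a (del_at i \<rho>) \<le> gr \<rho>"
      unfolding gr_def using i gram_form_nonneg [OF V(1)] by (intro member_le_sum) auto
    ultimately show ?thesis by linarith
  qed
  have m: "matching3 a \<rho>"
    using \<rho>(1) by (simp add: matching_roots_def)
  have sw: "stray_weight V (\<lambda>_. 1) a \<rho> = s"
    using V(1) by (simp add: stray_weight_def s_def stray_def Int_def)
  have N: "\<bar>part_weight V (\<lambda>_. 1) a \<rho> p - n / 9\<bar> \<le> 20 * (\<kappa> * n / 40 + 2 * s)" if "p < 9" for p
    using parts_balanced [OF V(1), of "\<lambda>_. 1" \<rho> "\<kappa> * n / 40" p] m gram \<kappa> n that unfolding sw n_def by simp
  \<comment> \<open>Stray vertices are put into an arbitrary part.\<close>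
  define \<pi> where "\<pi> x = (if stray a \<rho> x then 0 else (SOME p. attached a \<rho> p x))" for x
  have \<pi>: "attached a \<rho> (\<pi> x) x" if "\<not> stray a \<rho> x" for x
    unfolding \<pi>_def using that someI_ex [of "\<lambda>p. attached a \<rho> p x"] by (simp add: stray_def)
  have \<pi>9: "\<pi> x < 9" for x
    using \<pi> [of x] by (cases "stray a \<rho> x") (auto simp: \<pi>_def attached_def)
  show ?thesis
  proof (rule that)
    show "\<pi> ` V \<subseteq> {..<9}"
      using \<pi>9 by auto
    show "\<bar>real (card {x\<in>V. \<pi> x = p}) - real (card V) / 9\<bar> \<le> \<kappa> * real (card V)" if p: "p < 9" for p
    proof -
      have pw: "part_weight V (\<lambda>_. 1) a \<rho> p = real (card {x\<in>V. attached a \<rho> p x})"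
        by (simp add: part_weight_def)
      have s_card: "s = real (card {x\<in>V. stray a \<rho> x})"
        using V(1) by (simp add: s_def Int_def)
      have "{x\<in>V. attached a \<rho> p x} \<subseteq> {x\<in>V. \<pi> x = p}"
        using \<pi> attached_unique [of a \<rho>] by (auto simp: stray_def)
      then have "card {x\<in>V. attached a \<rho> p x} \<le> card {x\<in>V. \<pi> x = p}"
        using V(1) by (intro card_mono) auto
      moreover have "{x\<in>V. \<pi> x = p} \<subseteq> {x\<in>V. attached a \<rho> p x} \<union> {x\<in>V. stray a \<rho> x}"
        using \<pi> by auto
      then have "card {x\<in>V. \<pi> x = p} \<le> card ({x\<in>V. attached a \<rho> p x} \<union> {x\<in>V. stray a \<rho> x})"
        using V(1) by (intro card_mono) auto
      then have "card {x\<in>V. \<pi> x = p} \<le> card {x\<in>V. attached a \<rho> p x} + card {x\<in>V. stray a \<rho> x}"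
        using card_Un_le [of "{x\<in>V. attached a \<rho> p x}" "{x\<in>V. stray a \<rho> x}"] by linarith
      ultimately have "\<bar>real (card {x\<in>V. \<pi> x = p}) - n / 9\<bar> \<le> 20 * (\<kappa> * n / 40 + 2 * s) + s"
        using N [OF p] unfolding pw s_card by linarith
      also have "\<dots> \<le> \<kappa> * n"
        using s by simp
      finally show ?thesis
        unfolding n_def .
    qed
    have "disagreement V a (\<lambda>x y. b9 (\<pi> x) (\<pi> y)) \<le>
      (\<Sum>x\<in>V. \<Sum>y\<in>V. of_bool (misjoined a \<rho> x y) + of_bool (stray a \<rho> x) + of_bool (stray a \<rho> y))"
      unfolding disagreement_def
    proof (intro sum_mono)
      fix x y
      show "of_bool (a x y \<noteq> b9 (\<pi> x) (\<pi> y)) \<le> (of_bool (misjoined a \<rho> x y) + of_bool (stray a \<rho> x) + of_bool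
          (stray a \<rho> y) :: real)"
        using \<pi> [of x] \<pi> [of y] by (auto simp: misjoined_def)
    qed
    also have "\<dots> = bad \<rho>"
      unfolding bad_def n_def by (simp add: sum.distrib sum_distrib_left mult.assoc)
    finally have "disagreement V a (\<lambda>x y. b9 (\<pi> x) (\<pi> y)) * n ^ 5 \<le> bad \<rho> * n ^ 5"
      using n by (intro mult_right_mono) auto
    with bad show "disagreement V a (\<lambda>x y. b9 (\<pi> x) (\<pi> y)) * real (card V) ^ 5 \<le> 460800 * slack_total V a"
      unfolding n_def [symmetric] S_def [symmetric] by linarith
  qed
qed

text \<open>
  With parts balanced up to this fraction of \<open>n\<close>, the loss \<open>2435 * gram_bound
  * d * n\<^sup>4\<close> per wrong pair in the comparison of the forms is half of the gain
  \<open>n\<^sup>5 / (21 * 460800)\<close> that the slack provides.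
\<close>

definition stability_radius :: real where
  "stability_radius = 1 / (2435 * gram_bound * 42 * 460800)"

text \<open>
  Compare the graph with the blowup \<open>h\<close> on the parts of \<open>near_blowup\<close>:
  the blowup has no slack, and the slack of the graph outweighs the change in the forms.
\<close>

theorem leaf_total_stability:
  assumes V: "finite V" "V \<noteq> {}" and a: "simple_adjacency a"
    and L: "(160 / 2187 - stability_radius\<^sup>2 / 10 ^ 15) * real (card V) ^ 6 \<le> leaf_total V (\<lambda>_. 1) a"
  obtains \<pi> where "\<pi> ` V \<subseteq> {..<9}"
    "disagreement V a (\<lambda>x y. b9 (\<pi> x) (\<pi> y)) * real (card V) ^ 4 \<le>
       787320 * 42 * 460800 * (leaf_total V (\<lambda>_. 1) (\<lambda>x y. b9 (\<pi> x) (\<pi> y)) - leaf_total V (\<lambda>_. 1) a)"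
proof -
  define n where "n = real (card V)"
  define \<kappa> where "\<kappa> = stability_radius"
  have n: "0 < n"
    using V by (simp add: n_def card_gt_0_iff)
  have M: "1 \<le> gram_bound"
    by (rule gram_bound_ge)
  have \<kappa>: "0 < \<kappa>" "\<kappa> \<le> 1"
    using M by (simp_all add: \<kappa>_def stability_radius_def field_simps)
  obtain \<pi> where \<pi>: "\<pi> ` V \<subseteq> {..<9}"
    and parts: "\<And>p. p < 9 \<Longrightarrow> \<bar>real (card {x\<in>V. \<pi> x = p}) - n / 9\<bar> \<le> \<kappa> * n"
    and S: "disagreement V a (\<lambda>x y. b9 (\<pi> x) (\<pi> y)) * n ^ 5 \<le> 460800 * slack_total V a"
    by (rule near_blowup [OF V a \<kappa> L [folded \<kappa>_def], folded n_def]) blast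
  define h where "h = (\<lambda>x y. b9 (\<pi> x) (\<pi> y))"
  define W where "W = disagreement V a h"
  have h: "simple_adjacency h"
    unfolding h_def by (unfold_locales) (simp_all add: b9.adj_irrefl b9.adj_sym)
  have W: "0 \<le> W"
    unfolding W_def disagreement_def by (intro sum_nonneg) auto
  have "slack7 h xs = 0" if xs: "xs \<in> tup V 7" for xs
  proof -
    have "pulls_back V \<pi> h b9"
      by (simp add: pulls_back_def h_def)
    then have "slack7 h xs = slack7 b9 (map \<pi> xs)"
      using xs by (rule slack7_pullback)
    also have "\<dots> = 0"
      using xs \<pi> by (intro slack7_b9) (auto simp: tup_def)
    finally show ?thesis .
  qed
  then have "slack_total V h = 0"
    by (simp add: slack_total_def)
  then have "787320 * n * (leaf_total V (\<lambda>_. 1) h - leaf_total V (\<lambda>_. 1) a) = gram_total V a - gram_total V h + slack_total V a / 21"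
    using deficit_identity [OF V(1), of a] deficit_identity [OF V(1), of h] unfolding n_def [symmetric]
    by (simp add: algebra_simps)
  moreover have "gram_total V h - 2435 * gram_bound * (\<kappa> * n) * n ^ 4 * W \<le> gram_total V a"
    using sum_gram_form_comparison [OF V(1) a \<pi> parts] \<kappa> n
    unfolding gram_total_def n_def [symmetric] h_def W_def by (simp add: mult_left_le_one_le)
  moreover have "2435 * gram_bound * (\<kappa> * n) * n ^ 4 * W = W * n ^ 5 / (42 * 460800)"
    using M by (simp add: \<kappa>_def stability_radius_def power_numeral_reduce)
  moreover have "W * n ^ 5 / (21 * 460800) \<le> slack_total V a / 21"
    using S unfolding W_def h_def by (simp add: field_simps)
  ultimately have "W * n ^ 5 / (42 * 460800) \<le> 787320 * n * (leaf_total V (\<lambda>_. 1) h - leaf_total V (\<lambda>_. 1) a)"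
    by linarith
  then have "n * (W * n ^ 4) \<le> n * (787320 * 42 * 460800 * (leaf_total V (\<lambda>_. 1) h - leaf_total V (\<lambda>_. 1) a))"
    by (simp add: power_numeral_reduce mult_ac)
  then have "W * n ^ 4 \<le> 787320 * 42 * 460800 * (leaf_total V (\<lambda>_. 1) h - leaf_total V (\<lambda>_. 1) a)"
    using n by simp
  then show ?thesis
    using that [OF \<pi>] unfolding W_def h_def n_def by blast
qed

section \<open>Perfect stability\<close>

text \<open>
  A list that counts for one graph only contains a pair in which the graphs disagree.  If it
  also has a repeated entry, then at most three entries are free besides that pair; hence the
  factor \<open>n\<^sup>3\<close>.
\<close>

lemma card_degenerate_F7_le_add:
  assumes G: "is_graph G" and H: "is_graph H" and V: "verts H = verts G"
  shows "real (card (degenerate_F7 H)) \<le> real (card (degenerate_F7 G)) +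
     375 * real (card (verts G)) ^ 3 * disagreement (verts G) (adj G) (adj H)"
proof -
  have fin: "finite (verts G)" using G by (simp add: is_graph_def)
  let ?K = "\<lambda>S. \<not> agree_on S (adj G) (adj H)"
  let ?D = "{ys \<in> tup (verts G) 6. \<not> distinct ys \<and> ?K (set ys)}"
  have "degenerate_F7 H \<subseteq> degenerate_F7 G \<union> ?D"
  proof
    fix ys assume ys: "ys \<in> degenerate_F7 H"
    have "F7_list (adj G) ys \<longleftrightarrow> F7_list (adj H) ys" if "agree_on (set ys) (adj G) (adj H)"
      using F7_list_pullback [of "set ys" id "adj G" "adj H" ys] that ys
      by (auto simp: agree_on_pulls_back degenerate_F7_def tup_def)
    with ys show "ys \<in> degenerate_F7 G \<union> ?D"
      unfolding degenerate_F7_def V by blast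
  qed
  then have "card (degenerate_F7 H) \<le> card (degenerate_F7 G \<union> ?D)"
    using fin by (intro card_mono) (auto simp: degenerate_F7_def)
  also have "\<dots> \<le> card (degenerate_F7 G) + card ?D"
    by (rule card_Un_le)
  also have "card ?D \<le> 15 * card {t \<in> tup (verts G) 5. ?K (set t)}"
    by (rule card_nondistinct_le [OF fin])
  finally have "real (card (degenerate_F7 H)) \<le> real (card (degenerate_F7 G)) + 15 * real (card {t \<in> tup (verts G) 5. ?K (set t)})"
    by linarith
  also have "15 * real (card {t \<in> tup (verts G) 5. ?K (set t)}) \<le>
      15 * (25 * real (card (verts G)) ^ 3 * disagreement (verts G) (adj G) (adj H))"
    using card_disagreeing_tuples_le [OF fin simple_adjacency_adj [OF G] simple_adjacency_adj [OF H]]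
    by (rule mult_left_mono) simp
  finally show ?thesis
    by simp
qed

text \<open>The ordered pairs counted by the disagreement cover every edited edge.\<close>

lemma edit_dist_le_disagreement:
  fixes G :: "'a pattern"
  assumes G: "is_graph G" and P: "blowup_parts B9 P" and V: "verts (blowup B9 P) = verts G"
  shows "real (edit_dist G B9) \<le> disagreement (verts G) (adj G) (adj (blowup B9 P))"
proof -
  define H where "H = blowup B9 P"
  define D where "D = {p \<in> verts G \<times> verts G. adj G (fst p) (snd p) \<noteq> adj H (fst p) (snd p)}"
  have H: "is_graph H"
    unfolding H_def by (rule is_graph_blowup_B9 [OF P])
  have fin: "finite (verts G)" using G by (simp add: is_graph_def)
  have "isomorphic H (blowup B9 P)"
    unfolding isomorphic_def H_def by (rule exI [of _ id]) (simp add: is_iso_def)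
  then have "edit_dist G B9 \<le> card ((edges G - edges H) \<union> (edges H - edges G))"
    unfolding edit_dist_def using H V P unfolding H_def by (intro Least_le) blast
  also have "\<dots> \<le> card ((\<lambda>(x, y). {x, y}) ` D)"
  proof (rule card_mono)
    show "finite ((\<lambda>(x, y). {x, y}) ` D)"
      using fin by (simp add: D_def)
    show "(edges G - edges H) \<union> (edges H - edges G) \<subseteq> (\<lambda>(x, y). {x, y}) ` D"
    proof
      fix e assume e: "e \<in> (edges G - edges H) \<union> (edges H - edges G)"
      have ends: "\<exists>x\<in>verts G'. \<exists>y\<in>verts G'. e = {x, y}" if "is_graph G'" "e \<in> edges G'" for G' :: "'a pattern"
        using that unfolding is_graph_def by blast
      have "verts H = verts G"
        using V by (simp add: H_def)
      then obtain x y where "x \<in> verts G" "y \<in> verts G" "e = {x, y}"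
        using e ends [OF G] ends [OF H] by (metis DiffD1 UnE)
      with e show "e \<in> (\<lambda>(x, y). {x, y}) ` D"
        by (intro image_eqI [of _ _ "(x, y)"]) (auto simp: D_def adj_def)
    qed
  qed
  also have "\<dots> \<le> card D"
    using fin by (intro card_image_le) (simp add: D_def)
  also have "real (card D) = disagreement (verts G) (adj G) (adj H)"
    unfolding disagreement_def sum.cartesian_product using fin by (simp add: D_def Int_def case_prod_unfold)
  finally show ?thesis
    unfolding H_def by simp
qed

lemma edit_dist_le_square:
  assumes G: "is_graph G"
  shows "real (edit_dist G B9) \<le> (real (card (verts G)))\<^sup>2"
proof -
  define P where "P i = (if i = 0 then verts G else {})" for i :: nat
  have P: "blowup_parts B9 P"
    using G by (auto simp: blowup_parts_def is_graph_def disjoint_family_on_def P_def)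
  have V: "verts (blowup B9 P) = verts G"
    unfolding verts_blowup_B9 by (auto simp: P_def split: if_splits)
  have "disagreement (verts G) (adj G) (adj (blowup B9 P)) \<le> (\<Sum>x\<in>verts G. \<Sum>y\<in>verts G. 1)"
    unfolding disagreement_def by (intro sum_mono) auto
  then show ?thesis
    using edit_dist_le_disagreement [OF G P V] by (simp add: power2_eq_square)
qed

lemma leaf_total_cong_adj:
  assumes "pulls_back V id a h"
  shows "leaf_total V w a = leaf_total V w h"
  unfolding leaf_total_def using leaf_pullback [OF assms]
  by (intro sum.cong refl) (auto simp: tup_def)

lemma disagreement_cong:
  assumes "pulls_back V id h h'"
  shows "disagreement V a h = disagreement V a h'"
  unfolding disagreement_def using assms by (intro sum.cong refl) (auto simp: pulls_back_def)

text \<open>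
  If the deficit is bounded below, then any edit distance is affordable.  Otherwise
  \<open>leaf_total_stability\<close> applies, and for large \<open>n\<close> its gain of order
  \<open>n\<^sup>4\<close> per wrong pair absorbs the error of order \<open>n\<^sup>3\<close>
  from lists with repeated entries.
\<close>

theorem perfectly_stable_F7_B9: "perfectly_stable F7 B9"
proof -
  define \<epsilon> where "\<epsilon> = stability_radius\<^sup>2 / 10 ^ 15"
  define K :: real where "K = 787320 * 42 * 460800"
  have sr: "0 < stability_radius" "stability_radius \<le> 1"
    using gram_bound_ge(1) by (simp_all add: stability_radius_def field_simps)
  then have "stability_radius\<^sup>2 \<le> 1"
    by (simp add: power_le_one)
  then have \<epsilon>: "0 < \<epsilon>" "\<epsilon> \<le> 1 / 10 ^ 15"
    using sr by (simp_all add: \<epsilon>_def)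
  have "\<forall>\<^sub>F n in sequentially. 160 / 729 - \<epsilon> < max_density F7 n"
    using max_density_F7_tendsto \<epsilon>(1) by (intro order_tendstoD(1) [of _ "160 / 729"]) auto
  then obtain n0 where n0: "\<And>n. n0 \<le> n \<Longrightarrow> 160 / 729 - \<epsilon> < max_density F7 n"
    unfolding eventually_sequentially by blast
  have "\<forall>\<^sub>F n in sequentially. (1 - \<epsilon>) / 720 < real (n choose 6) / real n ^ 6"
    using \<epsilon>(1) by (intro order_tendstoD(1) [OF tendsto_choose_6]) auto
  then obtain n1 where n1: "\<And>n. n1 \<le> n \<Longrightarrow> (1 - \<epsilon>) / 720 < real (n choose 6) / real n ^ 6"
    unfolding eventually_sequentially by blast
  \<comment> \<open>The entries make \<open>n\<close> large enough for the two limits, for absorbing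
    the error of order \<open>n\<^sup>3\<close> and for six vertices, and \<open>C\<close> large
    enough for the two cases.\<close>
  define C where "C = Max {real n0, real n1, 375 * K, 1 / \<epsilon>, K, 6}"
  have C: "real n0 \<le> C" "real n1 \<le> C" "375 * K \<le> C" "1 / \<epsilon> \<le> C" "K \<le> C" "6 \<le> C"
    unfolding C_def by (rule Max_ge; simp)+
  have arith: "3 * q \<le> K * (720 * fh - 720 * fg + e)"
    if "q \<le> K * (lh - lg)" "3 * lg = 720 * fg + dg" "3 * lh = 720 * fh + dh" "dh \<le> dg + e" for q lh lg fg fh dg dh e
  proof -
    have "3 * q \<le> K * (3 * lh - 3 * lg)"
      using that(1) by (simp add: right_diff_distrib)
    also have "\<dots> \<le> K * (720 * fh - 720 * fg + e)"
      using that(2-4) by (intro mult_left_mono) (auto simp: K_def)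
    finally show ?thesis .
  qed
  have "real (edit_dist G B9) \<le> C * (max_density F7 (card (verts G)) - density F7 G) * (real (card (verts G)))\<^sup>2"
    if G: "is_graph G" and nC: "C \<le> real (card (verts G))" for G :: "nat pattern"
  proof -
    define V where "V = verts G"
    define N where "N = card V"
    define n where "n = real N"
    define gap where "gap = max_density F7 N - density F7 G"
    have fin: "finite V"
      using G by (simp add: V_def is_graph_def)
    have n: "6 \<le> n" "n0 \<le> N" "n1 \<le> N" "375 * K \<le> n"
      using nC C unfolding n_def N_def V_def by linarith+
    have "V \<noteq> {}"
      using n(1) by (auto simp: n_def N_def)
    have gap0: "0 \<le> gap"
      using density_le_max_density [OF G] by (simp add: gap_def N_def V_def)
    have choose_le: "720 * real (N choose 6) \<le> n ^ 6"
      using of_nat_mono [OF binomial_fact_pow [of N 6], where 'a = real] by (simp add: n_def fact_numeral)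
    have choose_pos: "0 < real (N choose 6)"
      using n(1) by (simp add: n_def)
    have "real (edit_dist G B9) \<le> C * gap * n\<^sup>2"
    proof (cases "\<epsilon> \<le> gap")
      case True
      have "1 \<le> C * gap"
      proof -
        have "1 = 1 / \<epsilon> * \<epsilon>" using \<epsilon> by simp
        also have "\<dots> \<le> C * gap"
          using C True \<epsilon> by (intro mult_mono) auto
        finally show ?thesis .
      qed
      then have "1 * n\<^sup>2 \<le> C * gap * n\<^sup>2"
        by (intro mult_right_mono) auto
      then show ?thesis
        using edit_dist_le_square [OF G] unfolding n_def N_def V_def by linarith
    next
      case False
      have dens: "160 / 729 - 2 * \<epsilon> \<le> density F7 G"
        using False n0 [OF n(2)] unfolding gap_def by linarith
      have L: "(160 / 2187 - \<epsilon>) * n ^ 6 \<le> leaf_total V (\<lambda>_. 1) (adj G)"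
      proof -
        have "(1 - \<epsilon>) * n ^ 6 \<le> 720 * real (N choose 6)"
          using n1 [OF n(3)] n(1) unfolding n_def [symmetric] by (simp add: field_simps)
        moreover have "0 \<le> density F7 G" "0 \<le> (1 - \<epsilon>) * n ^ 6"
          using \<epsilon> n(1) unfolding density_F7 by simp_all
        ultimately have "(160 / 729 - 2 * \<epsilon>) * ((1 - \<epsilon>) * n ^ 6) \<le> density F7 G * (720 * real (N choose 6))"
          by (intro mult_mono [OF dens])
        also have "\<dots> = 720 * real (card (F7_sets G))"
          using choose_pos unfolding density_F7 N_def V_def by simp
        also have "\<dots> \<le> 3 * leaf_total V (\<lambda>_. 1) (adj G)"
          using leaf_total_eq_F7_sets [OF G] unfolding V_def by simp
        finally have "(160 / 729 - 2 * \<epsilon>) * (1 - \<epsilon>) * n ^ 6 \<le> 3 * leaf_total V (\<lambda>_. 1) (adj G)"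
          by (simp add: mult.assoc)
        moreover have "(160 / 729 - 3 * \<epsilon>) * n ^ 6 \<le> (160 / 729 - 2 * \<epsilon>) * (1 - \<epsilon>) * n ^ 6"
        proof (rule mult_right_mono)
          have "(p - 2 * \<epsilon>) * (1 - \<epsilon>) = p - 3 * \<epsilon> + (1 - p + 2 * \<epsilon>) * \<epsilon>" for p
            by (simp add: algebra_simps)
          moreover have "0 \<le> (1 - 160 / 729 + 2 * \<epsilon>) * \<epsilon>"
            using \<epsilon> by (intro mult_nonneg_nonneg) auto
          ultimately show "160 / 729 - 3 * \<epsilon> \<le> (160 / 729 - 2 * \<epsilon>) * (1 - \<epsilon>)"
            by simp
        qed (use n(1) in auto)
        ultimately show ?thesis
          by (simp add: left_diff_distrib)
      qed
      obtain \<pi> where \<pi>: "\<pi> ` V \<subseteq> {..<9}"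
        and W: "disagreement V (adj G) (\<lambda>x y. b9 (\<pi> x) (\<pi> y)) * n ^ 4 \<le>
          K * (leaf_total V (\<lambda>_. 1) (\<lambda>x y. b9 (\<pi> x) (\<pi> y)) - leaf_total V (\<lambda>_. 1) (adj G))"
        by (rule leaf_total_stability [OF fin \<open>V \<noteq> {}\<close> simple_adjacency_adj [OF G] L [unfolded n_def N_def
            \<epsilon>_def], folded N_def n_def K_def]) blast
      define P where "P p = {x\<in>V. \<pi> x = p}" for p
      define H where "H = blowup B9 P"
      have P: "blowup_parts B9 P"
        using fin by (auto simp: blowup_parts_def disjoint_family_on_def P_def)
      have VH: "verts H = V"
        unfolding H_def verts_blowup_B9 using \<pi> by (auto simp: P_def)
      have H: "is_graph H"
        unfolding H_def by (rule is_graph_blowup_B9 [OF P])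
      have pb: "pulls_back V id (\<lambda>x y. b9 (\<pi> x) (\<pi> y)) (adj H)"
        unfolding pulls_back_def H_def
      proof (intro ballI)
        fix x y assume "x \<in> V" "y \<in> V"
        then show "b9 (\<pi> x) (\<pi> y) \<longleftrightarrow> adj (blowup B9 P) (id x) (id y)"
          using adj_blowup_B9 [OF P, of x "\<pi> x" y "\<pi> y"] \<pi> by (auto simp: P_def)
      qed
      define D where "D = disagreement V (adj G) (adj H)"
      have D0: "0 \<le> D"
        unfolding D_def disagreement_def by (intro sum_nonneg) auto
      have "D * n ^ 4 \<le> K * (leaf_total V (\<lambda>_. 1) (adj H) - leaf_total V (\<lambda>_. 1) (adj G))"
        using W unfolding D_def leaf_total_cong_adj [OF pb] disagreement_cong [OF pb] .
      moreover have "3 * leaf_total V (\<lambda>_. 1) (adj G) = 720 * real (card (F7_sets G)) + real (card (degenerate_F7 G))"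
        "3 * leaf_total V (\<lambda>_. 1) (adj H) = 720 * real (card (F7_sets H)) + real (card (degenerate_F7 H))"
        using leaf_total_eq_F7_sets [OF G] leaf_total_eq_F7_sets [OF H] unfolding VH V_def by simp_all
      moreover have "real (card (degenerate_F7 H)) \<le> real (card (degenerate_F7 G)) + 375 * n ^ 3 * D"
        using card_degenerate_F7_le_add [OF G H] VH unfolding D_def n_def N_def V_def by simp
      ultimately have "3 * (D * n ^ 4) \<le> K * (720 * real (card (F7_sets H)) - 720 * real (card (F7_sets G)) + 375 * n ^ 3 * D)"
        by (rule arith)
      also have "\<dots> = K * (720 * real (N choose 6) * (density F7 H - density F7 G)) + 375 * K * (n ^ 3 * D)"
        using choose_pos VH unfolding density_F7 N_def V_def by (simp add: algebra_simps)
      also have "\<dots> \<le> K * (n ^ 6 * gap) + n * (n ^ 3 * D)"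
      proof (intro add_mono mult_left_mono mult_right_mono)
        have "density F7 H - density F7 G \<le> gap"
          using density_le_max_density [OF H] VH by (simp add: gap_def N_def)
        then have "720 * real (N choose 6) * (density F7 H - density F7 G) \<le> 720 * real (N choose 6) * gap"
          by (intro mult_left_mono) auto
        also have "\<dots> \<le> n ^ 6 * gap"
          using choose_le gap0 by (rule mult_right_mono)
        finally show "720 * real (N choose 6) * (density F7 H - density F7 G) \<le> n ^ 6 * gap" .
      qed (use n D0 in \<open>auto simp: K_def\<close>)
      finally have "n ^ 4 * (2 * D) \<le> n ^ 4 * (K * gap * n\<^sup>2)"
        by (simp add: power_numeral_reduce mult_ac)
      then have "2 * D \<le> K * gap * n\<^sup>2"
        using n(1) by simp
      moreover have "K * gap * n\<^sup>2 \<le> C * gap * n\<^sup>2"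
        using C(5) gap0 by (intro mult_right_mono) auto
      moreover have "real (edit_dist G B9) \<le> D"
        using edit_dist_le_disagreement [OF G P] VH unfolding D_def H_def V_def by simp
      ultimately show ?thesis
        using D0 by linarith
    qed
    then show ?thesis
      unfolding gap_def n_def N_def V_def .
  qed
  then show ?thesis
    unfolding perfectly_stable_def using C by (intro exI [of _ C]) auto
qed

theorem theorem3p4:
  shows "(convergent (\<lambda>n. max_density F7 n) \<and> inducibility F7 = 160 / 729)
    \<and> perfectly_stable F7 B9
    \<and> unique_maximiser_up_to_aut F7 9 B9 (\<lambda>i. 1 / 9)"
  using max_density_F7_tendsto perfectly_stable_F7_B9 unique_maximiser_F7_B9
  unfolding inducibility_def convergent_def by (blast intro: limI)

end
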